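(* Let $g_1,\dots,g_k\in\mathcal{O}_{\mathbb{C}^n,0}$ be convenient germs defining a complete intersection $(Y,0)$ in $(\mathbb{C}^n,0)$, and let $p_1,\dots,p_r$, $\nu_1,\dots,\nu_k\in\mathbb{N}^r$, the initial parts $in_{j_1,\dots,j_s}g_i$, the multi-index filtrations $F_\mu$ and the Poincaré series $P$ be as defined in the context. Assume that for all $s\ge 1$ and all $1\le j_1<\dots<j_s\le r$ the functions $in_{j_1,\dots,j_s}g_1,\dots,in_{j_1,\dots,j_s}g_k$ define a subspace of $(\mathbb{C}^n,0)$ of codimension $\ge k-s+1$. Then $$P_{\mathcal{O}_{Y,0}}(t)=(1-t^{\nu_1})\cdots(1-t^{\nu_k})\,P_{\mathcal{O}_{\mathbb{C}^n,0}}(t).$$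
   Context: Notation: $\mathbb{N}=\{0,1,2,\dots\}$, $\mathbb{R}_+=[0,\infty)$, $\langle\cdot,\cdot\rangle$ is the standard scalar product, $z^q=z_1^{q_1}\cdots z_n^{q_n}$, $t^\mu=t_1^{\mu_1}\cdots t_r^{\mu_r}$, $\mathbf{1}=(1,\dots,1)\in\mathbb{Z}^r$. $\mathcal{O}_{\mathbb{C}^n,0}$ is the ring of germs of holomorphic functions at $0$. A germ $g$ is convenient if for every $i\in\{1,\dots,n\}$ some monomial $z_i^m$, $m\ge1$, occurs in $g$ (i.e. has nonzero coefficient). Setting: $g_1,\dots,g_k$ are convenient germs vanishing at $0$ which define a complete intersection $(Y,0)$ of dimension $n-k$, $\mathcal{O}_{Y,0}=\mathcal{O}_{\mathbb{C}^n,0}/(g_1,\dots,g_k)$. Let $\Delta$ be the convex hull of $\mathrm{supp}(g_1\cdots g_k)+\mathbb{R}_+^n$. Let $p_1,\dots,p_r\in\mathbb{N}^n$ be the vectors with relatively prime components orthogonal to the compact facets (one-codimensional faces) of $\Delta$. Let $\nu_{jl}$ be the maximal integer with $\langle p_l,q\rangle\ge\nu_{jl}$ for all monomials $z^q$ occurring in $g_j$, and $\nu_j=(\nu_{j1},\dots,\nu_{jr})$. Initial parts: if $g_i=\sum_q c_{iq}z^q$, then $in_{j_1,\dots,j_s}g_i$ is the sum of $c_{iq}z^q$ over those $q$ with $\langle p_{j_1},q\rangle=\nu_{ij_1},\dots,\langle p_{j_s},q\rangle=\nu_{ij_s}$ (it may be $0$; a codimension bound $\ge c$ with $c\le0$ is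 no condition). Filtrations: for $\mu\in\mathbb{Z}^r$, $F_\mu\mathcal{O}_{\mathbb{C}^n,0}$ is the ideal generated by all $z^q$ with $\langle p_l,q\rangle\ge\mu_l$ for all $l=1,\dots,r$, and $F_\mu\mathcal{O}_{Y,0}$ is the image of $F_\mu\mathcal{O}_{\mathbb{C}^n,0}$ in $\mathcal{O}_{Y,0}$. Poincaré series: for such a filtration put $L(t)=\sum_{\mu\in\mathbb{Z}^r}\dim_{\mathbb{C}}(F_\mu/F_{\mu+\mathbf{1}})\,t^\mu$ and $P(t)=\frac{(t_1-1)\cdots(t_r-1)}{t_1\cdots t_r-1}L(t)$. (Here $(t_1-1)\cdots(t_r-1)L(t)$ is a power series with exponents in $\mathbb{N}^r$, which is then divided by the invertible power series $t_1\cdots t_r-1$.) One has $P_{\mathcal{O}_{\mathbb{C}^n,0}}(t)=\prod_{l=1}^n\frac{1}{1-t^{p^l}}$ with $p^l=(p_{1l},\dots,p_{rl})$, where $p_{jl}$ is the $l$-th component of $p_j$. *)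

theory Defs
  imports "HOL-Analysis.Analysis" "HOL-Algebra.Algebra" "HOL-Library.Poly_Mapping"
begin

text \<open>A germ at \<open>0\<close> of a holomorphic function on \<open>\<complex>\<^sup>n\<close> is given by its Taylor series, so
  \<open>\<O>\<close> is the ring of convergent power series. A series is its coefficient function;
  the dimension \<open>n\<close> is the cardinality of the index type.\<close>

type_synonym 'n series = "nat ^ 'n \<Rightarrow> complex"

definition monom_val :: "complex ^ 'n \<Rightarrow> nat ^ 'n \<Rightarrow> complex" where
  "monom_val z q = (\<Prod>i\<in>UNIV. (z $ i) ^ (q $ i))"

definition convergent_series :: "'n::finite series \<Rightarrow> bool" where
  "convergent_series c \<longleftrightarrow>
     (\<exists>\<epsilon>>0. \<forall>z. norm z < \<epsilon> \<longrightarrow> (\<lambda>q. c q * monom_val z q) summable_on UNIV)"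

definition \<O> :: "'n::finite series ring" where
  "\<O> = \<lparr> carrier = {c. convergent_series c},
         monoid.mult = (\<lambda>f g q. \<Sum>(a, b) \<in> {(a, b). a + b = q}. f a * g b),
         monoid.one = (\<lambda>q. if q = 0 then 1 else 0),
         ring.zero = (\<lambda>q. 0),
         ring.add = (\<lambda>f g q. f q + g q) \<rparr>"

definition monomial :: "nat ^ 'n \<Rightarrow> 'n series" where
  "monomial q = (\<lambda>q'. if q' = q then 1 else 0)"

definition constants :: "'n::finite series set" where
  "constants = {\<lambda>q. if q = 0 then a else 0 | a. True}"

definition supp :: "'n series \<Rightarrow> (nat ^ 'n) set" where
  "supp g = {q. g q \<noteq> 0}"

definition convenient :: "'n::finite series \<Rightarrow> bool" where
  "convenient g \<longleftrightarrow> (\<forall>i. \<exists>m\<ge>1. axis i m \<in> supp g)"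

definition prime_chain :: "('a, 'b) ring_scheme \<Rightarrow> nat \<Rightarrow> (nat \<Rightarrow> 'a set) \<Rightarrow> bool" where
  "prime_chain R m P \<longleftrightarrow> (\<forall>i\<le>m. primeideal (P i) R) \<and> (\<forall>i<m. P i \<subset> P (Suc i))"

text \<open>The dimension of the analytic space germ defined by an ideal is the Krull dimension of
  its local ring. The supremum in \<^typ>\<open>ereal\<close> gives the zero ring (the empty space) dimension
  \<open>-\<infinity>\<close>, hence codimension \<open>\<infinity>\<close>.\<close>

definition krull_dim :: "('a, 'b) ring_scheme \<Rightarrow> ereal" where
  "krull_dim R = (SUP m \<in> {m. \<exists>P. prime_chain R m P}. ereal (real m))"

definition local_ring :: "'n::finite series set \<Rightarrow> 'n series set ring" where
  "local_ring G = \<O> Quot (Idl\<^bsub>\<O>\<^esub> G)"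

definition codim :: "'n::finite series set \<Rightarrow> ereal" where
  "codim G = ereal (real CARD('n)) - krull_dim (local_ring G)"

definition complete_intersection :: "nat \<Rightarrow> (nat \<Rightarrow> 'n::finite series) \<Rightarrow> bool" where
  "complete_intersection k g \<longleftrightarrow>
     krull_dim (local_ring (g ` {1..k})) = ereal (real CARD('n) - real k)"

definition real_vec :: "nat ^ 'n \<Rightarrow> real ^ 'n" where
  "real_vec q = (\<chi> i. real (q $ i))"

definition newton_polyhedron :: "'n::finite series \<Rightarrow> (real ^ 'n) set" where
  "newton_polyhedron f = convex hull {real_vec q + x | q x. q \<in> supp f \<and> (\<forall>i. 0 \<le> x $ i)}"

text \<open>\<open>Gcd = 1\<close> also excludes the zero vector. When \<open>n = 1\<close> a compact facet is a point, every
  vector is orthogonal to it, and primitivity leaves \<open>p = 1\<close>.\<close>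

definition facet_normals :: "(real ^ 'n::finite) set \<Rightarrow> (nat ^ 'n) set" where
  "facet_normals D = {p. Gcd (range (($) p)) = 1 \<and>
     (\<exists>T. T facet_of D \<and> compact T \<and> (\<forall>x\<in>T. \<forall>y\<in>T. real_vec p \<bullet> (x - y) = 0))}"

definition weight :: "nat ^ 'n \<Rightarrow> nat ^ 'n \<Rightarrow> int" where
  "weight p q = (\<Sum>i\<in>UNIV. int (p $ i) * int (q $ i))"

definition order_vec :: "('r::finite \<Rightarrow> nat ^ 'n) \<Rightarrow> 'n series \<Rightarrow> int ^ 'r" where
  "order_vec p g = (\<chi> l. GREATEST m. \<forall>q\<in>supp g. m \<le> weight (p l) q)"

definition initial_part :: "('r::finite \<Rightarrow> nat ^ 'n) \<Rightarrow> 'r set \<Rightarrow> 'n series \<Rightarrow> 'n series" where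
  "initial_part p J g = (\<lambda>q. if \<forall>l\<in>J. weight (p l) q = order_vec p g $ l then g q else 0)"

definition filt :: "('r::finite \<Rightarrow> nat ^ 'n) \<Rightarrow> int ^ 'r \<Rightarrow> 'n::finite series set" where
  "filt p \<mu> = Idl\<^bsub>\<O>\<^esub> {monomial q | q. \<forall>l. \<mu> $ l \<le> weight (p l) q}"

definition residue_class :: "'n::finite series set \<Rightarrow> 'n series \<Rightarrow> 'n series set" where
  "residue_class G f = Idl\<^bsub>\<O>\<^esub> G +>\<^bsub>\<O>\<^esub> f"

text \<open>Laurent polynomials in \<open>t\<^sub>1, \<dots>, t\<^sub>r\<close> are finitely supported functions on \<open>\<int>\<^sup>r\<close>; they act on
  formal sums \<open>\<Sum>\<^sub>\<mu> B(\<mu>) t\<^sup>\<mu>\<close> over all of \<open>\<int>\<^sup>r\<close> by convolution.\<close>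

abbreviation tpow :: "int ^ 'r::finite \<Rightarrow> (int ^ 'r) \<Rightarrow>\<^sub>0 int" where
  "tpow \<nu> \<equiv> Poly_Mapping.single \<nu> 1"

definition lmult :: "((int ^ 'r::finite) \<Rightarrow>\<^sub>0 int) \<Rightarrow> (int ^ 'r \<Rightarrow> int) \<Rightarrow> (int ^ 'r \<Rightarrow> int)" (infixr "\<star>" 70)
  where "a \<star> B = (\<lambda>\<mu>. \<Sum>\<nu>\<in>Poly_Mapping.keys a. Poly_Mapping.lookup a \<nu> * B (\<mu> - \<nu>))"

text \<open>\<open>dim\<^sub>\<complex> (V/W)\<close> for ideals \<open>W \<subseteq> V\<close> of \<open>R\<close>: the space \<open>V/W\<close> lies in the ring \<open>R/W\<close>, and \<open>K\<close>,
  the copy of the field \<open>\<complex>\<close> in \<open>R\<close>, acts through its image there.\<close>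

definition quot_dim :: "('a, 'b) ring_scheme \<Rightarrow> 'a set \<Rightarrow> 'a set \<Rightarrow> 'a set \<Rightarrow> nat" where
  "quot_dim R K V W = ring.dim (R Quot W) ((+>\<^bsub>R\<^esub>) W ` K) ((+>\<^bsub>R\<^esub>) W ` V)"

definition L_series ::
  "('a, 'b) ring_scheme \<Rightarrow> 'a set \<Rightarrow> (int ^ 'r::finite \<Rightarrow> 'a set) \<Rightarrow> (int ^ 'r \<Rightarrow> int)" where
  "L_series R K F = (\<lambda>\<mu>. int (quot_dim R K (F \<mu>) (F (\<mu> + 1))))"

definition power_series :: "(int ^ 'r::finite \<Rightarrow> int) \<Rightarrow> bool" where
  "power_series B \<longleftrightarrow> (\<forall>\<mu>. B \<mu> \<noteq> 0 \<longrightarrow> (\<forall>l. 0 \<le> \<mu> $ l))"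

text \<open>The quotient by \<open>t\<^sub>1\<cdots>t\<^sub>r - 1\<close> (here \<open>tpow 1 - 1\<close>, since \<open>1 :: int ^ 'r\<close> is the all-ones
  vector) is taken in the ring of formal power series, where this element is invertible.\<close>

definition poincare ::
  "('a, 'b) ring_scheme \<Rightarrow> 'a set \<Rightarrow> (int ^ 'r::finite \<Rightarrow> 'a set) \<Rightarrow> (int ^ 'r \<Rightarrow> int)" where
  "poincare R K F = (THE P. power_series P \<and>
     (tpow 1 - 1) \<star> P = (\<Prod>l\<in>UNIV. tpow (axis l 1) - 1) \<star> L_series R K F)"

definition poincare_ambient :: "('r::finite \<Rightarrow> nat ^ 'n::finite) \<Rightarrow> (int ^ 'r \<Rightarrow> int)" where
  "poincare_ambient p = poincare \<O> constants (filt p)"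

definition poincare_quot ::
  "('r::finite \<Rightarrow> nat ^ 'n::finite) \<Rightarrow> 'n series set \<Rightarrow> (int ^ 'r \<Rightarrow> int)" where
  "poincare_quot p G =
     poincare (local_ring G) (residue_class G ` constants) (\<lambda>\<mu>. residue_class G ` filt p \<mu>)"

end

theory Submission
  imports Defs
begin

text \<open>Let \<open>E\<^sub>\<mu>\<close> be the quotient of the levels \<open>\<mu>\<close> and \<open>\<mu> + 1\<close> of the filtration of \<open>\<O>\<close>. If multiplication by
  the \<open>g\<^sub>j\<close>, which raises levels by \<open>\<nu>\<^sub>j\<close>, makes the sum of all \<open>E\<^sub>\<mu>\<close> a module on which \<open>g\<^sub>1, \<dots>, g\<^sub>k\<close> is
  a regular sequence, and if an element of the ideal \<open>(g\<^sub>1, \<dots>, g\<^sub>k)\<close> of level \<open>\<mu>\<close> is a combination of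
  the \<open>g\<^sub>j\<close> with coefficients of level \<open>\<mu> - \<nu>\<^sub>j\<close>, then already the series of the dimensions of the
  graded pieces is multiplied by the factors \<open>1 - t\<^bsup>\<nu>\<^sub>j\<^esup>\<close>. Both properties amount to moving a Koszul
  chain whose boundary lies in a higher level to that level by a boundary, and the obstruction to
  raising the level in a direction \<open>l\<close> is a Koszul cycle for the initial parts in the direction \<open>l\<close>.
  Hence one shows by downward induction on \<open>J\<close> that the filtered Koszul complex of the initial parts
  in the directions \<open>J\<close> is exact in degrees \<open>\<ge> card J\<close>: forgetting the filtration, a cycle bounds by
  the codimension hypothesis, and the bounding chain is moved to the right level by the induction
  hypothesis.

  The codimension hypothesis enters through depth. If the ring modulo an ideal has no prime chain of
  length greater than \<open>d\<close>, Kronecker's theorem in Coquand's form, for which no Noetherian hypothesis is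
  needed, gives \<open>d\<close> elements of the maximal ideal which together with the ideal generate a power of
  every variable. Powers of the variables form a regular sequence, so the Koszul complex of the
  enlarged system is exact above the expected degree, and the added elements can be
  removed again by a Nakayama argument, which in the complete ring of formal power series only
  uses convergence.\<close>

section \<open>Formal power series in several variables\<close>

text \<open>The bound \<open>k - s + 1\<close> is what the induction on \<open>J\<close> consumes.
  It makes the Koszul homology of the \<open>k\<close> initial parts vanish in degrees
  \<open>\<ge> s\<close>. To correct the level of a chain of degree \<open>i + 1\<close> that bounds
  a cycle of degree \<open>i\<close>, exactness in degree \<open>i + 1\<close> for one more
  direction is used, so each further direction may cost one unit of codimension. The graded
  statements at the end only use degree 1 and single directions \<open>J = {m}\<close>.

  The two rings have different roles. Krull dimension is given in \<open>\<O>\<close>, but the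
  Nakayama argument produces infinite sums of chains without control over radii of convergence;
  hence homology is computed over formal series, where Krull dimension never occurs. Ideal
  membership passes from \<open>\<O>\<close> to formal series. The way back is possible because the
  weights are positive: a graded piece involves only finitely many monomials, and coefficients can
  be truncated to polynomials.

  Accordingly \<open>mps\<close> carries the Cauchy product as type class multiplication, and
  \<open>\<O>\<close> is the image of \<open>convergent_mps\<close> under \<open>cf\<close>.\<close>

typedef 'n mps = "UNIV :: (nat ^ 'n \<Rightarrow> complex) set"
  morphisms cf Ms by simp

lemma cf_Ms [simp]: "cf (Ms f) = f"
  by (simp add: Ms_inverse)

lemma Ms_cf [simp]: "Ms (cf f) = f"
  by (simp add: cf_inverse)

lemma mps_eqI: "(\<And>q. cf f q = cf g q) \<Longrightarrow> f = g"
  by (metis Ms_cf ext)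

definition splits :: "nat ^ 'n \<Rightarrow> ((nat ^ 'n) \<times> (nat ^ 'n)) set" where
  "splits q = {(a, b). a + b = q}"

lemma finite_le_vec: "finite {a :: nat ^ 'n::finite. a \<le> q}"
proof -
  have "finite (Pi\<^sub>E (UNIV :: 'n set) (\<lambda>i. {..q $ i}))"
    by (intro finite_PiE) auto
  then have "finite ((\<lambda>h. vec_lambda h) ` Pi\<^sub>E (UNIV :: 'n set) (\<lambda>i. {..q $ i}))"
    by (rule finite_imageI)
  moreover have "{a. a \<le> q} \<subseteq> (\<lambda>h. vec_lambda h) ` Pi\<^sub>E (UNIV :: 'n set) (\<lambda>i. {..q $ i})"
  proof
    fix a assume "a \<in> {a. a \<le> q}"
    then have "(\<lambda>i. a $ i) \<in> Pi\<^sub>E (UNIV :: 'n set) (\<lambda>i. {..q $ i})"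
      by (auto simp: less_eq_vec_def)
    then show "a \<in> (\<lambda>h. vec_lambda h) ` Pi\<^sub>E (UNIV :: 'n set) (\<lambda>i. {..q $ i})"
      by (metis image_eqI vec_nth_inverse)
  qed
  ultimately show ?thesis by (rule rev_finite_subset)
qed

lemma finite_splits [simp]: "finite (splits (q :: nat ^ 'n::finite))"
proof (rule finite_subset)
  show "splits q \<subseteq> {a. a \<le> q} \<times> {a. a \<le> q}"
    by (auto simp: splits_def less_eq_vec_def)
qed (simp add: finite_le_vec)

instantiation mps :: (finite) comm_ring_1
begin

definition zero_mps_def: "0 = Ms (\<lambda>q. 0)"
definition one_mps_def: "1 = Ms (\<lambda>q. if q = 0 then 1 else 0)"
definition plus_mps_def: "f + g = Ms (\<lambda>q. cf f q + cf g q)"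
definition minus_mps_def: "f - g = Ms (\<lambda>q. cf f q - cf g q)"
definition uminus_mps_def: "- f = Ms (\<lambda>q. - cf f q)"
definition times_mps_def: "f * g = Ms (\<lambda>q. \<Sum>(a, b)\<in>splits q. cf f a * cf g b)"

instance
proof
  fix f g h :: "'a mps"
  show "f + g + h = f + (g + h)" by (simp add: plus_mps_def add.assoc)
  show "f + g = g + f" by (simp add: plus_mps_def add.commute)
  show "0 + f = f" by (simp add: plus_mps_def zero_mps_def)
  show "- f + f = 0" by (simp add: plus_mps_def zero_mps_def uminus_mps_def)
  show "f - g = f + - g" by (simp add: plus_mps_def minus_mps_def uminus_mps_def)
  show "(0 :: 'a mps) \<noteq> 1" by (auto simp: zero_mps_def one_mps_def Ms_inject fun_eq_iff)
  show "(f + g) * h = f * h + g * h"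
    by (simp add: plus_mps_def times_mps_def distrib_right sum.distrib case_prod_unfold)
  show "f * g = g * f"
  proof (rule mps_eqI)
    fix q
    show "cf (f * g) q = cf (g * f) q"
      unfolding times_mps_def cf_Ms
      by (rule sum.reindex_bij_witness[where i = prod.swap and j = prod.swap])
        (auto simp: splits_def add.commute)
  qed
  show "1 * f = f"
  proof (rule mps_eqI)
    fix q
    have "(\<Sum>(a, b)\<in>splits q. cf 1 a * cf f b) = (\<Sum>(a, b)\<in>{(0, q)}. cf 1 a * cf f b)"
      by (rule sum.mono_neutral_right[OF finite_splits])
        (auto simp: one_mps_def splits_def split: if_splits)
    then show "cf (1 * f) q = cf f q"
      by (simp add: times_mps_def one_mps_def)
  qed
  show "f * g * h = f * (g * h)"
  proof (rule mps_eqI)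
    fix q
    have "cf (f * g * h) q = (\<Sum>(s, c)\<in>splits q. \<Sum>(a, b)\<in>splits s. cf f a * cf g b * cf h c)"
      by (simp add: times_mps_def sum_distrib_right case_prod_unfold)
    also have "\<dots> = (\<Sum>((s, c), (a, b))\<in>Sigma (splits q) (\<lambda>(s, c). splits s). cf f a * cf g b * cf h c)"
      by (subst sum.Sigma[symmetric]) (auto simp: case_prod_unfold)
    also have "\<dots> = (\<Sum>((a, s), (b, c))\<in>Sigma (splits q) (\<lambda>(a, s). splits s). cf f a * (cf g b * cf h c))"
      by (rule sum.reindex_bij_witness[where i = "\<lambda>((a, s), (b, c)). ((a + b, c), (a, b))"
              and j = "\<lambda>((s, c), (a, b)). ((a, b + c), (b, c))"])
        (auto simp: splits_def add.assoc mult.assoc)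
    also have "\<dots> = (\<Sum>(a, s)\<in>splits q. \<Sum>(b, c)\<in>splits s. cf f a * (cf g b * cf h c))"
      by (subst sum.Sigma[symmetric]) (auto simp: case_prod_unfold)
    also have "\<dots> = cf (f * (g * h)) q"
      by (simp add: times_mps_def sum_distrib_left case_prod_unfold)
    finally show "cf (f * g * h) q = cf (f * (g * h)) q" .
  qed
qed

end

lemma cf_zero [simp]: "cf 0 q = 0"
  by (simp add: zero_mps_def)

lemma cf_one: "cf 1 q = (if q = 0 then 1 else 0)"
  by (simp add: one_mps_def)

lemma cf_add [simp]: "cf (f + g) q = cf f q + cf g q"
  by (simp add: plus_mps_def)

lemma cf_diff [simp]: "cf (f - g) q = cf f q - cf g q"
  by (simp add: minus_mps_def)

lemma cf_uminus [simp]: "cf (- f) q = - cf f q"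
  by (simp add: uminus_mps_def)

lemma cf_mult: "cf (f * g) q = (\<Sum>(a, b)\<in>splits q. cf f a * cf g b)"
  by (simp add: times_mps_def)

lemma cf_sum [simp]: "cf (sum f A) q = (\<Sum>x\<in>A. cf (f x) q)"
  by (induction A rule: infinite_finite_induct) auto

lemma cf_mult_nonzeroE:
  assumes "cf (f * g) q \<noteq> 0"
  obtains a b where "a + b = q" "cf f a \<noteq> 0" "cf g b \<noteq> 0"
proof -
  obtain x where "x \<in> splits q" "(case x of (a, b) \<Rightarrow> cf f a * cf g b) \<noteq> 0"
    using assms unfolding cf_mult by (meson sum.not_neutral_contains_not_neutral)
  then show ?thesis using that by (auto simp: splits_def)
qed

definition zmon :: "nat ^ 'n \<Rightarrow> 'n mps" where
  "zmon q = Ms (monomial q)"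

lemma cf_zmon: "cf (zmon q) q' = (if q' = q then 1 else 0)"
  by (simp add: zmon_def monomial_def)

lemma cf_zmon_mult: "cf (zmon a * f) q = (if a \<le> q then cf f (q - a) else 0)"
  for f :: "'n::finite mps"
proof (cases "a \<le> q")
  case True
  then have *: "a + (q - a) = q" by (simp add: vec_eq_iff less_eq_vec_def)
  have "cf (zmon a * f) q = (\<Sum>(x, y)\<in>{(a, q - a)}. cf (zmon a) x * cf f y)"
    unfolding cf_mult
    by (rule sum.mono_neutral_right[OF finite_splits])
      (use * in \<open>auto simp: splits_def cf_zmon split: if_splits\<close>)
  with True show ?thesis by (simp add: cf_zmon)
next
  case False
  then have "\<And>x y. (x, y) \<in> splits q \<Longrightarrow> x \<noteq> a"
    by (auto simp: splits_def less_eq_vec_def)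
  then show ?thesis using False unfolding cf_mult by (auto intro!: sum.neutral simp: cf_zmon)
qed

lemma zmon_mult_zmon: "zmon a * zmon b = (zmon (a + b) :: 'n::finite mps)"
proof (rule mps_eqI)
  fix q
  have "a \<le> q \<and> q - a = b \<longleftrightarrow> q = a + b"
    by (auto simp: vec_eq_iff less_eq_vec_def) (metis le_add_diff_inverse)
  then show "cf (zmon a * zmon b) q = cf (zmon (a + b)) q"
    by (auto simp: cf_zmon_mult cf_zmon[of b] cf_zmon[of "a + b"])
qed

lemma zmon_0: "zmon 0 = (1 :: 'n::finite mps)"
  by (rule mps_eqI) (simp add: cf_zmon cf_one)

definition cst :: "complex \<Rightarrow> 'n::finite mps" where
  "cst a = Ms (\<lambda>q. if q = 0 then a else 0)"

lemma cf_cst: "cf (cst a) q = (if q = 0 then a else 0)"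
  by (simp add: cst_def)

lemma cf_cst_mult [simp]: "cf (cst a * f) q = a * cf f q"
  for f :: "'n::finite mps"
proof -
  have "cf (cst a * f) q = (\<Sum>(x, y)\<in>{(0, q)}. cf (cst a :: 'n mps) x * cf f y)"
    unfolding cf_mult
    by (rule sum.mono_neutral_right[OF finite_splits])
      (auto simp: splits_def cf_cst split: if_splits)
  then show ?thesis by (simp add: cf_cst)
qed

section \<open>Order of vanishing at the origin and completeness\<close>

definition tdeg :: "nat ^ 'n::finite \<Rightarrow> nat" where
  "tdeg q = (\<Sum>i\<in>UNIV. q $ i)"

lemma tdeg_add: "tdeg (a + b) = tdeg a + tdeg b"
  by (simp add: tdeg_def sum.distrib)

lemma tdeg_eq_0_iff [simp]: "tdeg q = 0 \<longleftrightarrow> q = 0"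
  by (simp add: tdeg_def vec_eq_iff)

text \<open>Membership in the \<open>N\<close>-th power of the maximal ideal; all limits are taken
  for this filtration.\<close>

definition ord_ge :: "nat \<Rightarrow> 'n::finite mps \<Rightarrow> bool" where
  "ord_ge N f \<longleftrightarrow> (\<forall>q. tdeg q < N \<longrightarrow> cf f q = 0)"

lemma ord_ge_0 [simp]: "ord_ge 0 f" by (simp add: ord_ge_def)
lemma ord_ge_zero [simp]: "ord_ge N 0" by (simp add: ord_ge_def)
lemma ord_ge_add: "ord_ge N f \<Longrightarrow> ord_ge N g \<Longrightarrow> ord_ge N (f + g)" by (simp add: ord_ge_def)
lemma ord_ge_diff: "ord_ge N f \<Longrightarrow> ord_ge N g \<Longrightarrow> ord_ge N (f - g)" by (simp add: ord_ge_def)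
lemma ord_ge_sum: "(\<And>x. x \<in> A \<Longrightarrow> ord_ge N (f x)) \<Longrightarrow> ord_ge N (sum f A)"
  by (simp add: ord_ge_def)

lemma ord_ge_mult:
  assumes "ord_ge N f" "ord_ge M g" shows "ord_ge (N + M) (f * g)"
  unfolding ord_ge_def
proof (intro allI impI, rule ccontr)
  fix q assume "tdeg q < N + M" "cf (f * g) q \<noteq> 0"
  then obtain a b where "a + b = q" "cf f a \<noteq> 0" "cf g b \<noteq> 0" by (rule_tac cf_mult_nonzeroE)
  with assms have "N \<le> tdeg a" "M \<le> tdeg b" by (auto simp: ord_ge_def not_less[symmetric])
  with \<open>tdeg q < N + M\<close> \<open>a + b = q\<close> show False by (auto simp: tdeg_add)
qed

lemma ord_ge_mult_left: "ord_ge N g \<Longrightarrow> ord_ge N (f * g)"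
  using ord_ge_mult[of 0 f N g] by simp

lemma ord_ge_power: "ord_ge 1 f \<Longrightarrow> ord_ge N (f ^ N)"
proof (induction N)
  case (Suc N)
  then show ?case using ord_ge_mult[of 1 f N "f ^ N"] by simp
qed simp

lemma ord_ge_1_iff: "ord_ge 1 f \<longleftrightarrow> cf f 0 = 0"
  by (auto simp: ord_ge_def)

lemma mps_eq_0I: "(\<And>N. ord_ge N f) \<Longrightarrow> f = 0"
  by (rule mps_eqI) (metis cf_zero lessI ord_ge_def)

text \<open>The coefficient of \<open>x ^ j * b j\<close> at \<open>q\<close> vanishes once
  \<open>j > tdeg q\<close>, so the limit \<open>B\<close> is given by finite sums. The
  \<open>b j\<close> are arbitrary because the corrections in the Nakayama argument come without
  bounds.\<close>

lemma mps_power_series_converges: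
  fixes x :: "'n::finite mps"
  assumes "ord_ge 1 x"
  shows "\<exists>B. \<forall>N. ord_ge N (B - (\<Sum>j<N. x ^ j * b j))"
proof -
  define B where "B = Ms (\<lambda>q. \<Sum>j\<le>tdeg q. cf (x ^ j * b j) q)"
  have "ord_ge N (B - (\<Sum>j<N. x ^ j * b j))" for N
    unfolding ord_ge_def
  proof (intro allI impI)
    fix q :: "nat ^ 'n" assume q: "tdeg q < N"
    have "cf (x ^ j * b j) q = 0" if "tdeg q < j" for j
      using ord_ge_mult[OF ord_ge_power[OF assms, of j] ord_ge_0[of "b j"]] that
      by (auto simp: ord_ge_def)
    then have "(\<Sum>j<N. cf (x ^ j * b j) q) = (\<Sum>j\<le>tdeg q. cf (x ^ j * b j) q)"
      using q by (intro sum.mono_neutral_right) auto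
    then show "cf (B - (\<Sum>j<N. x ^ j * b j)) q = 0" by (simp add: B_def)
  qed
  then show ?thesis by blast
qed

text \<open>Geometric series for \<open>1 / (1 - h)\<close>, where \<open>h = 1 - s / s(0)\<close>
  has no constant term.\<close>

lemma mps_unit:
  assumes "cf s 0 \<noteq> 0" shows "\<exists>t. t * s = 1"
proof -
  define h where "h = 1 - cst (1 / cf s 0) * s"
  have h: "ord_ge 1 h" using assms unfolding ord_ge_1_iff by (simp add: h_def cf_one)
  obtain B where B: "\<And>N. ord_ge N (B - (\<Sum>j<N. h ^ j * 1))"
    using mps_power_series_converges[OF h, of "\<lambda>_. 1"] by auto
  have "(1 - h) * B - 1 = 0"
  proof (rule mps_eq_0I)
    fix N
    have "(1 - h) * B - 1 = (1 - h) * (B - (\<Sum>j<N. h ^ j * 1)) - h ^ N"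
      using one_diff_power_eq[of h N] by (simp add: algebra_simps)
    then show "ord_ge N ((1 - h) * B - 1)"
      using ord_ge_diff[OF ord_ge_mult_left[OF B] ord_ge_power[OF h]] by metis
  qed
  then have "(B * cst (1 / cf s 0)) * s = 1" by (simp add: h_def mult_ac)
  then show ?thesis by blast
qed

section \<open>Koszul complexes\<close>

definition is_ideal :: "'a::comm_ring_1 set \<Rightarrow> bool" where
  "is_ideal I \<longleftrightarrow> 0 \<in> I \<and> (\<forall>x\<in>I. \<forall>y\<in>I. x + y \<in> I) \<and> (\<forall>x\<in>I. \<forall>r. r * x \<in> I)"

lemma is_ideal_zero: "is_ideal I \<Longrightarrow> 0 \<in> I"
  and is_ideal_add: "is_ideal I \<Longrightarrow> x \<in> I \<Longrightarrow> y \<in> I \<Longrightarrow> x + y \<in> I"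
  and is_ideal_mult: "is_ideal I \<Longrightarrow> x \<in> I \<Longrightarrow> r * x \<in> I"
  by (auto simp: is_ideal_def)

lemma is_ideal_diff: "is_ideal I \<Longrightarrow> x \<in> I \<Longrightarrow> y \<in> I \<Longrightarrow> x - y \<in> I"
  using is_ideal_add[of I x "- 1 * y"] is_ideal_mult[of I y "- 1"] by simp

lemma is_ideal_sum: "is_ideal I \<Longrightarrow> (\<And>a. a \<in> A \<Longrightarrow> f a \<in> I) \<Longrightarrow> sum f A \<in> I"
  by (induction A rule: infinite_finite_induct) (auto simp: is_ideal_zero is_ideal_add)

text \<open>For \<open>a \<notin> A\<close>, the sign in
  \<open>e_a \<and> e_A = \<plusminus> e_{A \<union> {a}}\<close>: the vector \<open>e_a\<close> is
  moved past the smaller basis vectors of \<open>A\<close>.\<close>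

definition koszul_sign :: "nat \<Rightarrow> nat set \<Rightarrow> 'a::comm_ring_1" where
  "koszul_sign a A = (- 1) ^ card {b \<in> A. b < a}"

lemma koszul_sign_square: "koszul_sign a A * koszul_sign a A = 1"
  by (simp add: koszul_sign_def flip: power_mult_distrib)

lemma koszul_sign_insert:
  assumes "finite A" "a \<notin> A"
  shows "koszul_sign b (insert a A) = (if a < b then - koszul_sign b A else koszul_sign b A)"
proof -
  have "{c \<in> insert a A. c < b} = (if a < b then insert a {c \<in> A. c < b} else {c \<in> A. c < b})"
    by auto
  then show ?thesis using assms by (auto simp: koszul_sign_def)
qed

lemma koszul_sign_anticomm:
  assumes "finite A" "a \<notin> A" "b \<notin> A" "a \<noteq> b"
  shows "koszul_sign a A * koszul_sign b (insert a A) = - (koszul_sign b A * koszul_sign a (insert b A))"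
  using assms by (auto simp: koszul_sign_insert)

text \<open>Elements of degree \<open>i\<close> of the exterior algebra on the basis \<open>D\<close>: \<open>c A\<close> is the coefficient of
  the basis vector indexed by \<open>A\<close>, the elements of \<open>A\<close> being taken in increasing order.\<close>

definition chain :: "nat set \<Rightarrow> nat \<Rightarrow> (nat set \<Rightarrow> 'a::zero) \<Rightarrow> bool" where
  "chain D i c \<longleftrightarrow> (\<forall>A. c A \<noteq> 0 \<longrightarrow> A \<subseteq> D \<and> card A = i)"

text \<open>Contraction with the linear form of values \<open>y a\<close>. Read at the coefficient
  of \<open>A\<close>, it collects what the larger sets \<open>insert a A\<close>
  contribute.\<close>

definition koszul_d :: "nat set \<Rightarrow> (nat \<Rightarrow> 'a::comm_ring_1) \<Rightarrow> (nat set \<Rightarrow> 'a) \<Rightarrow> nat set \<Rightarrow> 'a" where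
  "koszul_d D y c A = (\<Sum>a\<in>D - A. koszul_sign a A * y a * c (insert a A))"

lemma chain_eq_0: "chain D i c \<Longrightarrow> \<not> A \<subseteq> D \<or> card A \<noteq> i \<Longrightarrow> c A = 0"
  by (auto simp: chain_def)

lemma chain_zero: "chain D i (\<lambda>A. 0)"
  by (simp add: chain_def)

lemma chain_add: "chain D i c \<Longrightarrow> chain D i d \<Longrightarrow> chain D i (\<lambda>A. c A + d A)"
  for c d :: "nat set \<Rightarrow> 'a::comm_ring_1"
  unfolding chain_def by (metis add_0)

lemma chain_diff: "chain D i c \<Longrightarrow> chain D i d \<Longrightarrow> chain D i (\<lambda>A. c A - d A)"
  for c d :: "nat set \<Rightarrow> 'a::comm_ring_1"
  unfolding chain_def by (metis diff_0_right)

lemma chain_mult: "chain D i c \<Longrightarrow> chain D i (\<lambda>A. r * c A)"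
  for c :: "nat set \<Rightarrow> 'a::comm_ring_1"
  unfolding chain_def by (metis mult_zero_right)

lemma chain_sum: "(\<And>x. x \<in> S \<Longrightarrow> chain D i (h x)) \<Longrightarrow> chain D i (\<lambda>A. \<Sum>x\<in>S. h x A)"
  for h :: "'b \<Rightarrow> nat set \<Rightarrow> 'a::comm_ring_1"
  by (induction S rule: infinite_finite_induct) (auto simp: chain_zero intro: chain_add)

lemma koszul_d_add: "koszul_d D y (\<lambda>A. c A + d A) A = koszul_d D y c A + koszul_d D y d A"
  by (simp add: koszul_d_def sum.distrib algebra_simps)

lemma koszul_d_diff: "koszul_d D y (\<lambda>A. c A - d A) A = koszul_d D y c A - koszul_d D y d A"
  by (simp add: koszul_d_def sum_subtractf algebra_simps)

lemma koszul_d_mult: "koszul_d D y (\<lambda>A. r * c A) A = r * koszul_d D y c A"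
  by (simp add: koszul_d_def sum_distrib_left algebra_simps)

lemma koszul_d_sum: "koszul_d D y (\<lambda>A. \<Sum>x\<in>S. h x A) A = (\<Sum>x\<in>S. koszul_d D y (h x) A)"
  unfolding koszul_d_def by (simp add: sum_distrib_left) (rule sum.swap)

lemma koszul_d_in_ideal: "is_ideal I \<Longrightarrow> (\<And>A. c A \<in> I) \<Longrightarrow> koszul_d D y c A \<in> I"
  unfolding koszul_d_def by (intro is_ideal_sum is_ideal_mult)

lemma chain_koszul_d:
  assumes "finite D" "chain D (Suc i) c" shows "chain D i (koszul_d D y c)"
  unfolding chain_def
proof (intro allI impI)
  fix A assume "koszul_d D y c A \<noteq> 0"
  then obtain a where a: "a \<in> D - A" "koszul_sign a A * y a * c (insert a A) \<noteq> 0"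
    unfolding koszul_d_def by (meson sum.not_neutral_contains_not_neutral)
  then have "c (insert a A) \<noteq> 0" by auto
  then have "insert a A \<subseteq> D" "card (insert a A) = Suc i"
    using assms(2) unfolding chain_def by blast+
  then show "A \<subseteq> D \<and> card A = i"
    using a assms(1) by (auto simp: card_insert_if finite_subset)
qed

text \<open>Removing first \<open>a\<close> and then \<open>b\<close> gives the opposite sign of
  removing first \<open>b\<close> and then \<open>a\<close>; \<open>?P\<close> and \<open>?N\<close>
  are the two orders, and they cancel.\<close>

lemma koszul_d_koszul_d:
  assumes "finite D" "chain D i c" shows "koszul_d D y (koszul_d D y c) A = 0"
proof (cases "A \<subseteq> D")
  case False
  then have "c (insert a (insert b A)) = 0" for a b
    by (intro chain_eq_0[OF assms(2)]) auto
  then show ?thesis by (simp add: koszul_d_def)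
next
  case True
  then have fin: "finite A" using assms(1) finite_subset by blast
  let ?F = "\<lambda>a b. koszul_sign a A * koszul_sign b (insert a A) * (y a * y b * c (insert a (insert b A)))"
  have anti: "?F b a = - ?F a b" if "a \<in> D - A" "b \<in> D - A" "a \<noteq> b" for a b
    using koszul_sign_anticomm[OF fin, of b a, where 'a = 'a] that
    by (simp add: insert_commute mult.commute[of "y b"])
  let ?P = "{(a, b). a \<in> D - A \<and> b \<in> D - A \<and> a < b}"
  let ?N = "{(a, b). a \<in> D - A \<and> b \<in> D - A \<and> b < a}"
  have fP: "finite ?P" "finite ?N"
    by (rule finite_subset[of _ "D \<times> D"]; use assms(1) in auto)+
  have "koszul_d D y (koszul_d D y c) A = (\<Sum>a\<in>D - A. \<Sum>b\<in>D - insert a A.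
      koszul_sign a A * y a * (koszul_sign b (insert a A) * y b * c (insert b (insert a A))))"
    by (simp add: koszul_d_def sum_distrib_left)
  also have "\<dots> = (\<Sum>a\<in>D - A. \<Sum>b\<in>D - insert a A. ?F a b)"
    by (intro sum.cong refl) (simp add: insert_commute mult_ac)
  also have "\<dots> = (\<Sum>(a, b)\<in>Sigma (D - A) (\<lambda>a. D - insert a A). ?F a b)"
    using assms(1) by (subst sum.Sigma) auto
  also have "Sigma (D - A) (\<lambda>a. D - insert a A) = ?P \<union> ?N"
    by auto
  also have "(\<Sum>(a, b)\<in>?P \<union> ?N. ?F a b) = (\<Sum>(a, b)\<in>?P. ?F a b) + (\<Sum>(a, b)\<in>?N. ?F a b)"
    by (intro sum.union_disjoint fP) auto
  also have "(\<Sum>(a, b)\<in>?N. ?F a b) = (\<Sum>(a, b)\<in>?P. ?F b a)"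
    by (rule sum.reindex_bij_witness[where i = prod.swap and j = prod.swap]) auto
  also have "(\<Sum>(a, b)\<in>?P. ?F a b) + (\<Sum>(a, b)\<in>?P. ?F b a) = (\<Sum>(a, b)\<in>?P. ?F a b + ?F b a)"
    by (simp add: sum.distrib case_prod_unfold)
  also have "\<dots> = 0"
  proof (intro sum.neutral ballI, clarify)
    fix a b assume *: "a \<in> D" "a \<notin> A" "b \<in> D" "b \<notin> A" "a < b"
    have "?F b a = - ?F a b" using * by (intro anti) auto
    then show "?F a b + ?F b a = 0" by (simp only: add.right_inverse)
  qed
  finally show ?thesis .
qed

definition wedge :: "nat \<Rightarrow> (nat set \<Rightarrow> 'a::comm_ring_1) \<Rightarrow> nat set \<Rightarrow> 'a" where
  "wedge a c A = (if a \<in> A then koszul_sign a (A - {a}) * c (A - {a}) else 0)"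

lemma chain_wedge:
  assumes "finite D" "a \<in> D" "chain D i c" shows "chain D (Suc i) (wedge a c)"
  unfolding chain_def
proof (intro allI impI)
  fix A assume "wedge a c A \<noteq> 0"
  then have a: "a \<in> A" "c (A - {a}) \<noteq> 0" by (auto simp: wedge_def split: if_splits)
  then have *: "A - {a} \<subseteq> D" "card (A - {a}) = i" using assms(3) by (auto simp: chain_def)
  then have "finite (A - {a})" using assms(1) finite_subset by blast
  then have "finite A" by simp
  with a * assms(2) show "A \<subseteq> D \<and> card A = Suc i"
    using card_Suc_Diff1[of A a] by auto
qed

text \<open>Cartan's homotopy formula for exterior multiplication by \<open>e_a\<close>; it shows
  that every \<open>y a\<close> acts as zero on homology. For \<open>a \<notin> A\<close> only the
  term \<open>b = a\<close> of the first summand survives. For \<open>a \<in> A\<close> that term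
  sits in the second summand, and the others cancel by \<open>koszul_sign_anticomm\<close>.\<close>

lemma koszul_d_wedge:
  assumes "finite D" "a \<in> D" "A \<subseteq> D"
  shows "koszul_d D y (wedge a c) A + wedge a (koszul_d D y c) A = y a * c A"
proof (cases "a \<in> A")
  case False
  have "koszul_d D y (wedge a c) A = (\<Sum>b\<in>{a}. koszul_sign b A * y b * wedge a c (insert b A))"
    unfolding koszul_d_def using assms False
    by (intro sum.mono_neutral_right) (auto simp: wedge_def)
  also have "\<dots> = (koszul_sign a A * koszul_sign a A) * (y a * c A)"
    using False by (simp add: wedge_def mult_ac)
  finally show ?thesis using False by (simp add: wedge_def koszul_sign_square)
next
  case True
  define B where "B = A - {a}"
  have A: "A = insert a B" "a \<notin> B" and fin: "finite B"
    using True assms finite_subset by (auto simp: B_def)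
  let ?T = "\<lambda>b. koszul_sign a B * (koszul_sign b B * y b * c (insert b B))"
  have "wedge a (koszul_d D y c) A = (\<Sum>b\<in>D - B. ?T b)"
    using A by (simp add: wedge_def koszul_d_def sum_distrib_left)
  also have "D - B = insert a (D - A)"
    using A assms by auto
  also have "(\<Sum>b\<in>insert a (D - A). ?T b) = ?T a + (\<Sum>b\<in>D - A. ?T b)"
    using A assms by (subst sum.insert) auto
  also have "?T a = (koszul_sign a B * koszul_sign a B) * (y a * c A)"
    unfolding A(1) by (simp only: mult_ac)
  also have "\<dots> = y a * c A" by (simp add: koszul_sign_square)
  finally have 1: "wedge a (koszul_d D y c) A = y a * c A + (\<Sum>b\<in>D - A. ?T b)" .
  have "koszul_sign b A * y b * wedge a c (insert b A) = - ?T b" if b: "b \<in> D - A" for b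
  proof -
    have "insert b A - {a} = insert b B" using A b by auto
    moreover have "koszul_sign b A * koszul_sign a (insert b B) = (- (koszul_sign a B * koszul_sign b B) :: 'a)"
    proof -
      have *: "koszul_sign a B * koszul_sign b A = (- (koszul_sign b B * koszul_sign a (insert b B)) :: 'a)"
        using koszul_sign_anticomm[OF fin, of a b] A b by auto
      have "(koszul_sign b A * koszul_sign a (insert b B) :: 'a) = (koszul_sign a B * koszul_sign a B) * (koszul_sign b A * koszul_sign a (insert b B))"
        by (simp add: koszul_sign_square)
      also have "\<dots> = koszul_sign a B * (koszul_sign a B * koszul_sign b A) * koszul_sign a (insert b B)" by (simp add: mult_ac)
      also have "\<dots> = - (koszul_sign a B * koszul_sign b B) * (koszul_sign a (insert b B) * koszul_sign a (insert b B))"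
        by (simp add: * mult_ac)
      finally show ?thesis by (simp add: koszul_sign_square)
    qed
    moreover have "koszul_sign b A * y b * wedge a c (insert b A) =
        (koszul_sign b A * koszul_sign a (insert b A - {a})) * (y b * c (insert b A - {a}))"
      using True by (simp add: wedge_def mult_ac)
    ultimately have "koszul_sign b A * y b * wedge a c (insert b A) = - (koszul_sign a B * koszul_sign b B) * (y b * c (insert b B))"
      by (simp only:)
    then show ?thesis by (simp add: mult_ac)
  qed
  then have "koszul_d D y (wedge a c) A = (\<Sum>b\<in>D - A. - ?T b)"
    unfolding koszul_d_def by (intro sum.cong) auto
  with 1 show ?thesis by (simp add: sum_negf)
qed

text \<open>Vanishing of the Koszul homology of \<open>R/I\<close> in degree \<open>i\<close>.
  Chains keep coefficients in \<open>R\<close> and equations hold modulo \<open>I\<close>, which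
  avoids quotient rings and makes changing \<open>I\<close> easy.\<close>

definition koszul_acyclic :: "nat set \<Rightarrow> (nat \<Rightarrow> 'a::comm_ring_1) \<Rightarrow> 'a set \<Rightarrow> nat \<Rightarrow> bool" where
  "koszul_acyclic D y I i \<longleftrightarrow> (\<forall>c. chain D i c \<and> (\<forall>A. koszul_d D y c A \<in> I) \<longrightarrow>
     (\<exists>b. chain D (Suc i) b \<and> (\<forall>A. c A - koszul_d D y b A \<in> I)))"

lemma koszul_acyclic_above:
  assumes "finite D" "card D < i" "is_ideal I" shows "koszul_acyclic D y I i"
  unfolding koszul_acyclic_def
proof (intro allI impI)
  fix c :: "nat set \<Rightarrow> 'a" assume c: "chain D i c \<and> (\<forall>A. koszul_d D y c A \<in> I)"
  have "c A = 0" for A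
    using c assms card_mono[of D A] by (auto simp: chain_def)
  then show "\<exists>b. chain D (Suc i) b \<and> (\<forall>A. c A - koszul_d D y b A \<in> I)"
    using is_ideal_zero[OF assms(3)] by (intro exI[of _ "\<lambda>A. 0"]) (auto simp: chain_zero koszul_d_def)
qed

text \<open>The connecting homomorphism of \<open>0 \<rightarrow> R/I \<rightarrow> R/I \<rightarrow> R/I' \<rightarrow> 0\<close>, where the first map is
  multiplication by \<open>w\<close>; it is onto because \<open>w\<close>, being a combination of the \<open>y a\<close>, acts as zero on homology.\<close>

lemma koszul_acyclic_lift:
  assumes D: "finite D" and I: "is_ideal I"
    and nzd: "\<And>f. w * f \<in> I \<Longrightarrow> f \<in> I"
    and I': "\<And>f. f \<in> I' \<longleftrightarrow> (\<exists>g. f - w * g \<in> I)"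
    and w: "w = (\<Sum>a\<in>D. \<alpha> a * y a)"
    and ac: "koszul_acyclic D y I' (Suc i)"
  shows "koszul_acyclic D y I i"
  unfolding koszul_acyclic_def
proof (intro allI impI)
  fix c assume c: "chain D i c \<and> (\<forall>A. koszul_d D y c A \<in> I)"
  \<comment> \<open>The null homotopy of multiplication by \<open>w\<close>: modulo \<open>I\<close>
    the boundary of \<open>e\<close> is \<open>w * c\<close>, so \<open>e\<close> is a cycle modulo
    \<open>I'\<close>.\<close>
  define e where "e A = (\<Sum>a\<in>D. \<alpha> a * wedge a c A)" for A
  have e: "chain D (Suc i) e"
    unfolding e_def using c by (intro chain_sum chain_mult chain_wedge[OF D]) auto
  have de: "w * c A - koszul_d D y e A \<in> I" for A
  proof (cases "A \<subseteq> D")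
    case False
    then have "c A = 0" "koszul_d D y e A = 0"
      using c e chain_koszul_d[OF D e, of y] by (auto simp: chain_def)
    then show ?thesis using is_ideal_zero[OF I] by simp
  next
    case True
    have "koszul_d D y e A = (\<Sum>a\<in>D. \<alpha> a * koszul_d D y (wedge a c) A)"
      unfolding e_def by (simp add: koszul_d_sum koszul_d_mult)
    moreover have "w * c A = (\<Sum>a\<in>D. \<alpha> a * (koszul_d D y (wedge a c) A + wedge a (koszul_d D y c) A))"
      by (simp add: w sum_distrib_right koszul_d_wedge[OF D _ True] mult.assoc)
    ultimately have "w * c A - koszul_d D y e A = (\<Sum>a\<in>D. \<alpha> a * wedge a (koszul_d D y c) A)"
      by (simp add: distrib_left sum.distrib)
    moreover have "wedge a (koszul_d D y c) A \<in> I" for a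
      using c is_ideal_zero[OF I] is_ideal_mult[OF I] by (auto simp: wedge_def)
    ultimately show ?thesis by (auto intro: is_ideal_sum[OF I] is_ideal_mult[OF I])
  qed
  have "\<forall>A. koszul_d D y e A \<in> I'"
  proof
    fix A
    have "koszul_d D y e A - w * c A \<in> I"
      using is_ideal_mult[OF I de, of "- 1" A] by simp
    then show "koszul_d D y e A \<in> I'" using I' by blast
  qed
  with ac e obtain b where b: "chain D (Suc (Suc i)) b" "\<And>A. e A - koszul_d D y b A \<in> I'"
    unfolding koszul_acyclic_def by blast
  then have "\<forall>A. \<exists>g. (e A - koszul_d D y b A) - w * g \<in> I" using I' by blast
  then obtain g where g: "\<And>A. (e A - koszul_d D y b A) - w * g A \<in> I" by metis
  \<comment> \<open>The quotients \<open>g A\<close> were chosen separately for each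
    \<open>A\<close>; cutting them off outside the right degree gives a chain.\<close>
  define e' where "e' A = (if A \<subseteq> D \<and> card A = Suc i then g A else 0)" for A
  have e': "chain D (Suc i) e'" by (simp add: chain_def e'_def)
  have ge': "(e A - koszul_d D y b A) - w * e' A \<in> I" for A
  proof (cases "A \<subseteq> D \<and> card A = Suc i")
    case False
    then have "e A = 0" "koszul_d D y b A = 0"
      using e chain_koszul_d[OF D b(1), of y] by (auto simp: chain_def)
    with False show ?thesis using is_ideal_zero[OF I] by (auto simp: e'_def)
  qed (use g in \<open>auto simp: e'_def\<close>)
  have "c A - koszul_d D y e' A \<in> I" for A
  proof (rule nzd)
    \<comment> \<open>Applying the boundary to \<open>e - d b = w e'\<close> removes
      \<open>b\<close> and leaves \<open>w c = w d e'\<close> modulo \<open>I\<close>; then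
      \<open>w\<close> is cancelled.\<close>
    have "koszul_d D y (\<lambda>A. (e A - koszul_d D y b A) - w * e' A) A \<in> I"
      using ge' by (rule koszul_d_in_ideal[OF I])
    then have *: "koszul_d D y e A - w * koszul_d D y e' A \<in> I"
      by (simp add: koszul_d_diff koszul_d_mult koszul_d_koszul_d[OF D b(1)])
    show "w * (c A - koszul_d D y e' A) \<in> I"
      using is_ideal_add[OF I de[of A] *] by (simp add: algebra_simps)
  qed
  with e' show "\<exists>b. chain D (Suc i) b \<and> (\<forall>A. c A - koszul_d D y b A \<in> I)" by blast
qed

definition generated :: "nat set \<Rightarrow> (nat \<Rightarrow> 'a::comm_ring_1) \<Rightarrow> 'a set" where
  "generated D y = {\<Sum>a\<in>D. \<alpha> a * y a | \<alpha>. True}"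

lemma is_ideal_generated: "is_ideal (generated D y)"
  unfolding is_ideal_def
proof (intro conjI ballI allI)
  show "0 \<in> generated D y" unfolding generated_def by (auto intro!: exI[of _ "\<lambda>_. 0"])
next
  fix x z assume "x \<in> generated D y" "z \<in> generated D y"
  then obtain \<alpha> \<beta> where "x = (\<Sum>a\<in>D. \<alpha> a * y a)" "z = (\<Sum>a\<in>D. \<beta> a * y a)"
    by (auto simp: generated_def)
  then have "x + z = (\<Sum>a\<in>D. (\<alpha> a + \<beta> a) * y a)" by (simp add: algebra_simps sum.distrib)
  then show "x + z \<in> generated D y" unfolding generated_def by (intro CollectI exI[of _ "\<lambda>a. \<alpha> a + \<beta> a"]) simp
next
  fix x r assume "x \<in> generated D y"
  then obtain \<alpha> where "x = (\<Sum>a\<in>D. \<alpha> a * y a)" by (auto simp: generated_def)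
  then have "r * x = (\<Sum>a\<in>D. (r * \<alpha> a) * y a)" by (simp add: sum_distrib_left mult.assoc)
  then show "r * x \<in> generated D y" unfolding generated_def by (intro CollectI exI[of _ "\<lambda>a. r * \<alpha> a"]) simp
qed

lemma generated_base: "finite D \<Longrightarrow> a \<in> D \<Longrightarrow> y a \<in> generated D y"
  unfolding generated_def
  by (auto intro!: exI[of _ "\<lambda>b. if b = a then 1 else 0"] simp: if_distrib[of "\<lambda>x. x * _"] sum.delta' cong: if_cong)

section \<open>Powers of the variables as a regular sequence\<close>

lemma power_axis: "zmon (axis j (1 :: nat)) ^ N = (zmon (axis j N) :: 'n::finite mps)"
proof (induction N)
  case 0
  have "axis j 0 = (0 :: nat ^ 'n)" by (simp add: axis_def vec_eq_iff)
  then show ?case by (simp only: power_0 zmon_0)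
next
  case (Suc N)
  have "axis j 1 + axis j N = (axis j (Suc N) :: nat ^ 'n)"
    by (simp add: axis_def vec_eq_iff)
  then show ?case by (simp only: power_Suc Suc zmon_mult_zmon)
qed

text \<open>The ideal generated by the powers \<open>z_j^N\<close> with \<open>j \<in> S\<close>,
  described through its monomials; \<open>S = {}\<close> gives the zero ideal.\<close>

definition vanish_ideal :: "nat \<Rightarrow> 'n::finite set \<Rightarrow> 'n mps set" where
  "vanish_ideal N S = {f. \<forall>q. (\<forall>j\<in>S. q $ j < N) \<longrightarrow> cf f q = 0}"

lemma is_ideal_vanish: "is_ideal (vanish_ideal N S :: 'n::finite mps set)"
  unfolding is_ideal_def
proof (intro conjI ballI allI)
  fix f r :: "'n mps" assume f: "f \<in> vanish_ideal N S"
  show "r * f \<in> vanish_ideal N S"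
    unfolding vanish_ideal_def
  proof (intro CollectI allI impI, rule ccontr)
    fix q assume q: "\<forall>j\<in>S. q $ j < N" and "cf (r * f) q \<noteq> 0"
    then obtain a b where "a + b = q" "cf f b \<noteq> 0" by (rule_tac cf_mult_nonzeroE)
    moreover from this q have "\<forall>j\<in>S. b $ j < N" by (force simp: less_eq_vec_def)
    ultimately show False using f by (auto simp: vanish_ideal_def)
  qed
qed (auto simp: vanish_ideal_def)

lemma axis_le_iff: "axis j N \<le> (q :: nat ^ 'n::finite) \<longleftrightarrow> N \<le> q $ j"
  by (auto simp: less_eq_vec_def axis_def)

text \<open>The monomials of \<open>f\<close> divisible by \<open>z_j^N\<close> yield
  \<open>g\<close>, the others remain. This is the relation between \<open>I\<close> and
  \<open>I'\<close> that \<open>koszul_acyclic_lift\<close> asks for.\<close>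

lemma vanish_ideal_insert:
  assumes "j \<notin> S"
  shows "f \<in> vanish_ideal N (insert j S) \<longleftrightarrow> (\<exists>g. f - zmon (axis j N) * g \<in> vanish_ideal N S)"
    (is "?L \<longleftrightarrow> ?R")
proof
  assume ?L
  define g where "g = Ms (\<lambda>q. cf f (axis j N + q))"
  have "cf (f - zmon (axis j N) * g) q = (if N \<le> q $ j then 0 else cf f q)" for q
  proof (cases "N \<le> q $ j")
    case True
    then have "axis j N + (q - axis j N) = q" by (auto simp: vec_eq_iff axis_def)
    with True show ?thesis by (simp add: cf_zmon_mult axis_le_iff g_def)
  qed (simp add: cf_zmon_mult axis_le_iff)
  with \<open>?L\<close> have "f - zmon (axis j N) * g \<in> vanish_ideal N S"
    unfolding vanish_ideal_def by (auto simp: not_le)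
  then show ?R by blast
next
  assume ?R
  then obtain g where g: "f - zmon (axis j N) * g \<in> vanish_ideal N S" by blast
  show ?L
    unfolding vanish_ideal_def
  proof (intro CollectI allI impI)
    fix q assume q: "\<forall>i\<in>insert j S. q $ i < N"
    then have "cf (f - zmon (axis j N) * g) q = 0" using g by (auto simp: vanish_ideal_def)
    then show "cf f q = 0" using q by (auto simp: cf_zmon_mult axis_le_iff)
  qed
qed

lemma vanish_ideal_nzd:
  assumes "j \<notin> S" "zmon (axis j N) * f \<in> vanish_ideal N S"
  shows "f \<in> vanish_ideal N S"
  unfolding vanish_ideal_def
proof (intro CollectI allI impI)
  fix q assume q: "\<forall>i\<in>S. q $ i < N"
  have "\<forall>i\<in>S. (axis j N + q) $ i < N" using q assms(1) by (auto simp: axis_def)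
  then have "cf (zmon (axis j N) * f) (axis j N + q) = 0"
    using assms(2) unfolding vanish_ideal_def by blast
  moreover have "axis j N \<le> axis j N + q" by (simp add: less_eq_vec_def)
  ultimately show "cf f q = 0" by (simp add: cf_zmon_mult)
qed

text \<open>Modulo the \<open>N\<close>-th powers of all variables consider degree
  \<open>i + CARD('n)\<close>, which exceeds \<open>card D\<close>, so that there are no chains.
  Undoing the division by one power at a time lowers the degree by one, by
  \<open>koszul_acyclic_lift\<close>.\<close>

lemma koszul_acyclic_depth:
  fixes y :: "nat \<Rightarrow> 'n::finite mps"
  assumes D: "finite D"
    and X: "\<And>j. zmon (axis j 1) ^ N \<in> generated D y"
    and "card D < i + CARD('n)"
  shows "koszul_acyclic D y {0} i"
proof -
  have "card D < i + card (UNIV - S) \<Longrightarrow> koszul_acyclic D y (vanish_ideal N S) i" for S :: "'n set" and i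
  proof (induction "card (UNIV - S)" arbitrary: S i)
    case 0
    then have "card D < i" by presburger
    then show ?case by (intro koszul_acyclic_above[OF D] is_ideal_vanish)
  next
    case (Suc m)
    then obtain j where j: "j \<notin> S"
      by (metis Compl_eq_Diff_UNIV ComplD card.empty ex_in_conv nat.distinct(1))
    have "UNIV - S = insert j (UNIV - insert j S)" using j by auto
    then have card: "card (UNIV - S) = Suc (card (UNIV - insert j S))"
      by (metis Diff_iff card_insert_disjoint finite insertCI)
    obtain \<alpha> where \<alpha>: "zmon (axis j N) = (\<Sum>a\<in>D. \<alpha> a * y a)"
      using X[of j] unfolding power_axis generated_def by blast
    show ?case
    proof (rule koszul_acyclic_lift[OF D is_ideal_vanish _ _ \<alpha>])
      show "koszul_acyclic D y (vanish_ideal N (insert j S)) (Suc i)"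
        using Suc card by (intro Suc.hyps(1)) auto
    qed (use vanish_ideal_nzd[OF j] vanish_ideal_insert[OF j] in auto)
  qed
  from this[of i "{}"] have "koszul_acyclic D y (vanish_ideal N {}) i" using assms(3) by simp
  moreover have "vanish_ideal N {} = {0 :: 'n mps}"
    by (auto simp: vanish_ideal_def intro: mps_eqI)
  ultimately show ?thesis by simp
qed

text \<open>By the long exact sequence, acyclicity with \<open>x\<close> makes multiplication by
  \<open>y x\<close> surjective on the homology without \<open>x\<close>: every cycle
  \<open>c\<close> is \<open>d b + y x * c'\<close> with a cycle \<open>c'\<close>. Iterating gives
  \<open>c = d (b_0 + y x * b_1 + (y x)^2 * b_2 + \<dots>)\<close>, and the sum converges because
  \<open>y x\<close> has no constant term.\<close>

lemma koszul_acyclic_remove_last: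
  fixes y :: "nat \<Rightarrow> 'n::finite mps"
  assumes D: "finite D" "\<And>a. a \<in> D \<Longrightarrow> a < x" and yx: "ord_ge 1 (y x)"
    and ac: "koszul_acyclic (insert x D) y {0} i"
  shows "koszul_acyclic D y {0} i"
proof -
  have xD: "x \<notin> D" using D(2) by blast
  have step: "\<exists>b c'. chain D (Suc i) b \<and> chain D i c' \<and> (\<forall>A. koszul_d D y c' A = 0) \<and>
      (\<forall>A. c A = koszul_d D y b A + y x * c' A)"
    if c: "chain D i c" "\<And>A. koszul_d D y c A = 0" for c
  proof -
    have "chain (insert x D) i c" using c(1) by (auto simp: chain_def)
    moreover have "koszul_d (insert x D) y c A = 0" for A
    proof -
      have "c (insert x A) = 0" using xD by (intro chain_eq_0[OF c(1)]) auto
      then have "koszul_d (insert x D) y c A = koszul_d D y c A"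
        unfolding koszul_d_def using D(1) xD by (intro sum.mono_neutral_right) auto
      then show ?thesis using c(2) by simp
    qed
    ultimately obtain b where b: "chain (insert x D) (Suc i) b"
      and cb: "\<And>A. c A = koszul_d (insert x D) y b A"
      using ac unfolding koszul_acyclic_def by (auto simp: eq_iff_diff_eq_0[symmetric])
    define b0 where "b0 A = (if A \<subseteq> D then b A else 0)" for A
    \<comment> \<open>As \<open>x\<close> exceeds all indices in \<open>D\<close>, its sign against
      any set of size \<open>i\<close> is \<open>(- 1) ^ i\<close>; the factor absorbs it.\<close>
    define b1 where "b1 A = (if A \<subseteq> D then (- 1) ^ i * b (insert x A) else 0)" for A
    have b0: "chain D (Suc i) b0" using b by (auto simp: chain_def b0_def)
    have b1: "chain D i b1"
      unfolding chain_def
    proof (intro allI impI)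
      fix A assume "b1 A \<noteq> 0"
      then have A: "A \<subseteq> D" "b (insert x A) \<noteq> 0" by (auto simp: b1_def split: if_splits)
      then have "card (insert x A) = Suc i" using b by (auto simp: chain_def)
      with A xD D(1) show "A \<subseteq> D \<and> card A = i"
        by (subst (asm) card_insert_disjoint) (auto intro: finite_subset)
    qed
    have "c A = koszul_d D y b0 A + y x * b1 A" for A
    proof (cases "A \<subseteq> D \<and> card A = i")
      case False
      then have "c A = 0" "koszul_d D y b0 A = 0" "b1 A = 0"
        using c(1) b1 chain_koszul_d[OF D(1) b0, of y] unfolding chain_def by blast+
      then show ?thesis by simp
    next
      case True
      then have "{b \<in> A. b < x} = A" using D(2) by auto
      then have sgx: "koszul_sign x A = ((- 1) ^ i :: 'n mps)" using True by (simp add: koszul_sign_def)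
      have "insert x D - A = insert x (D - A)" using True xD by auto
      then have "c A = koszul_sign x A * y x * b (insert x A) + (\<Sum>a\<in>D - A. koszul_sign a A * y a * b (insert a A))"
        using D(1) xD by (simp add: cb koszul_d_def)
      also have "koszul_sign x A * y x * b (insert x A) = y x * b1 A"
        using True by (simp add: sgx b1_def)
      also have "(\<Sum>a\<in>D - A. koszul_sign a A * y a * b (insert a A)) = koszul_d D y b0 A"
        unfolding koszul_d_def using True by (intro sum.cong) (auto simp: b0_def)
      finally show ?thesis by simp
    qed
    \<comment> \<open>\<open>c\<close> has no coefficients at sets containing \<open>x\<close>;
      comparing them in \<open>c = d b\<close> shows that the \<open>x\<close>-part of
      \<open>b\<close> is a cycle.\<close>
    moreover have "koszul_d D y b1 A = 0" for A
    proof (cases "A \<subseteq> D")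
      case False
      then have "b1 (insert a A) = 0" for a by (auto simp: b1_def)
      then show ?thesis by (simp add: koszul_d_def)
    next
      case True
      then have fA: "finite A" and xA: "x \<notin> A" using D(1) xD finite_subset by auto
      have "0 = c (insert x A)" using xD by (intro chain_eq_0[OF c(1), symmetric]) auto
      also have "\<dots> = (\<Sum>a\<in>D - A. koszul_sign a (insert x A) * y a * b (insert a (insert x A)))"
        unfolding cb koszul_d_def using xD by (intro sum.cong) auto
      also have "\<dots> = (\<Sum>a\<in>D - A. (- 1) ^ i * (koszul_sign a A * y a * b1 (insert a A)))"
      proof (intro sum.cong refl)
        fix a assume a: "a \<in> D - A"
        then have "\<not> x < a" using D(2) by force
        then have "koszul_sign a (insert x A) = (koszul_sign a A :: 'n mps)" using fA xA by (simp add: koszul_sign_insert)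
        moreover have "b1 (insert a A) = (- 1) ^ i * b (insert a (insert x A))"
          using a True by (simp add: b1_def insert_commute)
        ultimately have "(- 1) ^ i * (koszul_sign a A * y a * b1 (insert a A)) =
            ((- 1) ^ i * (- 1) ^ i) * (koszul_sign a (insert x A) * y a * b (insert a (insert x A)))"
          by (simp only: mult_ac)
        then show "koszul_sign a (insert x A) * y a * b (insert a (insert x A)) =
            (- 1) ^ i * (koszul_sign a A * y a * b1 (insert a A))"
          by (simp flip: power_mult_distrib)
      qed
      also have "\<dots> = (- 1) ^ i * koszul_d D y b1 A" by (simp add: koszul_d_def sum_distrib_left)
      finally have "(- 1) ^ i * ((- 1) ^ i * koszul_d D y b1 A) = 0" by simp
      then show ?thesis by (simp flip: mult.assoc power_mult_distrib)
    qed
    ultimately show ?thesis using b0 b1 by blast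
  qed
  show ?thesis
    unfolding koszul_acyclic_def
  proof (intro allI impI)
    fix c assume c: "chain D i c \<and> (\<forall>A. koszul_d D y c A \<in> {0})"
    \<comment> \<open>To be iterated, the correction must be a function of the cycle:
      \<open>cs j\<close> is the \<open>j\<close>-th remainder, and \<open>bs j\<close> bounds it up
      to a multiple of \<open>y x\<close>.\<close>
    define Z where "Z = {c. chain D i c \<and> (\<forall>A. koszul_d D y c A = 0)}"
    have "\<forall>c\<in>Z. \<exists>bc. chain D (Suc i) (fst bc) \<and> snd bc \<in> Z \<and>
        (\<forall>A. c A = koszul_d D y (fst bc) A + y x * snd bc A)"
      using step unfolding Z_def by fastforce
    then obtain h where h: "\<And>c. c \<in> Z \<Longrightarrow> chain D (Suc i) (fst (h c)) \<and> snd (h c) \<in> Z \<and>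
        (\<forall>A. c A = koszul_d D y (fst (h c)) A + y x * snd (h c) A)"
      by metis
    define cs where "cs j = ((\<lambda>c. snd (h c)) ^^ j) c" for j
    define bs where "bs j = fst (h (cs j))" for j
    have cs: "cs j \<in> Z" for j
      by (induction j) (use c h in \<open>auto simp: cs_def Z_def\<close>)
    have bs: "chain D (Suc i) (bs j)" and cs_Suc: "cs j A = koszul_d D y (bs j) A + y x * cs (Suc j) A" for j A
      using h[OF cs[of j]] by (auto simp: bs_def cs_def)
    have part: "c A = koszul_d D y (\<lambda>A. \<Sum>j<N. y x ^ j * bs j A) A + y x ^ N * cs N A" for N A
    proof (induction N)
      case 0
      then show ?case by (simp add: cs_def koszul_d_def)
    next
      case (Suc N)
      have "koszul_d D y (\<lambda>A. \<Sum>j<Suc N. y x ^ j * bs j A) A =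
          koszul_d D y (\<lambda>A. \<Sum>j<N. y x ^ j * bs j A) A + y x ^ N * koszul_d D y (bs N) A"
        by (simp add: koszul_d_add koszul_d_mult)
      with Suc show ?case by (simp add: cs_Suc[of N] distrib_left mult_ac add_ac)
    qed
    have "\<forall>A. \<exists>B. \<forall>N. ord_ge N (B - (\<Sum>j<N. y x ^ j * bs j A))"
    proof
      fix A show "\<exists>B. \<forall>N. ord_ge N (B - (\<Sum>j<N. y x ^ j * bs j A))"
        by (rule mps_power_series_converges[OF yx])
    qed
    then obtain B where B: "\<And>A N. ord_ge N (B A - (\<Sum>j<N. y x ^ j * bs j A))" by metis
    have chB: "chain D (Suc i) B"
      unfolding chain_def
    proof (intro allI impI, rule ccontr)
      fix A assume "B A \<noteq> 0" "\<not> (A \<subseteq> D \<and> card A = Suc i)"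
      then have "bs j A = 0" for j using bs[of j] by (auto simp: chain_def)
      then have "B A = 0" using B[of _ A] by (intro mps_eq_0I) simp
      with \<open>B A \<noteq> 0\<close> show False by simp
    qed
    have "c A - koszul_d D y B A = 0" for A
    proof (rule mps_eq_0I)
      fix N
      have "c A - koszul_d D y B A = y x ^ N * cs N A - koszul_d D y (\<lambda>A. B A - (\<Sum>j<N. y x ^ j * bs j A)) A"
        using part[of A N] by (simp add: koszul_d_diff)
      moreover have "ord_ge N (y x ^ N * cs N A)"
        using ord_ge_mult[OF ord_ge_power[OF yx, of N] ord_ge_0] by simp
      moreover have "ord_ge N (koszul_d D y (\<lambda>A. B A - (\<Sum>j<N. y x ^ j * bs j A)) A)"
        unfolding koszul_d_def by (intro ord_ge_sum ord_ge_mult_left B)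
      ultimately show "ord_ge N (c A - koszul_d D y B A)" by (simp add: ord_ge_diff)
    qed
    with chB show "\<exists>b. chain D (Suc i) b \<and> (\<forall>A. c A - koszul_d D y b A \<in> {0})" by auto
  qed
qed

section \<open>Prime chains and Kronecker's theorem\<close>

text \<open>An ideal \<open>M\<close> maximal among those missing \<open>T\<close> is prime: for
  \<open>a\<close> and \<open>b\<close> outside, both \<open>M + (a)\<close> and
  \<open>M + (b)\<close> meet \<open>T\<close>, and the product of two such witnesses lies in
  \<open>M + (a b)\<close>.\<close>

lemma (in cring) exists_primeideal_disjoint:
  assumes I: "ideal I R" and T: "T \<subseteq> carrier R" "\<one> \<in> T"
    and mult: "\<And>s t. s \<in> T \<Longrightarrow> t \<in> T \<Longrightarrow> s \<otimes> t \<in> T" and disj: "I \<inter> T = {}"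
  shows "\<exists>P. primeideal P R \<and> I \<subseteq> P \<and> P \<inter> T = {}"
proof -
  define \<A> where "\<A> = {J. ideal J R \<and> I \<subseteq> J \<and> J \<inter> T = {}}"
  have "\<exists>M\<in>\<A>. \<forall>J\<in>\<A>. M \<subseteq> J \<longrightarrow> J = M"
  proof (rule subset_Zorn_nonempty)
    show "\<A> \<noteq> {}" using I disj by (auto simp: \<A>_def)
    fix C assume C: "C \<noteq> {}" "subset.chain \<A> C"
    then have "subset.chain {J. ideal J R} C"
      unfolding subset.chain_def \<A>_def by auto
    from chain_Union_is_ideal[OF this] have "ideal (\<Union>C) R" using C(1) by simp
    then show "\<Union>C \<in> \<A>"
      using C unfolding subset.chain_def \<A>_def by blast
  qed
  then obtain M where M: "ideal M R" "I \<subseteq> M" "M \<inter> T = {}"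
    and max: "\<And>J. ideal J R \<Longrightarrow> J \<inter> T = {} \<Longrightarrow> M \<subseteq> J \<Longrightarrow> J = M"
    unfolding \<A>_def by (auto 0 4)
  interpret M: ideal M R by fact
  have key: "\<exists>m\<in>M. \<exists>r\<in>carrier R. m \<oplus> r \<otimes> a \<in> T" if a: "a \<in> carrier R" "a \<notin> M" for a
  proof (rule ccontr)
    assume no: "\<not> ?thesis"
    have idl: "ideal (M <+>\<^bsub>R\<^esub> PIdl a) R"
      using add_ideals[OF M(1) cgenideal_ideal[OF a(1)]] .
    have mem: "x \<in> M <+>\<^bsub>R\<^esub> PIdl a \<longleftrightarrow> (\<exists>m\<in>M. \<exists>r\<in>carrier R. x = m \<oplus> r \<otimes> a)" for x
      unfolding set_add_def' cgenideal_def by auto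
    have "(M <+>\<^bsub>R\<^esub> PIdl a) \<inter> T = {}" using no mem by auto
    moreover have "M \<subseteq> M <+>\<^bsub>R\<^esub> PIdl a"
    proof
      fix m assume m: "m \<in> M"
      then have "m = m \<oplus> \<zero> \<otimes> a" using a(1) M.Icarr by simp
      then show "m \<in> M <+>\<^bsub>R\<^esub> PIdl a" using m mem by blast
    qed
    ultimately have "M <+>\<^bsub>R\<^esub> PIdl a = M" using max idl by blast
    moreover have "a = \<zero> \<oplus> \<one> \<otimes> a" using a(1) by simp
    then have "a \<in> M <+>\<^bsub>R\<^esub> PIdl a" using mem M.zero_closed by blast
    ultimately show False using a(2) by blast
  qed
  have "primeideal M R"
  proof (rule primeidealI[OF M(1)])
    show "cring R" by (rule is_cring)
    show "carrier R \<noteq> M" using T M(3) by auto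
    fix a b assume ab: "a \<in> carrier R" "b \<in> carrier R" "a \<otimes> b \<in> M"
    show "a \<in> M \<or> b \<in> M"
    proof (rule ccontr)
      assume "\<not> (a \<in> M \<or> b \<in> M)"
      then obtain m r m' r' where *: "m \<in> M" "r \<in> carrier R" "m \<oplus> r \<otimes> a \<in> T"
        "m' \<in> M" "r' \<in> carrier R" "m' \<oplus> r' \<otimes> b \<in> T"
        using key ab by meson
      have "(m \<oplus> r \<otimes> a) \<otimes> (m' \<oplus> r' \<otimes> b) =
          (m' \<oplus> r' \<otimes> b) \<otimes> m \<oplus> ((r \<otimes> a) \<otimes> m' \<oplus> (r \<otimes> r') \<otimes> (a \<otimes> b))"
        using * ab M.Icarr[OF *(1)] M.Icarr[OF *(4)] by algebra
      also have "\<dots> \<in> M"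
      proof (intro M.a_closed)
        show "(m' \<oplus> r' \<otimes> b) \<otimes> m \<in> M" "(r \<otimes> a) \<otimes> m' \<in> M" "(r \<otimes> r') \<otimes> (a \<otimes> b) \<in> M"
          using * ab M.Icarr[OF *(4)] by (simp_all add: M.I_l_closed)
      qed
      finally show False using mult[OF *(3) *(6)] M(3) by blast
    qed
  qed
  with M show ?thesis by blast
qed

text \<open>The iterated boundary monoid of Coquand and Lombardi; \<open>U\<close> takes the place of the units.\<close>

fun boundary_monoid :: "('a, 'b) ring_scheme \<Rightarrow> 'a set \<Rightarrow> 'a list \<Rightarrow> 'a set" where
  "boundary_monoid R U [] = U"
| "boundary_monoid R U (x # xs) = {x [^]\<^bsub>R\<^esub> (n :: nat) \<otimes>\<^bsub>R\<^esub> (s \<oplus>\<^bsub>R\<^esub> a \<otimes>\<^bsub>R\<^esub> x) | n s a. s \<in> boundary_monoid R U xs \<and> a \<in> carrier R}"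

lemma boundary_monoid_ConsI: "s \<in> boundary_monoid R U xs \<Longrightarrow> a \<in> carrier R \<Longrightarrow>
    x [^]\<^bsub>R\<^esub> (n :: nat) \<otimes>\<^bsub>R\<^esub> (s \<oplus>\<^bsub>R\<^esub> a \<otimes>\<^bsub>R\<^esub> x) \<in> boundary_monoid R U (x # xs)"
  by auto

context cring
begin

lemma boundary_monoid_submonoid:
  assumes "U \<subseteq> carrier R" "\<one> \<in> U" "\<And>s t. s \<in> U \<Longrightarrow> t \<in> U \<Longrightarrow> s \<otimes> t \<in> U"
    and "set xs \<subseteq> carrier R"
  shows "boundary_monoid R U xs \<subseteq> carrier R \<and> \<one> \<in> boundary_monoid R U xs \<and>
    (\<forall>s\<in>boundary_monoid R U xs. \<forall>t\<in>boundary_monoid R U xs. s \<otimes> t \<in> boundary_monoid R U xs)"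
  using assms(4)
proof (induction xs)
  case (Cons x xs)
  then have x: "x \<in> carrier R" and IH: "boundary_monoid R U xs \<subseteq> carrier R" "\<one> \<in> boundary_monoid R U xs"
      "\<And>s t. s \<in> boundary_monoid R U xs \<Longrightarrow> t \<in> boundary_monoid R U xs \<Longrightarrow> s \<otimes> t \<in> boundary_monoid R U xs"
    by auto
  show ?case
  proof (intro conjI ballI)
    show "boundary_monoid R U (x # xs) \<subseteq> carrier R" using x IH by auto
    have "\<one> = x [^] (0::nat) \<otimes> (\<one> \<oplus> \<zero> \<otimes> x)" using x by simp
    then show "\<one> \<in> boundary_monoid R U (x # xs)" using boundary_monoid_ConsI[OF IH(2) zero_closed] by metis
    fix s t assume "s \<in> boundary_monoid R U (x # xs)" "t \<in> boundary_monoid R U (x # xs)"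
    then obtain n s' a m t' b where st: "s = x [^] (n::nat) \<otimes> (s' \<oplus> a \<otimes> x)"
      "t = x [^] (m::nat) \<otimes> (t' \<oplus> b \<otimes> x)" "s' \<in> boundary_monoid R U xs" "t' \<in> boundary_monoid R U xs"
      "a \<in> carrier R" "b \<in> carrier R" by auto
    then have c: "s' \<in> carrier R" "t' \<in> carrier R" "x [^] n \<in> carrier R" "x [^] m \<in> carrier R"
      using IH(1) x by auto
    have "s \<otimes> t = (x [^] n \<otimes> x [^] m) \<otimes> ((s' \<otimes> t') \<oplus> (s' \<otimes> b \<oplus> a \<otimes> t' \<oplus> a \<otimes> b \<otimes> x) \<otimes> x)"
      unfolding st(1,2) using c st(5,6) x by algebra
    also have "x [^] n \<otimes> x [^] m = x [^] (n + m)" using x by (simp add: nat_pow_mult)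
    finally have "s \<otimes> t = x [^] (n + m) \<otimes> ((s' \<otimes> t') \<oplus> (s' \<otimes> b \<oplus> a \<otimes> t' \<oplus> a \<otimes> b \<otimes> x) \<otimes> x)" .
    moreover have "s' \<otimes> b \<oplus> a \<otimes> t' \<oplus> a \<otimes> b \<otimes> x \<in> carrier R" using c st x by simp
    ultimately show "s \<otimes> t \<in> boundary_monoid R U (x # xs)" using boundary_monoid_ConsI[OF IH(3)[OF st(3,4)]] by metis
  qed
next
  case Nil
  then show ?case using assms(1-3) by simp
qed

text \<open>If a prime \<open>Q\<close> misses the boundary monoid of \<open>x # xs\<close>, then
  \<open>Q + (x)\<close> misses that of \<open>xs\<close>: with \<open>m + r x\<close> in the
  latter, \<open>m = (m + r x) - r x\<close> would lie in the former. Since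
  \<open>x = x^1 (1 + 0 x)\<close> lies in the former as well, \<open>x\<close> is not in
  \<open>Q\<close>, and the inclusion into the next prime is strict.\<close>

lemma prime_chain_of_boundary:
  assumes U: "U \<subseteq> carrier R" "\<one> \<in> U" "\<And>s t. s \<in> U \<Longrightarrow> t \<in> U \<Longrightarrow> s \<otimes> t \<in> U"
    and "set xs \<subseteq> carrier R" "ideal I R" "I \<inter> boundary_monoid R U xs = {}"
  shows "\<exists>P. prime_chain R (length xs) P \<and> I \<subseteq> P 0"
  using assms(4-6)
proof (induction xs arbitrary: I)
  case Nil
  then obtain P where "primeideal P R" "I \<subseteq> P"
    using exists_primeideal_disjoint[of I U] U by auto
  then show ?case by (intro exI[of _ "\<lambda>_. P"]) (auto simp: prime_chain_def)
next
  case (Cons x xs)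
  note boundary_monoid = boundary_monoid_submonoid[OF U(1,2), of "x # xs"] boundary_monoid_submonoid[OF U(1,2), of xs]
  have x: "x \<in> carrier R" using Cons.prems by simp
  obtain Q where Q: "primeideal Q R" "I \<subseteq> Q" "Q \<inter> boundary_monoid R U (x # xs) = {}"
    using exists_primeideal_disjoint[of I "boundary_monoid R U (x # xs)"] boundary_monoid(1) U(3) Cons.prems by blast
  interpret Q: primeideal Q R by fact
  have one: "\<one> \<in> boundary_monoid R U xs" and sub: "boundary_monoid R U xs \<subseteq> carrier R"
    using boundary_monoid(2) U(3) Cons.prems(1) by auto
  have mem: "y \<in> Q <+>\<^bsub>R\<^esub> PIdl x \<longleftrightarrow> (\<exists>m\<in>Q. \<exists>r\<in>carrier R. y = m \<oplus> r \<otimes> x)" for y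
    unfolding set_add_def' cgenideal_def by auto
  have "(Q <+>\<^bsub>R\<^esub> PIdl x) \<inter> boundary_monoid R U xs = {}"
  proof (rule ccontr)
    assume "\<not> ?thesis"
    then obtain y where "y \<in> Q <+>\<^bsub>R\<^esub> PIdl x" "y \<in> boundary_monoid R U xs" by blast
    then obtain m r where mr: "m \<in> Q" "r \<in> carrier R" "m \<oplus> r \<otimes> x \<in> boundary_monoid R U xs"
      unfolding mem by blast
    have mc: "m \<in> carrier R" using mr(1) Q.Icarr by simp
    have "m = x [^] (0::nat) \<otimes> ((m \<oplus> r \<otimes> x) \<oplus> (\<ominus> r) \<otimes> x)"
      using mc mr(2) x by (simp add: a_assoc l_minus r_neg)
    then have "m \<in> boundary_monoid R U (x # xs)" using boundary_monoid_ConsI[OF mr(3), of "\<ominus> r" x 0] mr(2) by simp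
    then show False using mr(1) Q(3) by blast
  qed
  moreover have "ideal (Q <+>\<^bsub>R\<^esub> PIdl x) R"
    using add_ideals[OF Q.is_ideal cgenideal_ideal[OF x]] .
  ultimately obtain P where P: "prime_chain R (length xs) P" "Q <+>\<^bsub>R\<^esub> PIdl x \<subseteq> P 0"
    using Cons.IH Cons.prems(1) by fastforce
  have "Q \<subseteq> P 0"
  proof
    fix m assume m: "m \<in> Q"
    then have "m = m \<oplus> \<zero> \<otimes> x" using x Q.Icarr by simp
    then show "m \<in> P 0" using P(2) m mem by blast
  qed
  moreover have "x = \<zero> \<oplus> \<one> \<otimes> x" using x by simp
  then have "x \<in> P 0" using P(2) mem Q.zero_closed by blast
  moreover have "x \<notin> Q"
  proof -
    have "x = x [^] (1::nat) \<otimes> (\<one> \<oplus> \<zero> \<otimes> x)" using x by (simp add: nat_pow_eone)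
    then have "x \<in> boundary_monoid R U (x # xs)" using boundary_monoid_ConsI[OF one zero_closed] by metis
    then show ?thesis using Q(3) by blast
  qed
  ultimately have "Q \<subset> P 0" by blast
  then have "prime_chain R (length (x # xs)) (case_nat Q P)"
    using P(1) Q(1) unfolding prime_chain_def
    by (auto split: nat.split)
  then show ?case using Q(2) by (intro exI[of _ "case_nat Q P"]) auto
qed

text \<open>Otherwise \<open>prime_chain_of_boundary\<close>, applied to the zero ideal, produces a
  chain that is too long. A bound on the dimension thus becomes an explicit equation between ring
  elements.\<close>

lemma zero_in_boundary:
  assumes U: "U \<subseteq> carrier R" "\<one> \<in> U" "\<And>s t. s \<in> U \<Longrightarrow> t \<in> U \<Longrightarrow> s \<otimes> t \<in> U"
    and "set xs \<subseteq> carrier R" "krull_dim R < ereal (real (length xs))"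
  shows "\<zero> \<in> boundary_monoid R U xs"
proof (rule ccontr)
  assume "\<zero> \<notin> boundary_monoid R U xs"
  then obtain P where "prime_chain R (length xs) P"
    using prime_chain_of_boundary[OF assms(1-4) zeroideal] by blast
  then have "ereal (real (length xs)) \<le> krull_dim R"
    unfolding krull_dim_def by (intro SUP_upper) auto
  with assms(5) show False by simp
qed

end

text \<open>The coefficients are lifted one by one. For a quotient map, a zero in the boundary
  monoid below becomes an element of the ideal in the boundary monoid above.\<close>

lemma boundary_monoid_hom_lift:
  assumes R: "ring R" and S: "ring S" and h: "h \<in> ring_hom R S" "h ` carrier R = carrier S"
    and U: "U \<subseteq> carrier R" and xs: "set xs \<subseteq> carrier R"
    and t: "t \<in> boundary_monoid S (h ` U) (map h xs)"
  shows "\<exists>t'\<in>boundary_monoid R U xs. t' \<in> carrier R \<and> h t' = t"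
  using xs t
proof (induction xs arbitrary: t)
  case Nil
  then show ?case using U by auto
next
  case (Cons x xs)
  interpret ring R by fact
  interpret S: ring S by fact
  interpret H: ring_hom_ring R S h by (rule ring_hom_ringI2[OF R S h(1)])
  obtain n s a where t: "t = h x [^]\<^bsub>S\<^esub> (n::nat) \<otimes>\<^bsub>S\<^esub> (s \<oplus>\<^bsub>S\<^esub> a \<otimes>\<^bsub>S\<^esub> h x)"
    "s \<in> boundary_monoid S (h ` U) (map h xs)" "a \<in> carrier S"
    using Cons.prems by auto
  obtain s' where s': "s' \<in> boundary_monoid R U xs" "s' \<in> carrier R" "h s' = s"
    using Cons.IH[OF _ t(2)] Cons.prems by auto
  have "a \<in> h ` carrier R" using t(3) by (simp only: h(2))
  then obtain a' where a': "a' \<in> carrier R" "h a' = a" by auto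
  have x: "x \<in> carrier R" using Cons.prems(1) by simp
  let ?t = "x [^]\<^bsub>R\<^esub> n \<otimes>\<^bsub>R\<^esub> (s' \<oplus>\<^bsub>R\<^esub> a' \<otimes>\<^bsub>R\<^esub> x)"
  have pow: "h (x [^]\<^bsub>R\<^esub> m) = h x [^]\<^bsub>S\<^esub> m" for m :: nat
    by (induction m) (use x in \<open>simp_all add: H.hom_mult\<close>)
  have "h ?t = h (x [^]\<^bsub>R\<^esub> n) \<otimes>\<^bsub>S\<^esub> (h s' \<oplus>\<^bsub>S\<^esub> h a' \<otimes>\<^bsub>S\<^esub> h x)"
    using x s'(2) a'(1) by simp
  then have "h ?t = t" unfolding pow s'(3) a'(2) t(1) .
  moreover have "?t \<in> carrier R" using x s' a' by simp
  ultimately show ?case using boundary_monoid_ConsI[OF s'(1) a'(1)] by blast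
qed

text \<open>The boundary monoid in a type class ring. \<open>C\<close> records where the
  coefficients come from, so that the generators built from convergent series stay
  convergent.\<close>

fun boundary_monoid_in :: "'a::comm_ring_1 set \<Rightarrow> 'a set \<Rightarrow> 'a list \<Rightarrow> 'a set" where
  "boundary_monoid_in C U [] = U"
| "boundary_monoid_in C U (x # xs) = {x ^ n * (s + a * x) | n s a. s \<in> boundary_monoid_in C U xs \<and> a \<in> C}"

definition is_radical_ideal :: "'a::comm_ring_1 set \<Rightarrow> bool" where
  "is_radical_ideal J \<longleftrightarrow> is_ideal J \<and> (\<forall>f n. f ^ n \<in> J \<longrightarrow> f \<in> J)"

definition is_subring :: "'a::comm_ring_1 set \<Rightarrow> bool" where
  "is_subring C \<longleftrightarrow> 1 \<in> C \<and> (\<forall>x\<in>C. \<forall>y\<in>C. x - y \<in> C \<and> x * y \<in> C)"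

lemma is_subring_one: "is_subring C \<Longrightarrow> 1 \<in> C"
  and is_subring_diff: "is_subring C \<Longrightarrow> x \<in> C \<Longrightarrow> y \<in> C \<Longrightarrow> x - y \<in> C"
  and is_subring_mult: "is_subring C \<Longrightarrow> x \<in> C \<Longrightarrow> y \<in> C \<Longrightarrow> x * y \<in> C"
  unfolding is_subring_def by blast+

lemma is_subring_zero: "is_subring C \<Longrightarrow> 0 \<in> C"
  using is_subring_diff[of C 1 1] is_subring_one[of C] by simp

lemma is_subring_add: "is_subring C \<Longrightarrow> x \<in> C \<Longrightarrow> y \<in> C \<Longrightarrow> x + y \<in> C"
  using is_subring_diff[of C x "0 - y"] is_subring_diff[of C 0 y] is_subring_zero[of C] by simp

lemma is_subring_power: "is_subring C \<Longrightarrow> x \<in> C \<Longrightarrow> x ^ n \<in> C"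
  by (induction n) (auto intro: is_subring_one is_subring_mult)

lemma boundary_monoid_in_subset:
  assumes "is_subring C" "U \<subseteq> C" "set xs \<subseteq> C" shows "boundary_monoid_in C U xs \<subseteq> C"
  using assms(3)
proof (induction xs)
  case (Cons x xs)
  then show ?case using assms
    by (auto intro!: is_subring_mult is_subring_add is_subring_power)
next
  case Nil
  then show ?case using assms(2) by simp
qed

text \<open>Kronecker's theorem in the local case, after Coquand: the element \<open>a\<close> is absorbed into the other
  generators. The coefficient of \<open>a\<close> in each new generator is the factor complementary to the old
  one in \<open>t\<close>.\<close>

lemma kronecker_step:
  fixes a :: "'a::comm_ring_1"
  assumes C: "is_subring C" and U: "U \<subseteq> C"
    and unit: "\<And>s \<alpha>. s \<in> U \<Longrightarrow> \<alpha> \<in> C \<Longrightarrow> \<exists>v. v * (s + \<alpha> * a) = 1"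
    and a: "a \<in> C" and "set xs \<subseteq> C" and "t \<in> boundary_monoid_in C U (xs @ [a])"
  shows "\<exists>ys. list_all2 (\<lambda>x y. \<exists>c\<in>C. y = x + a * c) xs ys \<and>
    (\<forall>J. is_radical_ideal J \<longrightarrow> set ys \<subseteq> J \<longrightarrow> t \<in> J \<longrightarrow> a \<in> J)"
  using assms(5,6)
proof (induction xs arbitrary: t)
  case Nil
  then obtain n s \<alpha> where t: "t = a ^ n * (s + \<alpha> * a)" "s \<in> U" "\<alpha> \<in> C" by auto
  obtain v where v: "v * (s + \<alpha> * a) = 1" using unit t by blast
  have "a \<in> J" if J: "is_radical_ideal J" "t \<in> J" for J
  proof -
    have "v * t \<in> J" using J is_ideal_mult by (auto simp: is_radical_ideal_def)
    moreover have "v * t = a ^ n * (v * (s + \<alpha> * a))" by (simp add: t(1) mult_ac)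
    ultimately have "a ^ n \<in> J" by (simp add: v)
    then show ?thesis using J by (auto simp: is_radical_ideal_def)
  qed
  then show ?case by auto
next
  case (Cons b xs)
  then obtain n s \<alpha> where t: "t = b ^ n * (s + \<alpha> * b)" "s \<in> boundary_monoid_in C U (xs @ [a])" "\<alpha> \<in> C" by auto
  have sub: "b \<in> C" "set xs \<subseteq> C" using Cons.prems by auto
  obtain ys where ys: "list_all2 (\<lambda>x y. \<exists>c\<in>C. y = x + a * c) xs ys"
    and J: "\<And>J. is_radical_ideal J \<Longrightarrow> set ys \<subseteq> J \<Longrightarrow> s \<in> J \<Longrightarrow> a \<in> J"
    using Cons.IH[OF sub(2) t(2)] by blast
  define c where "c = s + \<alpha> * b"
  have "s \<in> C" using t(2) boundary_monoid_in_subset[OF C U, of "xs @ [a]"] sub a by auto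
  then have c: "c \<in> C" unfolding c_def using t(3) sub C by (auto intro!: is_subring_add is_subring_mult)
  have "a \<in> J" if rJ: "is_radical_ideal J" and ysJ: "set ((b + a * c) # ys) \<subseteq> J" and tJ: "t \<in> J" for J
  proof -
    have iJ: "is_ideal J" and rad: "\<And>f n. f ^ n \<in> J \<Longrightarrow> f \<in> J"
      using rJ by (auto simp: is_radical_ideal_def)
    have "(b * c) ^ Suc n = (b * c ^ n) * t"
      by (simp add: t(1) c_def power_mult_distrib mult_ac)
    then have bc: "b * c \<in> J" using rad is_ideal_mult[OF iJ tJ] by metis
    \<comment> \<open>The sum of \<open>b\<close> and \<open>a * c\<close> lies in \<open>J\<close>
      and so does their product; in a radical ideal this forces both elements into
      \<open>J\<close>.\<close>
    have "(a * c) ^ 2 = a * c * (b + a * c) - a * (b * c)"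
      by (simp add: power2_eq_square algebra_simps)
    then have "(a * c) ^ 2 \<in> J"
      using is_ideal_diff[OF iJ] is_ideal_mult[OF iJ] bc ysJ by auto
    then have ac: "a * c \<in> J" by (rule rad)
    have "b = (b + a * c) - a * c" by simp
    then have b: "b \<in> J" using is_ideal_diff[OF iJ _ ac] ysJ by (metis list.set_intros(1) subsetD)
    have "a * s = a * c - (a * \<alpha>) * b" by (simp add: c_def algebra_simps)
    then have as: "a * s \<in> J" using is_ideal_diff[OF iJ ac] is_ideal_mult[OF iJ b] by metis
    \<comment> \<open>The colon ideal \<open>J : a\<close> is again radical and contains
      \<open>ys\<close> and \<open>s\<close>; the induction hypothesis for it yields
      \<open>a * a \<in> J\<close>.\<close>
    define J' where "J' = {f. a * f \<in> J}"
    have "is_radical_ideal J'"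
      unfolding is_radical_ideal_def is_ideal_def
    proof (intro conjI ballI allI impI)
      show "0 \<in> J'" using is_ideal_zero[OF iJ] by (simp add: J'_def)
      show "x + y \<in> J'" if "x \<in> J'" "y \<in> J'" for x y
        using is_ideal_add[OF iJ] that by (simp add: J'_def distrib_left)
      show "r * x \<in> J'" if "x \<in> J'" for x r
        using is_ideal_mult[OF iJ, of "a * x" r] that by (simp add: J'_def mult.left_commute)
      show "f \<in> J'" if "f ^ n \<in> J'" for f n
      proof -
        have "(a * f) ^ Suc n = (a ^ n * f) * (a * f ^ n)" by (simp add: power_mult_distrib mult_ac)
        moreover have "a * f ^ n \<in> J" using that by (simp add: J'_def)
        ultimately have "(a * f) ^ Suc n \<in> J" using is_ideal_mult[OF iJ] by metis
        then have "a * f \<in> J" by (rule rad)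
        then show ?thesis by (simp add: J'_def)
      qed
    qed
    moreover have "set ys \<subseteq> J'" using ysJ is_ideal_mult[OF iJ] by (auto simp: J'_def)
    moreover have "s \<in> J'" using as by (simp add: J'_def)
    ultimately have "a * a \<in> J" using J by (auto simp: J'_def)
    then show "a \<in> J" using rad[of a 2] by (simp add: power2_eq_square)
  qed
  then show ?case using ys c by (intro exI[of _ "(b + a * c) # ys"]) auto
qed

lemma is_radical_ideal_radical:
  assumes "is_ideal I" shows "is_radical_ideal {f. \<exists>N. f ^ N \<in> I}"
  unfolding is_radical_ideal_def is_ideal_def
proof (intro conjI ballI allI impI)
  show "0 \<in> {f. \<exists>N. f ^ N \<in> I}" using is_ideal_zero[OF assms] by (auto intro: exI[of _ 1])
next
  fix f g assume "f \<in> {f. \<exists>N. f ^ N \<in> I}" "g \<in> {f. \<exists>N. f ^ N \<in> I}"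
  then obtain N M where NM: "f ^ N \<in> I" "g ^ M \<in> I" by blast
  have fN: "f ^ k \<in> I" if "N \<le> k" for k
    using is_ideal_mult[OF assms NM(1), of "f ^ (k - N)"] that by (simp flip: power_add)
  have gM: "g ^ k \<in> I" if "M \<le> k" for k
    using is_ideal_mult[OF assms NM(2), of "g ^ (k - M)"] that by (simp flip: power_add)
  have "(f + g) ^ (N + M) = (\<Sum>k\<le>N + M. of_nat ((N + M) choose k) * f ^ k * g ^ (N + M - k))"
    by (rule binomial_ring)
  also have "\<dots> \<in> I"
  proof (intro is_ideal_sum[OF assms])
    fix k assume "k \<in> {..N + M}"
    show "of_nat (N + M choose k) * f ^ k * g ^ (N + M - k) \<in> I"
    proof (cases "N \<le> k")
      case True
      then show ?thesis using is_ideal_mult[OF assms fN[OF True], of "of_nat (N + M choose k) * g ^ (N + M - k)"]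
        by (simp add: mult_ac)
    next
      case False
      then show ?thesis using is_ideal_mult[OF assms gM, of "N + M - k" "of_nat (N + M choose k) * f ^ k"]
        by simp
    qed
  qed
  finally show "f + g \<in> {f. \<exists>N. f ^ N \<in> I}" by blast
next
  fix f r assume "f \<in> {f. \<exists>N. f ^ N \<in> I}"
  then show "r * f \<in> {f. \<exists>N. f ^ N \<in> I}"
    using is_ideal_mult[OF assms] by (auto simp: power_mult_distrib)
next
  fix f n assume "f ^ n \<in> {f. \<exists>N. f ^ N \<in> I}"
  then obtain N where "(f ^ n) ^ N \<in> I" by blast
  then have "f ^ (n * N) \<in> I" by (simp add: power_mult)
  then show "f \<in> {f. \<exists>N. f ^ N \<in> I}" by blast
qed

section \<open>Convergent power series\<close>

text \<open>Absolute convergence at the point with all coordinates \<open>\<delta>\<close>, which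
  controls the closed polydisc of that radius.\<close>

definition conv_at :: "real \<Rightarrow> 'n::finite mps \<Rightarrow> bool" where
  "conv_at \<delta> f \<longleftrightarrow> (\<lambda>q. norm (cf f q) * \<delta> ^ tdeg q) summable_on UNIV"

lemma norm_monom_val_le:
  assumes "\<And>i. norm (z $ i) \<le> \<delta>" shows "norm (monom_val z q) \<le> \<delta> ^ tdeg q"
proof -
  have "norm (monom_val z q) = (\<Prod>i\<in>UNIV. norm (z $ i) ^ (q $ i))"
    by (simp add: monom_val_def norm_power flip: prod_norm)
  also have "\<dots> \<le> (\<Prod>i\<in>UNIV. \<delta> ^ (q $ i))"
    by (intro prod_mono) (auto intro: power_mono assms)
  also have "\<dots> = \<delta> ^ tdeg q" by (simp add: tdeg_def power_sum)
  finally show ?thesis .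
qed

lemma monom_val_const: "monom_val (\<chi> i. of_real \<delta>) q = of_real (\<delta> ^ tdeg q)"
  by (simp add: monom_val_def tdeg_def power_sum)

text \<open>Summability of complex families is absolute, so a single diagonal point decides about a
  neighbourhood of the origin.\<close>

lemma convergent_series_iff:
  "convergent_series (cf f) \<longleftrightarrow> (\<exists>\<delta>>0. conv_at \<delta> f)" for f :: "'n::finite mps"
proof
  assume "convergent_series (cf f)"
  then obtain \<epsilon> where \<epsilon>: "\<epsilon> > 0"
    "\<And>z. norm z < \<epsilon> \<Longrightarrow> (\<lambda>q. cf f q * monom_val z q) summable_on UNIV"
    by (auto simp: convergent_series_def)
  \<comment> \<open>\<open>CARD('n)\<close> accounts for bounding the norm of the diagonal point by
    the sum of its coordinates, and 2 makes the inequality strict.\<close>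
  define \<delta> where "\<delta> = \<epsilon> / (2 * real CARD('n))"
  have \<delta>: "\<delta> > 0" using \<epsilon> by (simp add: \<delta>_def)
  let ?z = "(\<chi> i. of_real \<delta>) :: complex ^ 'n"
  have "norm ?z \<le> (\<Sum>i\<in>(UNIV :: 'n set). norm (?z $ i))"
    unfolding norm_vec_def by (rule L2_set_le_sum) simp
  also have "\<dots> = real CARD('n) * \<delta>" using \<delta> by simp
  also have "\<dots> < \<epsilon>" using \<epsilon>(1) by (simp add: \<delta>_def)
  finally have "(\<lambda>q. cf f q * monom_val ?z q) summable_on UNIV" by (rule \<epsilon>(2))
  then have "(\<lambda>q. norm (cf f q * monom_val ?z q)) summable_on UNIV"
    by (simp add: summable_on_iff_abs_summable_on_complex)
  moreover have "norm (cf f q * monom_val ?z q) = norm (cf f q) * \<delta> ^ tdeg q" for q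
    using \<delta> by (simp add: monom_val_const norm_mult norm_power)
  ultimately have "conv_at \<delta> f" by (simp add: conv_at_def)
  with \<delta> show "\<exists>\<delta>>0. conv_at \<delta> f" by blast
next
  assume "\<exists>\<delta>>0. conv_at \<delta> f"
  then obtain \<delta> where \<delta>: "\<delta> > 0" "conv_at \<delta> f" by blast
  have "(\<lambda>q. cf f q * monom_val z q) summable_on UNIV" if "norm z < \<delta>" for z
  proof -
    have "norm (z $ i) \<le> \<delta>" for i
      using that Finite_Cartesian_Product.norm_nth_le[of z i] by linarith
    then have "norm (cf f q * monom_val z q) \<le> norm (cf f q) * \<delta> ^ tdeg q" for q
      by (simp add: norm_mult norm_monom_val_le mult_left_mono)
    then have "(\<lambda>q. norm (cf f q * monom_val z q)) summable_on UNIV"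
      by (intro Infinite_Sum.abs_summable_on_comparison_test'[OF \<delta>(2)[unfolded conv_at_def]]) auto
    then show ?thesis by (simp add: summable_on_iff_abs_summable_on_complex)
  qed
  with \<delta>(1) show "convergent_series (cf f)" unfolding convergent_series_def by blast
qed

lemma conv_at_mono:
  assumes "conv_at \<delta> f" "0 < \<delta>'" "\<delta>' \<le> \<delta>" shows "conv_at \<delta>' f"
  unfolding conv_at_def
proof (rule summable_on_comparison_test[OF assms(1)[unfolded conv_at_def]])
  show "norm (cf f q) * \<delta>' ^ tdeg q \<le> norm (cf f q) * \<delta> ^ tdeg q" for q
    using assms by (intro mult_left_mono power_mono) auto
qed (use assms in auto)

definition convergent_mps :: "'n::finite mps set" where
  "convergent_mps = {f. convergent_series (cf f)}"

lemma convergent_mpsI: "conv_at \<delta> f \<Longrightarrow> 0 < \<delta> \<Longrightarrow> f \<in> convergent_mps"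
  by (auto simp: convergent_mps_def convergent_series_iff)

lemma convergent_mps_common:
  assumes "f \<in> convergent_mps" "g \<in> convergent_mps"
  obtains \<delta> where "\<delta> > 0" "conv_at \<delta> f" "conv_at \<delta> g"
proof -
  obtain \<delta>1 \<delta>2 where "\<delta>1 > 0" "conv_at \<delta>1 f" "\<delta>2 > 0" "conv_at \<delta>2 g"
    using assms by (auto simp: convergent_mps_def convergent_series_iff)
  then have "min \<delta>1 \<delta>2 > 0" "conv_at (min \<delta>1 \<delta>2) f" "conv_at (min \<delta>1 \<delta>2) g"
    using conv_at_mono[of \<delta>1 f "min \<delta>1 \<delta>2"] conv_at_mono[of \<delta>2 g "min \<delta>1 \<delta>2"] by auto
  then show ?thesis by (rule that)
qed

lemma convergent_mps_finite: "finite {q. cf f q \<noteq> 0} \<Longrightarrow> f \<in> convergent_mps"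
  by (rule convergent_mpsI[of 1]) (auto simp: conv_at_def intro!: finite_nonzero_values_imp_summable_on)

text \<open>At a common radius the double series of norms is a product of two summable ones;
  regrouping it by \<open>a + b = q\<close> dominates the Cauchy product.\<close>

lemma convergent_mps_mult:
  fixes f g :: "'n::finite mps"
  assumes "f \<in> convergent_mps" "g \<in> convergent_mps" shows "f * g \<in> convergent_mps"
proof -
  obtain \<delta> where \<delta>: "\<delta> > 0" "conv_at \<delta> f" "conv_at \<delta> g"
    using assms by (rule convergent_mps_common)
  let ?F = "\<lambda>q. norm (cf f q) * \<delta> ^ tdeg q" and ?G = "\<lambda>q. norm (cf g q) * \<delta> ^ tdeg q"
  let ?h = "\<lambda>x :: (nat ^ 'n) \<times> (nat ^ 'n). ?F (fst x) * ?G (snd x)"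
  have FG: "?F summable_on UNIV" "?G summable_on UNIV" using \<delta> by (auto simp: conv_at_def)
  have "?h summable_on (UNIV \<times> UNIV)"
  proof (rule summable_on_SigmaI)
    show "((\<lambda>b. ?h (a, b)) has_sum ?F a * infsum ?G UNIV) UNIV" for a
      using has_sum_cmult_right[OF has_sum_infsum[OF FG(2)], of "?F a"] by simp
    show "(\<lambda>a. ?F a * infsum ?G UNIV) summable_on UNIV"
      by (rule summable_on_cmult_left[OF FG(1)])
  qed (use \<delta>(1) in auto)
  moreover have "bij_betw snd (SIGMA q : (UNIV :: (nat ^ 'n) set). splits q) (UNIV \<times> UNIV)"
    by (rule bij_betw_byWitness[where f' = "\<lambda>x. (fst x + snd x, x)"]) (auto simp: splits_def)
  ultimately have "(\<lambda>x. ?h (snd x)) summable_on (SIGMA q : UNIV. splits q)"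
    by (subst summable_on_reindex_bij_betw)
  then have "(\<lambda>q. infsum (\<lambda>x. ?h (snd (q, x))) (splits q)) summable_on UNIV"
    by (rule summable_on_SigmaD) simp
  then have s: "(\<lambda>q. \<Sum>x\<in>splits q. ?h x) summable_on UNIV" by simp
  have "norm (cf (f * g) q) * \<delta> ^ tdeg q \<le> (\<Sum>x\<in>splits q. ?h x)" for q
  proof -
    have "norm (cf (f * g) q) \<le> (\<Sum>x\<in>splits q. norm (cf f (fst x)) * norm (cf g (snd x)))"
      unfolding cf_mult by (rule sum_norm_le) (auto simp: norm_mult)
    then have "norm (cf (f * g) q) * \<delta> ^ tdeg q \<le>
        (\<Sum>x\<in>splits q. norm (cf f (fst x)) * norm (cf g (snd x)) * \<delta> ^ tdeg q)"
      using \<delta>(1) by (simp add: mult_right_mono flip: sum_distrib_right)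
    also have "\<dots> = (\<Sum>x\<in>splits q. ?h x)"
      by (intro sum.cong) (auto simp: splits_def tdeg_add power_add)
    finally show ?thesis .
  qed
  then have "conv_at \<delta> (f * g)" unfolding conv_at_def
    by (intro summable_on_comparison_test[OF s]) (use \<delta>(1) in auto)
  then show ?thesis using \<delta>(1) by (rule convergent_mpsI)
qed

lemma convergent_mps_diff:
  assumes "f \<in> convergent_mps" "g \<in> convergent_mps" shows "f - g \<in> convergent_mps"
proof -
  obtain \<delta> where \<delta>: "\<delta> > 0" "conv_at \<delta> f" "conv_at \<delta> g"
    using assms by (rule convergent_mps_common)
  have s: "(\<lambda>q. norm (cf f q) * \<delta> ^ tdeg q + norm (cf g q) * \<delta> ^ tdeg q) summable_on UNIV"
    using \<delta> unfolding conv_at_def by (intro summable_on_add)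
  have "norm (cf (f - g) q) * \<delta> ^ tdeg q \<le> norm (cf f q) * \<delta> ^ tdeg q + norm (cf g q) * \<delta> ^ tdeg q" for q
    using \<delta>(1) norm_triangle_ineq4[of "cf f q" "cf g q"]
    by (simp add: mult_right_mono flip: distrib_right)
  then have "conv_at \<delta> (f - g)" unfolding conv_at_def
    by (intro summable_on_comparison_test[OF s]) (use \<delta>(1) in auto)
  then show ?thesis using \<delta>(1) by (rule convergent_mpsI)
qed

lemma convergent_mps_subring: "is_subring convergent_mps"
  unfolding is_subring_def
proof (intro conjI ballI)
  show "1 \<in> convergent_mps"
    by (rule convergent_mps_finite) (auto simp: cf_one)
qed (auto intro: convergent_mps_diff convergent_mps_mult)

lemma convergent_mps_restrict:
  assumes "f \<in> convergent_mps" "\<And>q. cf g q = 0 \<or> cf g q = cf f q"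
  shows "g \<in> convergent_mps"
proof -
  obtain \<delta> where \<delta>: "\<delta> > 0" "conv_at \<delta> f"
    using convergent_mps_common[OF assms(1) assms(1)] by blast
  have "norm (cf g q) * \<delta> ^ tdeg q \<le> norm (cf f q) * \<delta> ^ tdeg q" for q
    using assms(2)[of q] \<delta>(1) by auto
  then have "conv_at \<delta> g" unfolding conv_at_def
    by (intro summable_on_comparison_test[OF \<delta>(2)[unfolded conv_at_def]]) (use \<delta>(1) in auto)
  then show ?thesis using \<delta>(1) by (rule convergent_mpsI)
qed

text \<open>Dividing by \<open>z^a\<close> changes the terms at radius \<open>\<delta>\<close> by
  the constant factor \<open>\<delta> ^ tdeg a\<close>. It provides the convergent coefficients in
  \<open>filt_eq\<close>.\<close>

lemma convergent_mps_shift: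
  assumes "f \<in> convergent_mps" "\<And>q. cf g q = 0 \<or> cf g q = cf f (a + q)"
  shows "g \<in> convergent_mps"
proof -
  obtain \<delta> where \<delta>: "\<delta> > 0" "conv_at \<delta> f"
    using convergent_mps_common[OF assms(1) assms(1)] by blast
  let ?F = "\<lambda>q. norm (cf f q) * \<delta> ^ tdeg q"
  have "?F summable_on (range ((+) a))"
    using \<delta>(2) unfolding conv_at_def by (rule summable_on_subset_banach) simp
  then have "(\<lambda>q. ?F (a + q)) summable_on UNIV"
    by (subst (asm) summable_on_reindex) (auto simp: o_def)
  then have s: "(\<lambda>q. ?F (a + q) * (1 / \<delta> ^ tdeg a)) summable_on UNIV"
    by (rule summable_on_cmult_left)
  have "norm (cf g q) * \<delta> ^ tdeg q \<le> ?F (a + q) * (1 / \<delta> ^ tdeg a)" for q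
    using assms(2)[of q] \<delta>(1) by (auto simp: tdeg_add power_add)
  then have "conv_at \<delta> g" unfolding conv_at_def
    by (intro summable_on_comparison_test[OF s]) (use \<delta>(1) in auto)
  then show ?thesis using \<delta>(1) by (rule convergent_mpsI)
qed

lemma zmon_convergent: "zmon q \<in> convergent_mps"
  by (rule convergent_mps_finite) (auto simp: cf_zmon)

lemma cst_convergent: "cst a \<in> convergent_mps"
  by (rule convergent_mps_finite) (auto simp: cf_cst)

lemmas convergent_mps_add = is_subring_add[OF convergent_mps_subring]
  and convergent_mps_zero = is_subring_zero[OF convergent_mps_subring]
  and convergent_mps_one = is_subring_one[OF convergent_mps_subring]

section \<open>The ring of convergent power series and its ideals\<close>

lemma carrier_O: "carrier \<O> = cf ` convergent_mps"
proof -
  have "f \<in> cf ` convergent_mps" if "convergent_series f" for f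
    using that by (intro image_eqI[of _ _ "Ms f"]) (auto simp: convergent_mps_def)
  then show ?thesis by (auto simp: \<O>_def convergent_mps_def)
qed

lemma carrier_O_iff: "f \<in> carrier \<O> \<longleftrightarrow> Ms f \<in> convergent_mps"
  by (simp add: \<O>_def convergent_mps_def)

lemma O_simps:
  "cf f \<otimes>\<^bsub>\<O>\<^esub> cf g = cf (f * g)" "cf f \<oplus>\<^bsub>\<O>\<^esub> cf g = cf (f + g)" "\<one>\<^bsub>\<O>\<^esub> = cf 1" "\<zero>\<^bsub>\<O>\<^esub> = cf 0"
  by (auto simp: \<O>_def times_mps_def plus_mps_def one_mps_def zero_mps_def splits_def)

lemma cring_O: "cring (\<O> :: 'n::finite series ring)"
proof (rule cringI)
  show "abelian_group (\<O> :: 'n series ring)"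
  proof (rule abelian_groupI)
    fix x :: "'n series" assume "x \<in> carrier \<O>"
    then obtain f where f: "x = cf f" "f \<in> convergent_mps" by (auto simp: carrier_O)
    have "cf (0 - f) \<oplus>\<^bsub>\<O>\<^esub> x = \<zero>\<^bsub>\<O>\<^esub>" by (simp add: f O_simps)
    moreover have "0 - f \<in> convergent_mps" using f convergent_mps_diff convergent_mps_zero by blast
    ultimately show "\<exists>y\<in>carrier \<O>. y \<oplus>\<^bsub>\<O>\<^esub> x = \<zero>\<^bsub>\<O>\<^esub>" by (auto simp: carrier_O)
  qed (auto simp: carrier_O O_simps convergent_mps_add convergent_mps_zero add_ac)
  show "comm_monoid (\<O> :: 'n series ring)"
    by (rule comm_monoidI) (auto simp: carrier_O O_simps convergent_mps_mult convergent_mps_one mult_ac)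
qed (auto simp: carrier_O O_simps distrib_right)

interpretation O: cring "\<O> :: 'n::finite series ring"
  by (rule cring_O)

lemma O_pow: "cf f [^]\<^bsub>\<O>\<^esub> (n :: nat) = cf (f ^ n)"
  by (induction n) (auto simp: O_simps mult.commute)

lemma ideal_OI:
  fixes I :: "'n::finite mps set"
  assumes "I \<subseteq> convergent_mps" "0 \<in> I" "\<And>f g. f \<in> I \<Longrightarrow> g \<in> I \<Longrightarrow> f + g \<in> I"
    and mult: "\<And>f r. f \<in> I \<Longrightarrow> r \<in> convergent_mps \<Longrightarrow> r * f \<in> I"
  shows "ideal (cf ` I) \<O>"
proof (rule idealI)
  show "ring (\<O> :: 'n series ring)" by (rule O.ring_axioms)
  show "subgroup (cf ` I) (add_monoid (\<O> :: 'n series ring))"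
  proof (rule O.add.subgroupI)
    show "cf ` I \<subseteq> carrier \<O>" using assms(1) by (auto simp: carrier_O)
    show "cf ` I \<noteq> {}" using assms(2) by auto
  next
    fix a assume "a \<in> cf ` I"
    then obtain f where f: "a = cf f" "f \<in> I" by blast
    have "- f \<in> I" using mult[OF f(2), of "0 - 1"] convergent_mps_diff convergent_mps_zero convergent_mps_one by force
    moreover have "\<ominus>\<^bsub>\<O>\<^esub> a = cf (- f)"
    proof (rule O.minus_equality)
      show "cf (- f) \<oplus>\<^bsub>\<O>\<^esub> a = \<zero>\<^bsub>\<O>\<^esub>" by (simp add: f O_simps)
    qed (use f \<open>- f \<in> I\<close> assms(1) in \<open>auto simp: carrier_O\<close>)
    ultimately show "\<ominus>\<^bsub>\<O>\<^esub> a \<in> cf ` I" by simp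
  qed (use assms(3) in \<open>auto simp: O_simps\<close>)
qed (use mult in \<open>auto simp: carrier_O O_simps mult.commute\<close>)

lemma ideal_O_D:
  fixes I :: "'n::finite series set"
  assumes "ideal I \<O>"
  shows ideal_O_zero: "cf 0 \<in> I"
    and ideal_O_add: "cf f \<in> I \<Longrightarrow> cf g \<in> I \<Longrightarrow> cf (f + g) \<in> I"
    and ideal_O_mult: "r \<in> convergent_mps \<Longrightarrow> cf f \<in> I \<Longrightarrow> cf (r * f) \<in> I"
    and ideal_O_convergent: "cf f \<in> I \<Longrightarrow> f \<in> convergent_mps"
proof -
  interpret ideal I \<O> by fact
  show "cf 0 \<in> I" using zero_closed by (simp add: O_simps)
  show "cf (f + g) \<in> I" if "cf f \<in> I" "cf g \<in> I" using a_closed[OF that] by (simp add: O_simps)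
  show "cf (r * f) \<in> I" if "r \<in> convergent_mps" "cf f \<in> I"
    using I_l_closed[OF that(2), of "cf r"] that(1) by (auto simp: O_simps carrier_O)
  show "f \<in> convergent_mps" if "cf f \<in> I" using Icarr[OF that] by (simp add: carrier_O_iff)
qed

lemma ideal_O_sum: "ideal I \<O> \<Longrightarrow> (\<And>a. a \<in> A \<Longrightarrow> cf (f a) \<in> I) \<Longrightarrow> cf (sum f A) \<in> I"
  by (induction A rule: infinite_finite_induct) (auto simp: ideal_O_zero ideal_O_add)

text \<open>The convergent members of an ideal of formal series form an ideal of
  \<open>\<O>\<close>. In \<open>generated\<close> the coefficients are merely formal
  series.\<close>

lemma Idl_subset_generated:
  assumes D: "finite D" and y: "\<And>a. a \<in> D \<Longrightarrow> y a \<in> convergent_mps"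
    and f: "cf f \<in> Idl\<^bsub>\<O>\<^esub> ((\<lambda>a. cf (y a)) ` D)"
  shows "f \<in> generated D y"
proof -
  have "ideal (cf ` (generated D y \<inter> convergent_mps)) \<O>"
    by (rule ideal_OI)
      (auto intro: is_ideal_zero is_ideal_add is_ideal_mult is_ideal_generated
        convergent_mps_zero convergent_mps_add convergent_mps_mult)
  moreover have "(\<lambda>a. cf (y a)) ` D \<subseteq> cf ` (generated D y \<inter> convergent_mps)"
    using y generated_base[OF D] by blast
  ultimately have "Idl\<^bsub>\<O>\<^esub> ((\<lambda>a. cf (y a)) ` D) \<subseteq> cf ` (generated D y \<inter> convergent_mps)"
    by (rule O.genideal_minimal)
  with f obtain g where "cf f = cf g" "g \<in> generated D y" by blast
  then show ?thesis by (metis Ms_cf)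
qed

lemma boundary_monoid_O_subset: "cf t \<in> boundary_monoid \<O> (cf ` U) (map cf xs) \<Longrightarrow> t \<in> boundary_monoid_in convergent_mps U xs"
proof (induction xs arbitrary: t)
  case Nil
  then show ?case by (auto simp: cf_inject)
next
  case (Cons x xs)
  then obtain n s a where "cf t = cf x [^]\<^bsub>\<O>\<^esub> (n::nat) \<otimes>\<^bsub>\<O>\<^esub> (s \<oplus>\<^bsub>\<O>\<^esub> a \<otimes>\<^bsub>\<O>\<^esub> cf x)"
    "s \<in> boundary_monoid \<O> (cf ` U) (map cf xs)" "a \<in> carrier \<O>" by auto
  then have "cf t = cf (x ^ n * (Ms s + Ms a * x))" "Ms s \<in> boundary_monoid_in convergent_mps U xs" "Ms a \<in> convergent_mps"
    using O_simps(1)[of "Ms a" x] O_simps(2)[of "Ms s" "Ms a * x"] Cons.IH[of "Ms s"]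
    by (auto simp: O_pow O_simps(1) carrier_O_iff)
  then show ?case by (auto simp: cf_inject)
qed

text \<open>The equation of \<open>zero_in_boundary\<close> in the quotient ring is lifted to
  \<open>\<O>\<close>: an element of the boundary monoid lies in the ideal. The series with nonzero
  constant term take the place of the units.\<close>

lemma boundary_relation:
  fixes y :: "nat \<Rightarrow> 'n::finite mps"
  assumes D: "finite D" and y: "\<And>a. a \<in> D \<Longrightarrow> y a \<in> convergent_mps"
    and zs: "set zs \<subseteq> convergent_mps"
    and dim: "krull_dim (local_ring ((\<lambda>a. cf (y a)) ` D)) < ereal (real (length zs))"
  shows "\<exists>t. t \<in> boundary_monoid_in convergent_mps {f \<in> convergent_mps. cf f 0 \<noteq> 0} zs \<and> t \<in> generated D y"
proof -
  let ?G = "(\<lambda>a. cf (y a)) ` D" and ?U = "{f :: 'n mps. f \<in> convergent_mps \<and> cf f 0 \<noteq> 0}"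
  let ?I = "Idl\<^bsub>\<O>\<^esub> ?G" and ?h = "\<lambda>f. Idl\<^bsub>\<O>\<^esub> ?G +>\<^bsub>\<O>\<^esub> f"
  have G: "?G \<subseteq> carrier \<O>" using y by (auto simp: carrier_O)
  have I: "ideal ?I \<O>" by (rule O.genideal_ideal[OF G])
  interpret I: ideal ?I \<O> by (rule I)
  interpret A: cring "\<O> Quot ?I" by (rule I.quotient_is_cring[OF cring_O])
  have h: "?h \<in> ring_hom \<O> (\<O> Quot ?I)" by (rule I.rcos_ring_hom)
  have surj: "?h ` carrier \<O> = carrier (\<O> Quot ?I)"
    by (auto simp: FactRing_def A_RCOSETS_def')
  have U: "cf ` ?U \<subseteq> carrier \<O>" by (auto simp: carrier_O)
  have "cf (f * g) 0 = cf f 0 * cf g 0" for f g :: "'n mps"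
  proof -
    have "splits (0 :: nat ^ 'n) = {(0, 0)}" by (auto simp: splits_def vec_eq_iff)
    then show ?thesis by (simp add: cf_mult)
  qed
  then have Um: "f * g \<in> ?U" if "f \<in> ?U" "g \<in> ?U" for f g
    using that by (auto intro: convergent_mps_mult)
  have one: "1 \<in> ?U" by (simp add: cf_one convergent_mps_one)
  have zc: "set (map cf zs) \<subseteq> carrier \<O>" using zs by (auto simp: carrier_O)
  have zero: "\<zero>\<^bsub>\<O> Quot ?I\<^esub> \<in> boundary_monoid (\<O> Quot ?I) (?h ` cf ` ?U) (map ?h (map cf zs))"
  proof (rule A.zero_in_boundary)
    show "?h ` cf ` ?U \<subseteq> carrier (\<O> Quot ?I)" using U surj by blast
    have "\<one>\<^bsub>\<O> Quot ?I\<^esub> = ?h (cf 1)" using ring_hom_one[OF h] by (simp add: O_simps)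
    then show "\<one>\<^bsub>\<O> Quot ?I\<^esub> \<in> ?h ` cf ` ?U" using one by blast
    show "s \<otimes>\<^bsub>\<O> Quot ?I\<^esub> t \<in> ?h ` cf ` ?U" if st: "s \<in> ?h ` cf ` ?U" "t \<in> ?h ` cf ` ?U" for s t
    proof -
      obtain f where f: "s = ?h (cf f)" "f \<in> ?U" using st(1) by (elim imageE) simp
      obtain g where g: "t = ?h (cf g)" "g \<in> ?U" using st(2) by (elim imageE) simp
      note fg = f(1) g(1) f(2) g(2)
      have "?h (cf (f * g)) = s \<otimes>\<^bsub>\<O> Quot ?I\<^esub> t"
        using ring_hom_mult[OF h, of "cf f" "cf g"] fg by (auto simp: O_simps carrier_O)
      then show ?thesis using Um[OF fg(3,4)] by blast
    qed
    show "set (map ?h (map cf zs)) \<subseteq> carrier (\<O> Quot ?I)"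
      unfolding set_map[of ?h] surj[symmetric] by (rule image_mono[OF zc])
    show "krull_dim (\<O> Quot ?I) < ereal (real (length (map ?h (map cf zs))))"
      using dim by (simp add: local_ring_def)
  qed
  obtain t where t: "t \<in> boundary_monoid \<O> (cf ` ?U) (map cf zs)" "t \<in> carrier \<O>" "?h t = \<zero>\<^bsub>\<O> Quot ?I\<^esub>"
    using boundary_monoid_hom_lift[OF O.ring_axioms A.ring_axioms h surj U zc zero] by (elim bexE conjE)
  have "t \<in> ?I" using t(2,3) by (intro I.rcos_const_imp_mem) (auto simp: FactRing_def)
  then have "Ms t \<in> generated D y" by (intro Idl_subset_generated[OF D y]) auto
  moreover have "Ms t \<in> boundary_monoid_in convergent_mps ?U zs" using t(1) by (intro boundary_monoid_O_subset) simp
  ultimately show ?thesis by blast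
qed

text \<open>For \<open>e = CARD('n)\<close> take the variables. As long as there are more than
  \<open>d\<close> elements, \<open>kronecker_step\<close> absorbs the last one into the others. The
  clause on all radical ideals \<open>J\<close> says that the variables lie in the radical of the
  enlarged ideal, in the form in which the step preserves it.\<close>

lemma system_of_parameters:
  fixes y :: "nat \<Rightarrow> 'n::finite mps"
  assumes D: "finite D" and y: "\<And>a. a \<in> D \<Longrightarrow> y a \<in> convergent_mps"
    and dim: "krull_dim (local_ring ((\<lambda>a. cf (y a)) ` D)) \<le> ereal (real d)"
    and "d \<le> e" "e \<le> CARD('n)"
  shows "\<exists>xs. length xs = e \<and> set xs \<subseteq> convergent_mps \<and> (\<forall>x\<in>set xs. ord_ge 1 x) \<and>
    (\<forall>J. is_radical_ideal J \<longrightarrow> generated D y \<subseteq> J \<longrightarrow> set xs \<subseteq> J \<longrightarrow> (\<forall>j. zmon (axis j 1) \<in> J))"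
  using assms(5,4)
proof (induction rule: inc_induct)
  case base
  obtain js :: "'n list" where js: "set js = UNIV" "distinct js"
    using finite_distinct_list[of "UNIV :: 'n set"] by auto
  let ?xs = "map (\<lambda>j. zmon (axis j 1)) js"
  have "length ?xs = CARD('n)" using distinct_card[OF js(2)] js(1) by simp
  moreover have "set ?xs = range (\<lambda>j. zmon (axis j 1))" using js(1) by simp
  moreover have "ord_ge 1 (zmon (axis j 1) :: 'n mps)" for j
  proof -
    have "(0 :: nat ^ 'n) \<noteq> axis j 1" by (metis axis_eq_0_iff zero_neq_one)
    then show ?thesis by (simp only: ord_ge_1_iff cf_zmon) simp
  qed
  ultimately show ?case
    by (intro exI[of _ ?xs]) (auto intro: zmon_convergent)
next
  case (step e)
  then obtain zs :: "'n mps list" where zs: "length zs = Suc e" "set zs \<subseteq> convergent_mps"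
    "\<And>x. x \<in> set zs \<Longrightarrow> ord_ge 1 x"
    and J: "\<And>J j. is_radical_ideal J \<Longrightarrow> generated D y \<subseteq> J \<Longrightarrow> set zs \<subseteq> J \<Longrightarrow> zmon (axis j 1) \<in> J"
    by (auto 0 0)
  have "zs \<noteq> []" using zs(1) by auto
  then obtain xs a where xa: "zs = xs @ [a]" by (metis rev_exhaust)
  then have a: "a \<in> convergent_mps" "ord_ge 1 a" and xs: "set xs \<subseteq> convergent_mps"
    "\<And>x. x \<in> set xs \<Longrightarrow> ord_ge 1 x" "length xs = e"
    using zs by auto
  let ?U = "{f :: 'n mps. f \<in> convergent_mps \<and> cf f 0 \<noteq> 0}"
  have "ereal (real d) < ereal (real (length zs))" using step zs(1) by simp
  with dim have lt: "krull_dim (local_ring ((\<lambda>a. cf (y a)) ` D)) < ereal (real (length zs))"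
    by (rule le_less_trans)
  have "\<exists>t. t \<in> boundary_monoid_in convergent_mps ?U zs \<and> t \<in> generated D y"
    by (rule boundary_relation[OF D _ zs(2) lt]) (rule y)
  then obtain t where t: "t \<in> boundary_monoid_in convergent_mps ?U zs" "t \<in> generated D y" by (elim exE conjE)
  have U: "?U \<subseteq> convergent_mps" by blast
  have unit: "\<exists>v. v * (s + \<alpha> * a) = 1" if "s \<in> ?U" for s \<alpha>
  proof (rule mps_unit)
    have "cf (\<alpha> * a) 0 = 0" using ord_ge_mult_left[OF a(2)] ord_ge_1_iff by blast
    then show "cf (s + \<alpha> * a) 0 \<noteq> 0" using that by simp
  qed
  obtain ys where ys: "list_all2 (\<lambda>x y. \<exists>c\<in>convergent_mps. y = x + a * c) xs ys"
    and aJ: "\<And>J. is_radical_ideal J \<Longrightarrow> set ys \<subseteq> J \<Longrightarrow> t \<in> J \<Longrightarrow> a \<in> J"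
    using kronecker_step[OF convergent_mps_subring U unit a(1) xs(1) t(1)[unfolded xa]] by blast
  have yform: "\<exists>x\<in>set xs. \<exists>c\<in>convergent_mps. y' = x + a * c" if y': "y' \<in> set ys" for y'
  proof -
    obtain i where i: "i < length ys" "ys ! i = y'" using y' by (auto simp: in_set_conv_nth)
    then have "xs ! i \<in> set xs" using list_all2_lengthD[OF ys] by simp
    with list_all2_nthD2[OF ys i(1)] i(2) show ?thesis by blast
  qed
  have xform: "\<exists>y'\<in>set ys. \<exists>c\<in>convergent_mps. y' = x + a * c" if x: "x \<in> set xs" for x
  proof -
    obtain i where i: "i < length xs" "xs ! i = x" using x by (auto simp: in_set_conv_nth)
    then have "ys ! i \<in> set ys" using list_all2_lengthD[OF ys] by simp
    with list_all2_nthD[OF ys i(1)] i(2) show ?thesis by blast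
  qed
  show ?case
  proof (intro exI[of _ ys] conjI allI impI ballI subsetI)
    show "length ys = e" using ys xs(3) by (simp add: list_all2_lengthD)
  next
    fix y' assume "y' \<in> set ys"
    from yform[OF this] obtain x c where xc: "x \<in> set xs" "c \<in> convergent_mps" "y' = x + a * c"
      by (elim bexE)
    then show "y' \<in> convergent_mps"
      using a(1) subsetD[OF xs(1)] by (simp add: convergent_mps_add convergent_mps_mult)
    have "ord_ge 1 (c * a)" using a(2) by (rule ord_ge_mult_left)
    then show "ord_ge 1 y'" unfolding xc(3) mult.commute[of a c] using xs(2)[OF xc(1)] by (intro ord_ge_add)
  next
    fix J j assume rJ: "is_radical_ideal J" and gJ: "generated D y \<subseteq> J" and ysJ: "set ys \<subseteq> J"
    have iJ: "is_ideal J" using rJ by (simp add: is_radical_ideal_def)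
    have "a \<in> J" using aJ[OF rJ ysJ] t(2) gJ by blast
    moreover have "x \<in> J" if x: "x \<in> set xs" for x
    proof -
      obtain y' c where "y' \<in> set ys" "y' = x + a * c" using xform[OF x] by (elim bexE)
      then have "x = y' - c * a" "y' \<in> J" using ysJ by (auto simp: mult.commute)
      then show ?thesis using is_ideal_diff[OF iJ] is_ideal_mult[OF iJ \<open>a \<in> J\<close>] by metis
    qed
    ultimately have "set zs \<subseteq> J" using xa by auto
    then show "zmon (axis j 1) \<in> J" by (rule J[OF rJ gJ])
  qed
qed

text \<open>The last index is dropped repeatedly. This discards the parameters added for depth, and
  later carries acyclicity from \<open>g 1, \<dots>, g k\<close> to
  \<open>g 1, \<dots>, g j\<close>.\<close>

lemma koszul_acyclic_initial_segment:
  fixes y :: "nat \<Rightarrow> 'n::finite mps"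
  assumes "j \<le> k" and "\<And>a. a \<in> {1..k} \<Longrightarrow> ord_ge 1 (y a)" "koszul_acyclic {1..k} y {0} i"
  shows "koszul_acyclic {1..j} y {0} i"
  using assms(1)
proof (induction rule: inc_induct)
  case base
  show ?case by fact
next
  case (step m)
  have "insert (Suc m) {1..m} = {1..Suc m}" by auto
  then have "koszul_acyclic (insert (Suc m) {1..m}) y {0} i" using step.IH by simp
  then show ?case
    by (rule koszul_acyclic_remove_last[rotated 3]) (use step.hyps assms(2) in auto)
qed

theorem koszul_acyclic_of_krull_dim:
  fixes y :: "nat \<Rightarrow> 'n::finite mps"
  assumes y: "\<And>a. a \<in> {1..k} \<Longrightarrow> y a \<in> convergent_mps"
    and y0: "\<And>a. a \<in> {1..k} \<Longrightarrow> ord_ge 1 (y a)"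
    and dim: "krull_dim (local_ring ((\<lambda>a. cf (y a)) ` {1..k}))
      \<le> ereal (real CARD('n) - (real k - real s + 1))"
    and "s \<le> i"
  shows "koszul_acyclic {1..k} y {0} i"
proof -
  let ?G = "(\<lambda>a. cf (y a)) ` {1..k}"
  \<comment> \<open>The series vanish at the origin, so their ideal contains no unit;
    \<open>boundary_relation\<close> for the empty list turns this into a nonnegative dimension.
    Hence the natural number subtraction in \<open>d\<close> below is exact.\<close>
  have "\<not> krull_dim (local_ring ?G) < ereal (real (length ([] :: 'n mps list)))"
  proof
    assume "krull_dim (local_ring ?G) < ereal (real (length ([] :: 'n mps list)))"
    from boundary_relation[OF _ y _ this]
    obtain t where t: "t \<in> boundary_monoid_in convergent_mps {f \<in> convergent_mps. cf f 0 \<noteq> 0} []" "t \<in> generated {1..k} y"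
      by auto
    have "ord_ge 1 t" using t(2) y0 unfolding generated_def by (auto intro!: ord_ge_sum ord_ge_mult_left)
    with t(1) show False unfolding ord_ge_1_iff by simp
  qed
  with dim have "0 \<le> real CARD('n) - (real k - real s + 1)"
    by (metis (no_types, lifting) ereal_less_eq(3) linorder_not_le list.size(3) of_nat_0 order_trans)
  then have le: "k + 1 \<le> CARD('n) + s" by linarith
  define d where "d = CARD('n) + s - (k + 1)"
  have "real d = real CARD('n) - (real k - real s + 1)" using le by (simp add: d_def of_nat_diff)
  with dim have dim': "krull_dim (local_ring ?G) \<le> ereal (real d)" by simp
  \<comment> \<open>If \<open>d > CARD('n)\<close>, then \<open>i\<close> exceeds \<open>k\<close>
    and there are no chains. Otherwise \<open>k + d = CARD('n) + s - 1\<close>, just within the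
    bound of \<open>koszul_acyclic_depth\<close>.\<close>
  define e where "e = min d CARD('n)"
  have card: "k + e < i + CARD('n)" using le \<open>s \<le> i\<close> by (auto simp: e_def d_def)
  show ?thesis
  proof (cases "d \<le> CARD('n)")
    case False
    then have "k < i" using card by (simp add: e_def)
    then show ?thesis by (intro koszul_acyclic_above) (auto simp: is_ideal_def)
  next
    case True
    have fin: "finite {1..k}" by simp
    have "\<exists>xs. length xs = d \<and> set xs \<subseteq> convergent_mps \<and> (\<forall>x\<in>set xs. ord_ge 1 x) \<and>
        (\<forall>J. is_radical_ideal J \<longrightarrow> generated {1..k} y \<subseteq> J \<longrightarrow> set xs \<subseteq> J \<longrightarrow> (\<forall>j. zmon (axis j 1) \<in> J))"
      by (rule system_of_parameters[OF fin _ dim' order.refl True]) (rule y)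
    then obtain xs where xs: "length xs = d" "\<forall>x\<in>set xs. ord_ge 1 x"
      and J: "\<forall>J. is_radical_ideal J \<longrightarrow> generated {1..k} y \<subseteq> J \<longrightarrow> set xs \<subseteq> J \<longrightarrow>
        (\<forall>j. zmon (axis j 1) \<in> J)"
      by (elim exE conjE)
    \<comment> \<open>The parameters get the indices \<open>k + 1, \<dots>, k + d\<close>, behind
      the given series, so that they can be removed from the end.\<close>
    define Y where "Y a = (if a \<le> k then y a else xs ! (a - (k + 1)))" for a
    have Y0: "ord_ge 1 (Y a)" if "a \<in> {1..k + d}" for a
    proof (cases "a \<le> k")
      case False
      then have "a - (k + 1) < length xs" using that xs(1) by auto
      then have "xs ! (a - (k + 1)) \<in> set xs" by (rule nth_mem)
      then show ?thesis using False xs(2) by (simp add: Y_def)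
    qed (use y0 that in \<open>auto simp: Y_def\<close>)
    let ?rad = "{f. \<exists>N. f ^ N \<in> generated {1..k + d} Y}"
    have sub: "generated {1..k + d} Y \<subseteq> ?rad"
    proof
      fix f assume "f \<in> generated {1..k + d} Y"
      then show "f \<in> ?rad" by (intro CollectI exI[of _ 1]) simp
    qed
    have base: "Y a \<in> generated {1..k + d} Y" if "a \<in> {1..k + d}" for a
      using that by (intro generated_base) auto
    have "zmon (axis j 1) \<in> ?rad" for j
    proof (rule J[rule_format])
      show "is_radical_ideal ?rad" by (rule is_radical_ideal_radical[OF is_ideal_generated])
      have "generated {1..k} y \<subseteq> generated {1..k + d} Y"
      proof
        fix f assume "f \<in> generated {1..k} y"
        then obtain \<alpha> where f: "f = (\<Sum>a\<in>{1..k}. \<alpha> a * y a)" unfolding generated_def by blast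
        have "y a \<in> generated {1..k + d} Y" if "a \<in> {1..k}" for a
          using base[of a] that by (simp add: Y_def)
        then show "f \<in> generated {1..k + d} Y"
          unfolding f by (intro is_ideal_sum[OF is_ideal_generated] is_ideal_mult[OF is_ideal_generated])
      qed
      with sub show "generated {1..k} y \<subseteq> ?rad" by blast
      show "set xs \<subseteq> ?rad"
      proof
        fix x assume "x \<in> set xs"
        then obtain b where b: "b < length xs" "xs ! b = x" by (metis in_set_conv_nth)
        then have "Y (b + (k + 1)) = x" "b + (k + 1) \<in> {1..k + d}" using xs(1) by (auto simp: Y_def)
        then show "x \<in> ?rad" using base sub by blast
      qed
    qed
    then obtain N where N: "\<And>j. zmon (axis j 1) ^ N j \<in> generated {1..k + d} Y"
      by simp metis
    have "zmon (axis j 1) ^ Max (range N) \<in> generated {1..k + d} Y" for j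
    proof -
      have "N j \<le> Max (range N)" by simp
      then have "zmon (axis j 1) ^ Max (range N) =
          zmon (axis j 1) ^ (Max (range N) - N j) * zmon (axis j 1) ^ N j"
        by (metis le_add_diff_inverse2 power_add)
      then show ?thesis using is_ideal_mult[OF is_ideal_generated N] by metis
    qed
    then have "koszul_acyclic {1..k + d} Y {0} i"
      by (rule koszul_acyclic_depth[rotated]) (use card True in \<open>auto simp: e_def\<close>)
    then have "koszul_acyclic {1..k} Y {0} i"
      by (rule koszul_acyclic_initial_segment[rotated 2]) (use Y0 in auto)
    moreover have "koszul_d {1..k} Y c A = koszul_d {1..k} y c A" for c A
      unfolding koszul_d_def by (intro sum.cong) (auto simp: Y_def)
    ultimately show ?thesis by (simp add: koszul_acyclic_def)
  qed
qed

section \<open>Newton filtrations of Koszul complexes\<close>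

lemma weight_add: "weight p (a + b) = weight p a + weight p b"
  by (simp add: weight_def sum.distrib algebra_simps)

section \<open>Restriction to sets of monomials\<close>

definition restr :: "(nat ^ 'n \<Rightarrow> bool) \<Rightarrow> 'n::finite mps \<Rightarrow> 'n mps" where
  "restr P f = Ms (\<lambda>q. if P q then cf f q else 0)"

lemma cf_restr [simp]: "cf (restr P f) q = (if P q then cf f q else 0)"
  by (simp add: restr_def)

lemma restr_zero [simp]: "restr P 0 = 0"
  and restr_diff: "restr P (f - g) = restr P f - restr P g"
  and restr_sum: "restr P (sum h S) = (\<Sum>x\<in>S. restr P (h x))"
  by (rule mps_eqI; simp)+

lemma restr_id: "(\<And>q. cf f q \<noteq> 0 \<Longrightarrow> P q) \<Longrightarrow> restr P f = f"
  by (rule mps_eqI) auto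

lemma restr_eq_0: "(\<And>q. cf f q \<noteq> 0 \<Longrightarrow> \<not> P q) \<Longrightarrow> restr P f = 0"
  by (rule mps_eqI) auto

text \<open>The condition on \<open>x + y\<close> has to split only on the two supports. It does for
  minimal weights, where lower bounds add up, and for fixed weights, where one factor is
  homogeneous.\<close>

lemma restr_mult:
  assumes "\<And>x y. cf f x \<noteq> 0 \<Longrightarrow> cf h y \<noteq> 0 \<Longrightarrow> P (x + y) \<longleftrightarrow> F x \<and> H y"
  shows "restr P (f * h) = restr F f * restr H h"
proof (rule mps_eqI)
  fix q
  have "(if P q then cf f (fst x) * cf h (snd x) else 0) =
      cf (restr F f) (fst x) * cf (restr H h) (snd x)" if "x \<in> splits q" for x
  proof (cases "cf f (fst x) \<noteq> 0 \<and> cf h (snd x) \<noteq> 0")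
    case True
    moreover have "fst x + snd x = q" using that by (auto simp: splits_def)
    ultimately have "P q \<longleftrightarrow> F (fst x) \<and> H (snd x)" using assms by blast
    then show ?thesis by simp
  qed auto
  then have "(\<Sum>x\<in>splits q. if P q then cf f (fst x) * cf h (snd x) else 0) =
      (\<Sum>x\<in>splits q. cf (restr F f) (fst x) * cf (restr H h) (snd x))"
    by (intro sum.cong) auto
  then show "cf (restr P (f * h)) q = cf (restr F f * restr H h) q"
    by (cases "P q") (simp_all add: cf_mult case_prod_unfold)
qed

lemma koszul_sign_cases: "koszul_sign a A = 1 \<or> koszul_sign a A = - 1"
  unfolding koszul_sign_def by (metis neg_one_even_power neg_one_odd_power)

lemma restr_koszul_sign: "restr P (koszul_sign a A * f) = koszul_sign a A * restr P f" for f :: "'n::finite mps"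
  using koszul_sign_cases[of a A, where 'a = "'n mps"]
proof
  assume "koszul_sign a A = (1 :: 'n mps)"
  then show ?thesis by simp
next
  assume "koszul_sign a A = (- 1 :: 'n mps)"
  then show ?thesis by (intro mps_eqI) simp
qed

text \<open>\<open>\<nu> a\<close> enters as a lower bound for the weights in \<open>g a\<close>,
  and \<open>D\<close> is kept variable so that the results apply to the first \<open>j\<close>
  series as well.\<close>

locale newton_system =
  fixes p :: "'r::finite \<Rightarrow> nat ^ 'n::finite"
    and g :: "nat \<Rightarrow> 'n mps" and \<nu> :: "nat \<Rightarrow> int ^ 'r" and D :: "nat set"
  assumes fin: "finite D"
    and nu_le: "a \<in> D \<Longrightarrow> cf (g a) q \<noteq> 0 \<Longrightarrow> \<nu> a $ l \<le> weight (p l) q"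
    and nu_nonneg: "a \<in> D \<Longrightarrow> 0 \<le> \<nu> a $ l"
begin

definition wv :: "nat ^ 'n \<Rightarrow> int ^ 'r" where
  "wv q = (\<chi> l. weight (p l) q)"

lemma wv_add: "wv (a + b) = wv a + wv b"
  by (simp add: wv_def vec_eq_iff weight_add)

lemma wv_nonneg: "0 \<le> wv q $ l"
  by (simp add: wv_def weight_def sum_nonneg)

definition inp :: "'r set \<Rightarrow> nat \<Rightarrow> 'n mps" where
  "inp J a = restr (\<lambda>q. \<forall>l\<in>J. wv q $ l = \<nu> a $ l) (g a)"

lemma inp_empty: "inp {} = g"
  by (simp add: inp_def restr_id fun_eq_iff)

text \<open>For \<open>J = {}\<close> this is the level \<open>\<mu>\<close> of the filtration, in
  formal series; each \<open>l \<in> J\<close> restricts the support to the face of minimal weight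
  in direction \<open>l\<close>.\<close>

definition lev :: "'r set \<Rightarrow> int ^ 'r \<Rightarrow> 'n mps \<Rightarrow> bool" where
  "lev J \<mu> f \<longleftrightarrow> (\<forall>q. cf f q \<noteq> 0 \<longrightarrow> (\<forall>l. \<mu> $ l \<le> wv q $ l) \<and> (\<forall>l\<in>J. wv q $ l = \<mu> $ l))"

lemma lev_zero [simp]: "lev J \<mu> 0"
  by (simp add: lev_def)

lemma lev_add: "lev J \<mu> f \<Longrightarrow> lev J \<mu> h \<Longrightarrow> lev J \<mu> (f + h)"
  unfolding lev_def by (metis add_0 cf_add)

lemma lev_diff: "lev J \<mu> f \<Longrightarrow> lev J \<mu> h \<Longrightarrow> lev J \<mu> (f - h)"
  unfolding lev_def by (metis cf_diff diff_0_right)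

lemma lev_sum: "(\<And>x. x \<in> S \<Longrightarrow> lev J \<mu> (h x)) \<Longrightarrow> lev J \<mu> (sum h S)"
  by (induction S rule: infinite_finite_induct) (auto intro: lev_add)

lemma lev_koszul_sign: "lev J \<mu> f \<Longrightarrow> lev J \<mu> (koszul_sign a A * f)"
  using koszul_sign_cases[of a A, where 'a = "'n mps"]
proof
  assume "koszul_sign a A = (- 1 :: 'n mps)" and "lev J \<mu> f"
  then show ?thesis using lev_diff[OF lev_zero, of J \<mu> f] by simp
qed simp

lemma lev_mult:
  assumes "lev J \<mu> f" "lev J \<mu>' h" shows "lev J (\<mu> + \<mu>') (f * h)"
  unfolding lev_def
proof (intro allI impI)
  fix q assume "cf (f * h) q \<noteq> 0"
  then obtain a b where ab: "a + b = q" "cf f a \<noteq> 0" "cf h b \<noteq> 0" by (rule cf_mult_nonzeroE)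
  then have q: "wv q $ l = wv a $ l + wv b $ l" for l by (auto simp: wv_add)
  have "\<mu> $ l \<le> wv a $ l" "\<mu>' $ l \<le> wv b $ l" "l \<in> J \<Longrightarrow> wv a $ l = \<mu> $ l"
    "l \<in> J \<Longrightarrow> wv b $ l = \<mu>' $ l" for l
    using assms ab unfolding lev_def by blast+
  then show "(\<forall>l. (\<mu> + \<mu>') $ l \<le> wv q $ l) \<and> (\<forall>l\<in>J. wv q $ l = (\<mu> + \<mu>') $ l)"
    by (simp add: q add_mono)
qed

lemma lev_mono:
  assumes "lev J \<mu>' f" "\<And>l. \<mu> $ l \<le> \<mu>' $ l" "\<And>l. l \<in> J \<Longrightarrow> \<mu> $ l = \<mu>' $ l"
  shows "lev J \<mu> f"
  unfolding lev_def
proof (intro allI impI)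
  fix q assume "cf f q \<noteq> 0"
  then have "\<mu>' $ l \<le> wv q $ l" "l \<in> J \<Longrightarrow> wv q $ l = \<mu>' $ l" for l
    using assms(1) by (auto simp: lev_def)
  then show "(\<forall>l. \<mu> $ l \<le> wv q $ l) \<and> (\<forall>l\<in>J. wv q $ l = \<mu> $ l)"
    using order_trans[OF assms(2)] by (simp add: assms(3))
qed

lemma lev_subset: "lev J \<mu> f \<Longrightarrow> J' \<subseteq> J \<Longrightarrow> lev J' \<mu> f"
  unfolding lev_def by blast

lemma lev_inp: "a \<in> D \<Longrightarrow> lev J (\<nu> a) (inp J a)"
  using nu_le[of a] by (auto simp: lev_def inp_def wv_def split: if_splits)

abbreviation nus :: "nat set \<Rightarrow> int ^ 'r" where
  "nus A \<equiv> \<Sum>a\<in>A. \<nu> a"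

text \<open>The part of degree \<open>i\<close> and level \<open>\<mu>\<close> of the Koszul complex of the initial forms: the
  subspace on which equality holds in the directions \<open>J\<close>.\<close>

definition filtered_chain :: "'r set \<Rightarrow> nat \<Rightarrow> int ^ 'r \<Rightarrow> (nat set \<Rightarrow> 'n mps) \<Rightarrow> bool" where
  "filtered_chain J i \<mu> c \<longleftrightarrow> chain D i c \<and> (\<forall>A. lev J (\<mu> - nus A) (c A))"

abbreviation dd :: "'r set \<Rightarrow> (nat set \<Rightarrow> 'n mps) \<Rightarrow> nat set \<Rightarrow> 'n mps" where
  "dd J \<equiv> koszul_d D (inp J)"

lemma filtered_chain_zero: "filtered_chain J i \<mu> (\<lambda>A. 0)"
  by (simp add: filtered_chain_def chain_zero)

lemma filtered_chain_add: "filtered_chain J i \<mu> c \<Longrightarrow> filtered_chain J i \<mu> c' \<Longrightarrow> filtered_chain J i \<mu> (\<lambda>A. c A + c' A)"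
  by (simp add: filtered_chain_def chain_add lev_add)

lemma filtered_chain_diff: "filtered_chain J i \<mu> c \<Longrightarrow> filtered_chain J i \<mu> c' \<Longrightarrow> filtered_chain J i \<mu> (\<lambda>A. c A - c' A)"
  by (simp add: filtered_chain_def chain_diff lev_diff)

lemma filtered_chain_mono:
  assumes "filtered_chain J i \<mu>' c" "\<And>l. \<mu> $ l \<le> \<mu>' $ l" "\<And>l. l \<in> J \<Longrightarrow> \<mu> $ l = \<mu>' $ l"
  shows "filtered_chain J i \<mu> c"
  using assms(1) unfolding filtered_chain_def
  by (auto intro: lev_mono[of J "\<mu>' - nus A" for A] simp: assms(2,3))

lemma filtered_chain_subset: "filtered_chain J i \<mu> c \<Longrightarrow> J' \<subseteq> J \<Longrightarrow> filtered_chain J' i \<mu> c"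
  unfolding filtered_chain_def using lev_subset by blast

lemma insert_chain_cases:
  assumes "chain D i c" "a \<in> D - A"
  obtains "c (insert a A) = 0" | "A \<subseteq> D" "nus (insert a A) = \<nu> a + nus A"
proof (cases "A \<subseteq> D")
  case True
  then have "finite A" using fin finite_subset by blast
  with True assms(2) show ?thesis by (intro that(2)) auto
next
  case False
  then show ?thesis by (intro that(1) chain_eq_0[OF assms(1)]) auto
qed

lemma filtered_chain_koszul_d:
  assumes "filtered_chain J (Suc i) \<mu> c" shows "filtered_chain J i \<mu> (dd J c)"
  unfolding filtered_chain_def
proof (intro conjI allI)
  have c: "chain D (Suc i) c" using assms by (simp add: filtered_chain_def)
  then show "chain D i (dd J c)" by (rule chain_koszul_d[OF fin])
  fix A
  have "lev J (\<mu> - nus A) (koszul_sign a A * inp J a * c (insert a A))" if a: "a \<in> D - A" for a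
    using c a
  proof (cases rule: insert_chain_cases)
    case 1
    then show ?thesis by simp
  next
    case 2
    have "lev J (\<nu> a + (\<mu> - nus (insert a A))) (inp J a * c (insert a A))"
      using assms a by (intro lev_mult lev_inp) (auto simp: filtered_chain_def)
    then have "lev J (\<mu> - nus A) (inp J a * c (insert a A))" by (simp add: 2(2))
    from lev_koszul_sign[OF this] show ?thesis by (simp add: mult.assoc)
  qed
  then show "lev J (\<mu> - nus A) (dd J c A)" unfolding koszul_d_def by (rule lev_sum)
qed

lemma restr_koszul_d:
  assumes c: "chain D i c"
    and P: "\<And>A a x y. a \<in> D - A \<Longrightarrow> nus (insert a A) = \<nu> a + nus A \<Longrightarrow>
      cf (f a) x \<noteq> 0 \<Longrightarrow> cf (c (insert a A)) y \<noteq> 0 \<Longrightarrow> P A (x + y) \<longleftrightarrow> F a x \<and> P (insert a A) y"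
  shows "restr (P A) (koszul_d D f c A) = koszul_d D (\<lambda>a. restr (F a) (f a)) (\<lambda>A. restr (P A) (c A)) A"
proof -
  have "restr (P A) (koszul_sign a A * f a * c (insert a A)) =
      koszul_sign a A * restr (F a) (f a) * restr (P (insert a A)) (c (insert a A))" if a: "a \<in> D - A" for a
    using c a
  proof (cases rule: insert_chain_cases)
    case 1
    then show ?thesis by simp
  next
    case 2
    have "restr (P A) (f a * c (insert a A)) =
        restr (F a) (f a) * restr (P (insert a A)) (c (insert a A))"
      by (rule restr_mult) (rule P[OF a 2(2)])
    then show ?thesis by (simp add: mult.assoc restr_koszul_sign)
  qed
  then show ?thesis unfolding koszul_d_def restr_sum by (intro sum.cong) auto
qed

definition face :: "'r \<Rightarrow> int ^ 'r \<Rightarrow> nat set \<Rightarrow> nat ^ 'n \<Rightarrow> bool" where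
  "face m \<mu> A q \<longleftrightarrow> wv q $ m = (\<mu> - nus A) $ m"

text \<open>Weights add and each factor has weight at least its bound, so a product attains the
  minimum in direction \<open>m\<close> only if both factors do. Taking faces is therefore a chain
  map from the complex of \<open>J\<close> to that of \<open>insert m J\<close>.\<close>

lemma restr_face_koszul_d:
  assumes "filtered_chain J i \<mu> c"
  shows "restr (face m \<mu> A) (dd J c A) = dd (insert m J) (\<lambda>A. restr (face m \<mu> A) (c A)) A"
proof -
  have c: "chain D i c" using assms by (simp add: filtered_chain_def)
  have "inp (insert m J) a = restr (\<lambda>q. wv q $ m = \<nu> a $ m) (inp J a)" for a
    by (rule mps_eqI) (auto simp: inp_def)
  then have inp: "inp (insert m J) = (\<lambda>a. restr (\<lambda>q. wv q $ m = \<nu> a $ m) (inp J a))" by blast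
  show ?thesis
    unfolding inp
  proof (rule restr_koszul_d[OF c])
    fix A a x y
    assume *: "a \<in> D - A" "nus (insert a A) = \<nu> a + nus A" "cf (inp J a) x \<noteq> 0"
      "cf (c (insert a A)) y \<noteq> 0"
    have "\<nu> a $ m \<le> wv x $ m"
      using lev_inp[of a J] * by (auto simp: lev_def)
    moreover have "lev J (\<mu> - nus (insert a A)) (c (insert a A))" using assms by (auto simp: filtered_chain_def)
    then have "(\<mu> - nus (insert a A)) $ m \<le> wv y $ m" using *(4) unfolding lev_def by blast
    ultimately show "face m \<mu> A (x + y) \<longleftrightarrow> wv x $ m = \<nu> a $ m \<and> face m \<mu> (insert a A) y"
      unfolding face_def by (auto simp: wv_add *(2))
  qed
qed

lemma filtered_chain_face:
  assumes "filtered_chain J i \<mu> c" shows "filtered_chain (insert m J) i \<mu> (\<lambda>A. restr (face m \<mu> A) (c A))"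
  unfolding filtered_chain_def
proof (intro conjI allI)
  show "chain D i (\<lambda>A. restr (face m \<mu> A) (c A))"
    using assms unfolding filtered_chain_def chain_def by (metis restr_zero)
  show "lev (insert m J) (\<mu> - nus A) (restr (face m \<mu> A) (c A))" for A
    using assms unfolding filtered_chain_def lev_def face_def by auto
qed

text \<open>Exactness respecting the filtration: the bounding chain has the same level
  \<open>\<mu>\<close> as the cycle.\<close>

definition exact_at :: "'r set \<Rightarrow> nat \<Rightarrow> bool" where
  "exact_at J i \<longleftrightarrow> (\<forall>\<mu> c. filtered_chain J i \<mu> c \<and> (\<forall>A. dd J c A = 0) \<longrightarrow>
     (\<exists>b. filtered_chain J (Suc i) \<mu> b \<and> (\<forall>A. dd J b A = c A)))"

text \<open>A chain whose boundary lies in a higher level can be moved to that level by a boundary: the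
  obstruction in each direction \<open>m\<close> is a cycle for \<open>insert m J\<close>.\<close>

lemma raise_level:
  assumes K: "\<And>m. m \<notin> J \<Longrightarrow> exact_at (insert m J) i"
    and "filtered_chain J i \<mu> c" "\<And>A. lev J (\<kappa> - nus A) (dd J c A)"
    and "\<And>l. \<mu> $ l \<le> \<kappa> $ l" "\<And>l. l \<in> J \<Longrightarrow> \<mu> $ l = \<kappa> $ l"
  shows "\<exists>b. filtered_chain J (Suc i) \<mu> b \<and> filtered_chain J i \<kappa> (\<lambda>A. c A - dd J b A)"
  using assms(2-)
proof (induction "\<Sum>l\<in>UNIV. nat (\<kappa> $ l - \<mu> $ l)" arbitrary: \<mu> c rule: less_induct)
  case less
  show ?case
  proof (cases "\<mu> = \<kappa>")
    case True
    have "dd J (\<lambda>A. 0) A = 0" for A by (simp add: koszul_d_def)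
    then show ?thesis using less.prems(1) True filtered_chain_zero by (intro exI[of _ "\<lambda>A. 0"]) simp
  next
    case False
    then obtain m where "\<mu> $ m \<noteq> \<kappa> $ m" by (auto simp: vec_eq_iff)
    then have m: "\<mu> $ m < \<kappa> $ m" "m \<notin> J" using less.prems(3,4) by (auto simp: order_less_le)
    let ?c' = "\<lambda>A. restr (face m \<mu> A) (c A)"
    have "filtered_chain (insert m J) i \<mu> ?c'" by (rule filtered_chain_face[OF less.prems(1)])
    moreover have "dd (insert m J) ?c' A = 0" for A
    proof -
      have "restr (face m \<mu> A) (dd J c A) = 0"
      proof (rule restr_eq_0)
        fix q assume "cf (dd J c A) q \<noteq> 0"
        then have "(\<kappa> - nus A) $ m \<le> wv q $ m" using less.prems(2)[of A] unfolding lev_def by blast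
        then show "\<not> face m \<mu> A q" using m by (simp add: face_def)
      qed
      then show ?thesis by (simp add: restr_face_koszul_d[OF less.prems(1)])
    qed
    ultimately obtain b0 where b0: "filtered_chain (insert m J) (Suc i) \<mu> b0"
      and db0: "\<And>A. dd (insert m J) b0 A = ?c' A"
      using K[OF m(2)] unfolding exact_at_def by blast
    have b0J: "filtered_chain J (Suc i) \<mu> b0" by (rule filtered_chain_subset[OF b0]) blast
    have b0f: "restr (face m \<mu> A) (b0 A) = b0 A" for A
      using b0 by (intro restr_id) (auto simp: filtered_chain_def lev_def face_def)
    let ?c1 = "\<lambda>A. c A - dd J b0 A"
    have c1: "filtered_chain J i \<mu> ?c1" using less.prems(1) filtered_chain_koszul_d[OF b0J] by (rule filtered_chain_diff)
    \<comment> \<open>\<open>b0\<close> lives on the face, so the face part of its boundary is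
      \<open>dd (insert m J) b0\<close>, which is the face part of \<open>c\<close>.\<close>
    have r0: "restr (face m \<mu> A) (?c1 A) = 0" for A
      unfolding restr_diff restr_face_koszul_d[OF b0J] by (simp only: b0f db0 diff_self)
    \<comment> \<open>Without its part on the face the chain lies one step higher in direction
      \<open>m\<close>; the induction is on the total distance to \<open>\<kappa>\<close>.\<close>
    let ?\<mu>' = "\<mu> + axis m 1"
    have mu': "?\<mu>' $ l = (if l = m then \<mu> $ m + 1 else \<mu> $ l)" for l by (simp add: axis_def)
    have c1': "filtered_chain J i ?\<mu>' ?c1"
      unfolding filtered_chain_def
    proof (intro conjI allI)
      show "chain D i ?c1" using c1 by (simp add: filtered_chain_def)
      fix A
      have lev: "lev J (\<mu> - nus A) (?c1 A)" using c1 by (simp add: filtered_chain_def)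
      show "lev J (?\<mu>' - nus A) (?c1 A)"
        unfolding lev_def
      proof (intro allI impI)
        fix q assume q: "cf (?c1 A) q \<noteq> 0"
        then have *: "(\<mu> - nus A) $ l \<le> wv q $ l" "l \<in> J \<Longrightarrow> wv q $ l = (\<mu> - nus A) $ l" for l
          using lev unfolding lev_def by blast+
        have "\<not> face m \<mu> A q"
          using arg_cong[OF r0[of A], of "\<lambda>f. cf f q"] q unfolding cf_restr by auto
        then have "wv q $ m \<noteq> (\<mu> - nus A) $ m" by (simp add: face_def)
        with * m(2) show "(\<forall>l. (?\<mu>' - nus A) $ l \<le> wv q $ l) \<and> (\<forall>l\<in>J. wv q $ l = (?\<mu>' - nus A) $ l)"
          unfolding vector_minus_component mu' by (auto split: if_splits)
      qed
    qed
    have dc1: "dd J ?c1 A = dd J c A" for A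
    proof -
      have "chain D (Suc i) b0" using b0 by (simp add: filtered_chain_def)
      then show ?thesis by (simp add: koszul_d_diff koszul_d_koszul_d[OF fin])
    qed
    have "(\<Sum>l\<in>UNIV. nat (\<kappa> $ l - ?\<mu>' $ l)) < (\<Sum>l\<in>UNIV. nat (\<kappa> $ l - \<mu> $ l))"
    proof (intro sum_strict_mono_ex1 ballI bexI)
      show "nat (\<kappa> $ l - ?\<mu>' $ l) \<le> nat (\<kappa> $ l - \<mu> $ l)" for l unfolding mu' by auto
      show "nat (\<kappa> $ m - ?\<mu>' $ m) < nat (\<kappa> $ m - \<mu> $ m)" using m(1) unfolding mu' by auto
    qed auto
    then have "\<exists>b. filtered_chain J (Suc i) ?\<mu>' b \<and> filtered_chain J i \<kappa> (\<lambda>A. ?c1 A - dd J b A)"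
    proof (rule less.hyps[OF _ c1'])
      show "lev J (\<kappa> - nus A) (dd J ?c1 A)" for A unfolding dc1 by (rule less.prems(2))
      show "?\<mu>' $ l \<le> \<kappa> $ l" for l using less.prems(3)[of l] m(1) unfolding mu' by auto
      show "?\<mu>' $ l = \<kappa> $ l" if "l \<in> J" for l using less.prems(4)[OF that] m(2) that unfolding mu' by auto
    qed
    then obtain b1 where b1: "filtered_chain J (Suc i) ?\<mu>' b1" "filtered_chain J i \<kappa> (\<lambda>A. ?c1 A - dd J b1 A)"
      by (elim exE conjE)
    have "filtered_chain J (Suc i) \<mu> b1"
    proof (rule filtered_chain_mono[OF b1(1)])
      show "\<mu> $ l \<le> ?\<mu>' $ l" for l unfolding mu' by auto
      show "\<mu> $ l = ?\<mu>' $ l" if "l \<in> J" for l using that m(2) unfolding mu' by auto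
    qed
    then have "filtered_chain J (Suc i) \<mu> (\<lambda>A. b0 A + b1 A)" by (rule filtered_chain_add[OF b0J])
    moreover have "filtered_chain J i \<kappa> (\<lambda>A. c A - dd J (\<lambda>A. b0 A + b1 A) A)"
      using b1(2) by (simp add: koszul_d_add diff_diff_eq)
    ultimately show ?thesis by blast
  qed
qed

lemma exact_at_of_koszul_acyclic:
  assumes ac: "\<And>J i. J \<noteq> {} \<Longrightarrow> card J \<le> i \<Longrightarrow> koszul_acyclic D (inp J) {0} i"
    and "J \<noteq> {}" "card J \<le> i"
  shows "exact_at J i"
  using assms(2,3)
proof (induction "card (UNIV - J)" arbitrary: J i rule: less_induct)
  case less
  have K: "exact_at (insert m J) (Suc i)" if "m \<notin> J" for m
  proof (rule less.hyps)
    have "UNIV - J = insert m (UNIV - insert m J)" using that by auto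
    then have "card (UNIV - J) = Suc (card (UNIV - insert m J))"
      by (metis Diff_iff card_insert_disjoint finite insertCI)
    then show "card (UNIV - insert m J) < card (UNIV - J)" by simp
  qed (use less.prems that in auto)
  show ?case
    unfolding exact_at_def
  proof (intro allI impI)
    fix \<mu> c assume c: "filtered_chain J i \<mu> c \<and> (\<forall>A. dd J c A = 0)"
    then obtain b where b: "chain D (Suc i) b" and db: "\<And>A. dd J b A = c A"
    proof -
      have "\<exists>b. chain D (Suc i) b \<and> (\<forall>A. c A - dd J b A \<in> {0})"
        using ac[OF less.prems] c unfolding koszul_acyclic_def filtered_chain_def by blast
      then show ?thesis by (elim exE conjE, intro that) auto
    qed
    \<comment> \<open>The initial forms are homogeneous in the directions \<open>J\<close>, so the
      part of \<open>b\<close> with the prescribed weights there has the same boundary.\<close>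
    let ?P = "\<lambda>A q. \<forall>l\<in>J. wv q $ l = (\<mu> - nus A) $ l"
    let ?b = "\<lambda>A. restr (?P A) (b A)"
    \<comment> \<open>Weights and \<open>\<nu>\<close> are nonnegative, so outside \<open>J\<close>
      the minimum with 0 is a level that any chain has; \<open>raise_level\<close> starts from
      it.\<close>
    define \<mu>' where "\<mu>' = (\<chi> l. if l \<in> J then \<mu> $ l else min (\<mu> $ l) 0)"
    have chb: "chain D (Suc i) ?b"
      unfolding chain_def
    proof (intro allI impI)
      fix A assume "?b A \<noteq> 0"
      have "b A \<noteq> 0"
      proof
        assume "b A = 0"
        with \<open>?b A \<noteq> 0\<close> show False by (simp only: restr_zero simp_thms)
      qed
      then show "A \<subseteq> D \<and> card A = Suc i" using b unfolding chain_def by blast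
    qed
    have CCb: "filtered_chain J (Suc i) \<mu>' ?b"
      unfolding filtered_chain_def
    proof (intro conjI allI chb)
      fix A
      show "lev J (\<mu>' - nus A) (?b A)"
      proof (cases "A \<subseteq> D")
        case False
        then have "?b A = 0" using chain_eq_0[OF chb, of A] by blast
        then show ?thesis by (simp only: lev_zero)
      next
        case True
        have n: "0 \<le> nus A $ l" for l
          using True nu_nonneg by (auto simp: sum_component intro!: sum_nonneg)
        have P: "(\<mu>' - nus A) $ l \<le> wv q $ l" "l \<in> J \<Longrightarrow> wv q $ l = (\<mu>' - nus A) $ l"
          if "?P A q" for q l
          using n[of l] wv_nonneg[of q l] that by (auto simp: \<mu>'_def)
        show ?thesis
          unfolding lev_def
        proof (intro allI impI)
          fix q assume "cf (?b A) q \<noteq> 0"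
          then have "?P A q" unfolding cf_restr by presburger
          then show "(\<forall>l. (\<mu>' - nus A) $ l \<le> wv q $ l) \<and> (\<forall>l\<in>J. wv q $ l = (\<mu>' - nus A) $ l)"
            using P by simp
        qed
      qed
    qed
    have db': "dd J ?b A = c A" for A
    proof -
      have "restr (?P A) (dd J b A) = koszul_d D (\<lambda>a. restr (\<lambda>_. True) (inp J a)) ?b A"
      proof (rule restr_koszul_d[OF b])
        fix A a x y
        assume *: "a \<in> D - A" "nus (insert a A) = \<nu> a + nus A" "cf (inp J a) x \<noteq> 0"
          "cf (b (insert a A)) y \<noteq> 0"
        have x: "wv x $ l = \<nu> a $ l" if "l \<in> J" for l
          using that *(3) by (simp add: inp_def split: if_splits)
        have "wv (x + y) $ l = (\<mu> - nus A) $ l \<longleftrightarrow> wv y $ l = (\<mu> - nus (insert a A)) $ l"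
          if "l \<in> J" for l
          using x[OF that] unfolding *(2) wv_add vector_add_component vector_minus_component
          by linarith
        then show "?P A (x + y) \<longleftrightarrow> True \<and> ?P (insert a A) y" by blast
      qed
      moreover have "(\<lambda>a. restr (\<lambda>_. True) (inp J a)) = inp J" by (simp add: restr_id)
      moreover have "restr (?P A) (c A) = c A"
        using c by (intro restr_id) (auto simp: filtered_chain_def lev_def)
      ultimately show ?thesis by (simp add: db)
    qed
    have levb: "lev J (\<mu> - nus A) (dd J ?b A)" for A
      using c unfolding db' filtered_chain_def by blast
    have "\<exists>b2. filtered_chain J (Suc (Suc i)) \<mu>' b2 \<and> filtered_chain J (Suc i) \<mu> (\<lambda>A. ?b A - dd J b2 A)"
      by (rule raise_level[OF K CCb levb]) (auto simp: \<mu>'_def)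
    then obtain b2 where b2: "filtered_chain J (Suc (Suc i)) \<mu>' b2"
      "filtered_chain J (Suc i) \<mu> (\<lambda>A. ?b A - dd J b2 A)"
      by (elim exE conjE)
    have chb2: "chain D (Suc (Suc i)) b2" using b2 by (simp add: filtered_chain_def)
    have "dd J (\<lambda>A. ?b A - dd J b2 A) A = c A" for A
      unfolding koszul_d_diff by (simp only: db' koszul_d_koszul_d[OF fin chb2] diff_zero)
    with b2(2) show "\<exists>b. filtered_chain J (Suc i) \<mu> b \<and> (\<forall>A. dd J b A = c A)" by blast
  qed
qed

text \<open>This is \<open>raise_level\<close> for \<open>J = {}\<close> in degree 1, where a chain
  is a tuple of coefficients and a boundary is a combination of the trivial relations
  \<open>g a * g b = g b * g a\<close>. The level of the corrected coefficients gives the strictness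
  of the ideal, and the level of \<open>\<beta>\<close> is used for regularity.\<close>

lemma raise_combination:
  assumes ac: "\<And>J i. J \<noteq> {} \<Longrightarrow> card J \<le> i \<Longrightarrow> koszul_acyclic D (inp J) {0} i"
    and \<alpha>: "\<And>a. a \<in> D \<Longrightarrow> lev {} (\<mu> - \<nu> a) (\<alpha> a)"
    and f: "lev {} \<kappa> (\<Sum>a\<in>D. g a * \<alpha> a)" and le: "\<And>l. \<mu> $ l \<le> \<kappa> $ l"
  shows "\<exists>\<beta>. (\<forall>a\<in>D. lev {} (\<kappa> - \<nu> a) (\<alpha> a - (\<Sum>b\<in>D - {a}. g b * \<beta> a b))) \<and>
    (\<forall>a\<in>D. \<forall>b\<in>D - {a}. lev {} (\<mu> - \<nu> a - \<nu> b) (\<beta> a b)) \<and>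
    (\<Sum>a\<in>D. g a * (\<alpha> a - (\<Sum>b\<in>D - {a}. g b * \<beta> a b))) = (\<Sum>a\<in>D. g a * \<alpha> a)"
proof -
  define c where "c A = (if \<exists>a\<in>D. A = {a} then \<alpha> (the_elem A) else 0)" for A
  have ca: "c {a} = \<alpha> a" if "a \<in> D" for a using that by (simp add: c_def)
  have chc: "chain D 1 c" by (auto simp: chain_def c_def)
  have c: "filtered_chain {} 1 \<mu> c"
    unfolding filtered_chain_def using chc \<alpha> by (auto simp: c_def)
  have kd0: "koszul_d D g e {} = (\<Sum>a\<in>D. g a * e {a})" for e
    by (simp add: koszul_d_def koszul_sign_def)
  have dc: "lev {} (\<kappa> - nus A) (dd {} c A)" for A
  proof (cases "A = {}")
    case True
    have "(\<Sum>a\<in>D. g a * c {a}) = (\<Sum>a\<in>D. g a * \<alpha> a)" by (intro sum.cong) (auto simp: ca)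
    then show ?thesis using f by (simp add: True kd0 inp_empty)
  next
    case False
    have "chain D 0 (dd {} c)" using chc by (intro chain_koszul_d[OF fin]) simp
    then have "dd {} c A = 0" using False fin finite_subset by (fastforce simp: chain_def)
    then show ?thesis by simp
  qed
  have "exact_at (insert m {}) 1" for m :: 'r
    by (rule exact_at_of_koszul_acyclic[OF ac]) auto
  then obtain b where b: "filtered_chain {} (Suc 1) \<mu> b" "filtered_chain {} 1 \<kappa> (\<lambda>A. c A - dd {} b A)"
    using raise_level[OF _ c dc le] by auto
  define \<beta> where "\<beta> a b' = koszul_sign b' {a} * b (insert b' {a})" for a b'
  have db: "dd {} b {a} = (\<Sum>b'\<in>D - {a}. g b' * \<beta> a b')" for a
    unfolding koszul_d_def inp_empty \<beta>_def by (intro sum.cong) (auto simp: mult_ac)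
  show ?thesis
  proof (intro exI[of _ \<beta>] conjI ballI)
    fix a assume a: "a \<in> D"
    have "lev {} (\<kappa> - nus {a}) (c {a} - dd {} b {a})" using b(2) unfolding filtered_chain_def by blast
    then show "lev {} (\<kappa> - \<nu> a) (\<alpha> a - (\<Sum>b\<in>D - {a}. g b * \<beta> a b))"
      using a by (simp add: ca db)
  next
    fix a b' assume b': "b' \<in> D - {a}"
    have "lev {} (\<mu> - nus (insert b' {a})) (b (insert b' {a}))" using b(1) unfolding filtered_chain_def by blast
    moreover have "\<mu> - nus (insert b' {a}) = \<mu> - \<nu> a - \<nu> b'" using b' by (simp add: algebra_simps)
    ultimately show "lev {} (\<mu> - \<nu> a - \<nu> b') (\<beta> a b')"
      unfolding \<beta>_def by (metis lev_koszul_sign)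
  next
    have "koszul_d D g (\<lambda>A. c A - dd {} b A) {} = koszul_d D g c {}"
    proof -
      have "chain D (Suc 1) b" using b(1) by (simp add: filtered_chain_def)
      then show ?thesis unfolding inp_empty koszul_d_diff by (simp only: koszul_d_koszul_d[OF fin] diff_zero)
    qed
    then have "(\<Sum>a\<in>D. g a * (c {a} - dd {} b {a})) = (\<Sum>a\<in>D. g a * c {a})" by (simp only: kd0)
    then show "(\<Sum>a\<in>D. g a * (\<alpha> a - (\<Sum>b\<in>D - {a}. g b * \<beta> a b))) = (\<Sum>a\<in>D. g a * \<alpha> a)"
      by (simp add: db ca cong: sum.cong)
  qed
qed

end

section \<open>Dimensions of quotients\<close>

context vector_space
begin

text \<open>The ambient space will be infinite-dimensional; here and below a finite set
  \<open>T\<close> witnesses that the dimension of \<open>S\<close> is finite.\<close>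

lemma subspace_basis_exists:
  assumes "subspace S" "S \<subseteq> span T" "finite T"
  obtains B where "B \<subseteq> S" "independent B" "span B = S" "finite B" "card B = dim S"
proof -
  obtain B where B: "B \<subseteq> S" "independent B" "S \<subseteq> span B" "card B = dim S"
    by (rule basis_exists)
  have "finite B" using independent_span_bound[OF assms(3) B(2)] B(1) assms(2) by blast
  moreover have "span B = S" using B assms(1) by (simp add: span_minimal subset_antisym)
  ultimately show ?thesis using B that by blast
qed

lemma dim_span_insert:
  assumes "subspace S" "S \<subseteq> span T" "finite T" "v \<notin> S"
  shows "dim (span (insert v S)) = Suc (dim S)"
proof -
  obtain B where B: "B \<subseteq> S" "independent B" "span B = S" "finite B" "card B = dim S"
    by (rule subspace_basis_exists[OF assms(1-3)])
  have ins: "independent (insert v B)" using B assms(4) by (intro independent_insertI) auto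
  have sS: "span S = S" using assms(1) by (simp add: span_eq_iff)
  have "span (insert v B) = span (insert v S)"
    unfolding span_insert B(3) sS ..
  then have "dim (span (insert v S)) = card (insert v B)"
    using dim_span_eq_card_independent[OF ins] by simp
  also have "\<dots> = Suc (card B)" using B assms(4) by (subst card_insert_disjoint) auto
  finally show ?thesis using B by simp
qed

lemma subspace_sum_image:
  assumes "subspace W" and add: "\<And>x y. F (x + y) = F x + F y" and scale: "\<And>a x. F (scale a x) = scale a (F x)"
    and "subspace S"
  shows "subspace {w + F c | w c. w \<in> W \<and> c \<in> S}"
proof (rule subspaceI)
  have "F 0 = 0" using scale[of 0 0] by simp
  then show "0 \<in> {w + F c | w c. w \<in> W \<and> c \<in> S}"
    using subspace_0[OF assms(1)] subspace_0[OF assms(4)] by (intro CollectI exI[of _ 0]) auto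
next
  fix x y assume "x \<in> {w + F c | w c. w \<in> W \<and> c \<in> S}" "y \<in> {w + F c | w c. w \<in> W \<and> c \<in> S}"
  then obtain w c w' c' where "x = w + F c" "y = w' + F c'" "w \<in> W" "w' \<in> W" "c \<in> S" "c' \<in> S"
    by blast
  then show "x + y \<in> {w + F c | w c. w \<in> W \<and> c \<in> S}"
    using subspace_add[OF assms(1)] subspace_add[OF assms(4)]
    by (intro CollectI exI[of _ "w + w'"] exI[of _ "c + c'"]) (simp add: add algebra_simps)
next
  fix a x assume "x \<in> {w + F c | w c. w \<in> W \<and> c \<in> S}"
  then obtain w c where "x = w + F c" "w \<in> W" "c \<in> S" by blast
  then show "scale a x \<in> {w + F c | w c. w \<in> W \<and> c \<in> S}"
    using subspace_scale[OF assms(1)] subspace_scale[OF assms(4)]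
    by (intro CollectI exI[of _ "scale a w"] exI[of _ "scale a c"]) (simp add: scale scale_right_distrib)
qed

lemma dim_sum_image:
  assumes W: "subspace W" "W \<subseteq> span T" "finite T"
    and add: "\<And>x y. F (x + y) = F x + F y" and scale: "\<And>a x. F (scale a x) = scale a (F x)"
    and "finite C" "independent C" and "\<And>c. c \<in> span C \<Longrightarrow> F c \<in> W \<Longrightarrow> c = 0"
  shows "dim {w + F c | w c. w \<in> W \<and> c \<in> span C} = dim W + card C"
  using assms(6-)
proof (induction C rule: finite_induct)
  case empty
  have "F 0 = 0" using scale[of 0 0] by simp
  then have "{w + F c | w c. w \<in> W \<and> c \<in> span {}} = W" by simp
  then show ?case by simp
next
  case (insert v C)
  have z: "F 0 = 0" using scale[of 0 0] by simp
  let ?S = "{w + F c | w c. w \<in> W \<and> c \<in> span C}"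
  have ind: "v \<notin> span C" "independent C"
    using insert.prems(1) insert.hyps(2) by (auto simp: independent_insert)
  have sub: "span C \<subseteq> span (insert v C)" by (rule span_mono) auto
  have IH: "dim ?S = dim W + card C"
    using ind sub insert.prems(2) by (intro insert.IH) auto
  have S: "subspace ?S" by (rule subspace_sum_image[OF W(1) add scale subspace_span])
  have "?S \<subseteq> span (T \<union> F ` C)"
  proof clarify
    fix w c assume wc: "w \<in> W" "c \<in> span C"
    have "w \<in> span (T \<union> F ` C)" using W(2) wc(1) span_mono[of T "T \<union> F ` C"] by blast
    moreover have "F c \<in> span (F ` C)" using wc(2)
    proof (induction rule: span_induct_alt)
      case base
      then show ?case using z by (simp add: span_zero)
    next
      case (step a x y)
      then show ?case by (simp add: add scale span_add span_scale span_base)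
    qed
    then have "F c \<in> span (T \<union> F ` C)" using span_mono[of "F ` C" "T \<union> F ` C"] by blast
    ultimately show "w + F c \<in> span (T \<union> F ` C)" by (rule span_add)
  qed
  moreover have "finite (T \<union> F ` C)" using W(3) insert.hyps(1) by simp
  moreover have "F v \<notin> ?S"
  proof
    assume "F v \<in> ?S"
    then obtain w c where wc: "F v = w + F c" "w \<in> W" "c \<in> span C" by blast
    have "F (v + - c) = w" using add[of "v + - c" c] wc(1) by simp
    moreover have "v + - c \<in> span (insert v C)"
      using sub wc(3) by (intro span_add span_neg) (auto intro: span_base)
    ultimately have "v + - c = 0" using insert.prems(2) wc(2) by blast
    then show False using wc(3) ind(1) by simp
  qed
  ultimately have e1: "dim (span (insert (F v) ?S)) = Suc (dim ?S)" by (intro dim_span_insert[OF S])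
  have e2: "span (insert (F v) ?S) = {w + F c | w c. w \<in> W \<and> c \<in> span (insert v C)}"
  proof (intro subset_antisym span_minimal)
    show "subspace {w + F c | w c. w \<in> W \<and> c \<in> span (insert v C)}"
      by (rule subspace_sum_image[OF W(1) add scale subspace_span])
    have "F v = 0 + F v" "v \<in> span (insert v C)" by (auto intro: span_base)
    then show "insert (F v) ?S \<subseteq> {w + F c | w c. w \<in> W \<and> c \<in> span (insert v C)}"
      using sub subspace_0[OF W(1)] by blast
    show "{w + F c | w c. w \<in> W \<and> c \<in> span (insert v C)} \<subseteq> span (insert (F v) ?S)"
    proof clarify
      fix w c assume wc: "w \<in> W" "c \<in> span (insert v C)"
      then obtain k where k: "c - scale k v \<in> span C" by (auto simp: span_insert)
      have "w + F c = (w + F (c - scale k v)) + scale k (F v)"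
        using add[of "c - scale k v" "scale k v"] by (simp add: scale)
      moreover have "w + F (c - scale k v) \<in> span (insert (F v) ?S)"
        using wc(1) k by (intro span_base) blast
      moreover have "scale k (F v) \<in> span (insert (F v) ?S)"
        by (intro span_scale span_base) simp
      ultimately show "w + F c \<in> span (insert (F v) ?S)" by (simp only: span_add)
    qed
  qed
  show ?case using e1 unfolding e2 IH card_insert_disjoint[OF insert.hyps(1,2)] by simp
qed

lemma complement_exists:
  assumes "subspace W" "subspace E" "W \<subseteq> E" "E \<subseteq> span T" "finite T"
  obtains C where "finite C" "C \<subseteq> E" "independent C" "span C \<inter> W \<subseteq> {0}"
    "E = {w + c | w c. w \<in> W \<and> c \<in> span C}" "card C + dim W = dim E"
proof -
  obtain B' where B': "B' \<subseteq> W" "independent B'" "span B' = W" "finite B'" "card B' = dim W"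
    by (rule subspace_basis_exists[OF assms(1) order_trans[OF assms(3,4)] assms(5)])
  have B'E: "B' \<subseteq> E" using B'(1) assms(3) by (rule order_trans)
  obtain B where B: "B' \<subseteq> B" "B \<subseteq> E" "independent B" "E \<subseteq> span B"
    by (rule maximal_independent_subset_extend[OF B'E B'(2)])
  have finB: "finite B" using independent_span_bound[OF assms(5) B(3)] B(2) assms(4) by blast
  have spB: "span B = E" using B assms(2) by (simp add: span_minimal subset_antisym)
  let ?C = "B - B'"
  have CB: "?C \<subseteq> B" by blast
  show ?thesis
  proof (rule that[of ?C])
    show "finite ?C" "?C \<subseteq> E" using finB B(2) by auto
    show "independent ?C" using B(3) CB independent_mono by blast
    have "c = 0" if c: "c \<in> span ?C" "c \<in> W" for c
    proof -
    \<comment> \<open>The coordinates of \<open>c\<close> in \<open>B\<close> are supported both in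
      \<open>B - B'\<close> and in \<open>B'\<close>.\<close>
    have "representation B c b = 0" for b
    proof -
      have "representation B c = representation ?C c" "representation B c = representation B' c"
        using representation_extend[OF B(3) c(1) CB] representation_extend[OF B(3) _ B(1), of c] c(2) B'(3)
        by auto
      then show ?thesis using representation_ne_zero[of ?C c b] representation_ne_zero[of B' c b] by auto
    qed
    moreover have "c \<in> span B" using c(1) span_mono[OF CB] by blast
    ultimately show ?thesis
      using sum_nonzero_representation_eq[OF B(3), of c] by simp
    qed
    then show "span ?C \<inter> W \<subseteq> {0}" by blast
  next
    have "B = B' \<union> ?C" using B(1) by blast
    then have "E = span (B' \<union> ?C)" using spB by simp
    then show "E = {w + c | w c. w \<in> W \<and> c \<in> span ?C}" unfolding span_Un B'(3) by auto
    have "card B = dim E" using dim_span_eq_card_independent[OF B(3)] spB by simp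
    then show "card ?C + dim W = dim E"
      using card_Diff_subset[OF B'(4) B(1)] card_mono[OF finB B(1)] B'(5) by simp
  qed
qed

text \<open>\<open>F\<close> induces an isomorphism of \<open>E / W'\<close> onto
  \<open>(W + F E) / W\<close>; comparing dimensions in additive form avoids natural number
  subtraction.\<close>

lemma dim_sum_image_subspace:
  assumes W: "subspace W" "W \<subseteq> span T" "finite T"
    and E: "subspace E" "E \<subseteq> span T'" "finite T'"
    and add: "\<And>x y. F (x + y) = F x + F y" and scale: "\<And>a x. F (scale a x) = scale a (F x)"
    and W': "subspace W'" "W' \<subseteq> E" "\<And>e. e \<in> E \<Longrightarrow> F e \<in> W \<longleftrightarrow> e \<in> W'"
  shows "dim {w + F e | w e. w \<in> W \<and> e \<in> E} + dim W' = dim W + dim E"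
proof -
  obtain C where C: "finite C" "C \<subseteq> E" "independent C" "span C \<inter> W' \<subseteq> {0}"
    "E = {w + c | w c. w \<in> W' \<and> c \<in> span C}" "card C + dim W' = dim E"
    by (rule complement_exists[OF W'(1) E(1) W'(2) E(2,3)])
  have CE: "span C \<subseteq> E" using C(2) E(1) by (rule span_minimal)
  have "{w + F e | w e. w \<in> W \<and> e \<in> E} = {w + F c | w c. w \<in> W \<and> c \<in> span C}"
  proof (intro subset_antisym; clarify)
    fix w e assume we: "w \<in> W" "e \<in> E"
    then obtain w' c where wc: "e = w' + c" "w' \<in> W'" "c \<in> span C" using C(5) by blast
    then have "F w' \<in> W" using W'(2,3) by blast
    then have "w + F w' \<in> W" by (rule subspace_add[OF W(1) we(1)])
    then show "\<exists>wa c. w + F e = wa + F c \<and> wa \<in> W \<and> c \<in> span C"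
      using wc by (intro exI[of _ "w + F w'"] exI[of _ c]) (simp add: add add.assoc)
  next
    fix w c assume "w \<in> W" "c \<in> span C"
    then show "\<exists>wa e. w + F c = wa + F e \<and> wa \<in> W \<and> e \<in> E" using CE by blast
  qed
  moreover have "dim {w + F c | w c. w \<in> W \<and> c \<in> span C} = dim W + card C"
  proof (rule dim_sum_image[OF W add scale C(1,3)])
    fix c assume c: "c \<in> span C" "F c \<in> W"
    then have "c \<in> W'" using W'(3)[OF subsetD[OF CE c(1)]] by simp
    with c(1) C(4) show "c = 0" by blast
  qed
  ultimately show ?thesis using C(6) by simp
qed

end

section \<open>Vector spaces of series and dimensions in quotient rings\<close>

lemma cst_add: "cst (a + b) = cst a + cst b"
  and cst_mult: "cst (a * b) = cst a * cst b"
  and cst_one: "cst 1 = 1"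
  and cst_zero: "cst 0 = 0"
  by (rule mps_eqI; simp add: cf_cst cf_one)+

interpretation mps: vector_space "\<lambda>a (f :: 'n::finite mps). cst a * f"
  by unfold_locales (simp_all add: distrib_left distrib_right cst_add cst_mult cst_one mult.assoc)

lemma subspace_convergent_mps: "mps.subspace convergent_mps"
  by (rule mps.subspaceI) (auto intro: convergent_mps_zero convergent_mps_add convergent_mps_mult cst_convergent)

lemma constants_O: "constants = cf ` range cst"
  by (auto simp: constants_def cst_def image_iff)

lemma subfield_constants: "subfield constants (\<O> :: 'n::finite series ring)"
proof (rule O.subfieldI)
  have sub: "subring constants (\<O> :: 'n series ring)"
  proof (rule O.subringI)
    show "constants \<subseteq> carrier (\<O> :: 'n series ring)"
      by (auto simp: constants_O carrier_O intro: cst_convergent)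
    show "\<one>\<^bsub>\<O>\<^esub> \<in> (constants :: 'n series set)" unfolding constants_O O_simps cst_one[symmetric] by blast
  next
    fix h :: "'n series" assume "h \<in> constants"
    then obtain a where a: "h = cf (cst a)" by (auto simp: constants_O)
    have "\<ominus>\<^bsub>\<O>\<^esub> h = cf (cst (- a))"
    proof (rule O.minus_equality)
      have "cst (- a) + cst a = (0 :: 'n mps)" unfolding cst_add[symmetric] by (simp add: cst_zero)
      then show "cf (cst (- a)) \<oplus>\<^bsub>\<O>\<^esub> h = \<zero>\<^bsub>\<O>\<^esub>" by (simp add: a O_simps)
    qed (auto simp: a carrier_O intro: cst_convergent)
    then show "\<ominus>\<^bsub>\<O>\<^esub> h \<in> constants" by (auto simp: constants_O)
  next
    fix h h' :: "'n series" assume "h \<in> constants" "h' \<in> constants"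
    then obtain a b where ab: "h = cf (cst a)" "h' = cf (cst b)" by (auto simp: constants_O)
    show "h \<otimes>\<^bsub>\<O>\<^esub> h' \<in> constants" "h \<oplus>\<^bsub>\<O>\<^esub> h' \<in> constants"
      unfolding ab O_simps cst_add[symmetric] cst_mult[symmetric] constants_O by blast+
  qed
  then show "subcring constants (\<O> :: 'n series ring)" by (rule O.subcringI')
  show "Units ((\<O> :: 'n series ring)\<lparr>carrier := constants\<rparr>) = constants - {\<zero>\<^bsub>\<O>\<^esub>}"
  proof (intro subset_antisym subsetI)
    fix h :: "'n series" assume "h \<in> Units (\<O>\<lparr>carrier := constants\<rparr>)"
    then have h: "h \<in> constants" "\<exists>h'\<in>constants. h' \<otimes>\<^bsub>\<O>\<^esub> h = \<one>\<^bsub>\<O>\<^esub>" by (auto simp: Units_def)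
    then obtain a b where ab: "h = cf (cst a)" "cf (cst b * cst a) = cf (1 :: 'n mps)"
      by (auto simp: constants_O O_simps)
    have "h \<noteq> cf 0"
    proof
      assume "h = cf 0"
      then have "cst a = (0 :: 'n mps)" using ab(1) by (simp add: cf_inject)
      with ab(2) have "(0 :: 'n mps) = 1" by (simp add: cf_inject)
      then show False by simp
    qed
    with h(1) show "h \<in> constants - {\<zero>\<^bsub>\<O>\<^esub>}" by (simp add: O_simps)
  next
    fix h :: "'n series" assume "h \<in> constants - {\<zero>\<^bsub>\<O>\<^esub>}"
    then obtain a where a: "h = cf (cst a)" "cf (cst a) \<noteq> cf (0 :: 'n mps)" by (auto simp: constants_O O_simps)
    then have "a \<noteq> 0" by (auto simp: cst_zero)
    then have inv: "cst (1 / a) * cst a = (1 :: 'n mps)" "cst a * cst (1 / a) = (1 :: 'n mps)"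
      unfolding cst_mult[symmetric] by (simp_all add: cst_one)
    have "cf (cst (1 / a)) \<otimes>\<^bsub>\<O>\<^esub> h = \<one>\<^bsub>\<O>\<^esub>" "h \<otimes>\<^bsub>\<O>\<^esub> cf (cst (1 / a)) = \<one>\<^bsub>\<O>\<^esub>"
      unfolding a(1) O_simps inv by simp_all
    moreover have "cf (cst (1 / a) :: 'n mps) \<in> constants" "h \<in> constants" by (auto simp: constants_O a(1))
    ultimately show "h \<in> Units (\<O>\<lparr>carrier := constants\<rparr>)" unfolding Units_def by auto
  qed
qed

text \<open>\<open>dimension\<close> grows by one \<open>line_extension\<close> at a time, and the
  elements of \<open>C\<close> are added in the same way; injectivity on the span keeps every new
  image outside the previous space.\<close>

lemma ring_dimension_image_span:
  fixes h :: "'n::finite series \<Rightarrow> 'b" and C :: "'n mps set"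
  assumes R: "ring R" and h: "h \<in> ring_hom \<O> R"
    and "finite C" "C \<subseteq> convergent_mps" "mps.independent C"
    and "\<And>c. c \<in> mps.span C \<Longrightarrow> h (cf c) = \<zero>\<^bsub>R\<^esub> \<Longrightarrow> c = 0"
  shows "ring.dimension R (card C) (h ` constants) ((\<lambda>c. h (cf c)) ` mps.span C)"
  using assms(3-)
proof (induction C rule: finite_induct)
  interpret ring R by fact
  interpret H: ring_hom_ring \<O> R h by (rule ring_hom_ringI2[OF O.ring_axioms R h])
  case empty
  have "h (cf 0) = \<zero>\<^bsub>R\<^esub>" using H.hom_zero unfolding O_simps .
  then have "(\<lambda>c. h (cf c)) ` mps.span {} = {\<zero>\<^bsub>R\<^esub>}"
    by (simp only: mps.span_empty image_insert image_empty)
  then show ?case by (simp only: card.empty zero_dim)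
next
  interpret ring R by fact
  interpret H: ring_hom_ring \<O> R h by (rule ring_hom_ringI2[OF O.ring_axioms R h])
  case (insert v C)
  have hadd: "h (cf (f + f')) = h (cf f) \<oplus>\<^bsub>R\<^esub> h (cf f')"
    and hmult: "h (cf (f * f')) = h (cf f) \<otimes>\<^bsub>R\<^esub> h (cf f')"
    if "f \<in> convergent_mps" "f' \<in> convergent_mps" for f f'
    using that H.hom_add[of "cf f" "cf f'"] H.hom_mult[of "cf f" "cf f'"]
    by (auto simp: O_simps carrier_O)
  have ind: "v \<notin> mps.span C" "mps.independent C"
    using insert.prems(2) insert.hyps(2) by (auto simp: mps.independent_insert)
  have sub: "mps.span C \<subseteq> mps.span (insert v C)" by (rule mps.span_mono) auto
  have spc: "mps.span (insert v C) \<subseteq> convergent_mps"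
    using insert.prems(1) subspace_convergent_mps by (rule mps.span_minimal)
  have vc: "v \<in> convergent_mps" using insert.prems(1) by simp
  let ?E = "(\<lambda>c. h (cf c)) ` mps.span C"
  have IH: "dimension (card C) (h ` constants) ?E"
    using ind sub insert.prems by (intro insert.IH) auto
  have "h (cf v) \<notin> ?E"
  proof
    assume "h (cf v) \<in> ?E"
    then obtain c where c: "c \<in> mps.span C" "h (cf v) = h (cf c)" by blast
    have cc: "c \<in> convergent_mps" using c(1) sub spc by blast
    have "v - c \<in> mps.span (insert v C)"
      using sub c(1) by (intro mps.span_diff) (auto intro: mps.span_base)
    moreover have "h (cf (v - c)) = \<zero>\<^bsub>R\<^esub>"
    proof -
      have vcc: "v - c \<in> convergent_mps" using vc cc by (rule convergent_mps_diff)
      have "h (cf v) = h (cf (v - c)) \<oplus>\<^bsub>R\<^esub> h (cf c)" using hadd[OF vcc cc] by simp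
      moreover have "h (cf (v - c)) \<in> carrier R" "h (cf c) \<in> carrier R"
        using vcc cc by (auto simp: carrier_O)
      ultimately show ?thesis using c(2) by (metis add.r_cancel_one' )
    qed
    ultimately have "v - c = 0" using insert.prems(3) by blast
    then show False using c(1) ind(1) by simp
  qed
  moreover have "h (cf v) \<in> carrier R" using vc by (auto simp: carrier_O)
  ultimately have "dimension (Suc (card C)) (h ` constants) (line_extension (h ` constants) (h (cf v)) ?E)"
    using IH by (intro Suc_dim)
  moreover have "line_extension (h ` constants) (h (cf v)) ?E = (\<lambda>c. h (cf c)) ` mps.span (insert v C)"
  proof (intro subset_antisym subsetI)
    fix x assume "x \<in> line_extension (h ` constants) (h (cf v)) ?E"
    then obtain a c where ac: "x = h (cf (cst a)) \<otimes>\<^bsub>R\<^esub> h (cf v) \<oplus>\<^bsub>R\<^esub> h (cf c)" "c \<in> mps.span C"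
      by (auto simp: line_extension_mem_iff constants_O)
    have "x = h (cf (cst a * v + c))"
      using ac sub spc vc by (subst hadd) (auto simp: hmult cst_convergent convergent_mps_mult)
    moreover have "cst a * v + c \<in> mps.span (insert v C)"
      using ac(2) sub by (intro mps.span_add mps.span_scale) (auto intro: mps.span_base)
    ultimately show "x \<in> (\<lambda>c. h (cf c)) ` mps.span (insert v C)" by blast
  next
    fix x assume "x \<in> (\<lambda>c. h (cf c)) ` mps.span (insert v C)"
    then obtain c where c: "x = h (cf c)" "c \<in> mps.span (insert v C)" by blast
    then obtain a where a: "c - cst a * v \<in> mps.span C" by (auto simp: mps.span_insert)
    have "h (cf (cst a * v + (c - cst a * v))) = h (cf (cst a)) \<otimes>\<^bsub>R\<^esub> h (cf v) \<oplus>\<^bsub>R\<^esub> h (cf (c - cst a * v))"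
      using a sub spc vc by (subst hadd) (auto simp: hmult cst_convergent convergent_mps_mult)
    then have "x = h (cf (cst a)) \<otimes>\<^bsub>R\<^esub> h (cf v) \<oplus>\<^bsub>R\<^esub> h (cf (c - cst a * v))" by (simp add: c(1))
    then show "x \<in> line_extension (h ` constants) (h (cf v)) ?E"
      using a by (auto simp: line_extension_mem_iff constants_O)
  qed
  ultimately show ?case using insert.hyps by simp
qed

lemma quot_dim_image_span:
  fixes h :: "'n::finite series \<Rightarrow> 'b" and C :: "'n mps set"
  assumes R: "ring R" and h: "h \<in> ring_hom \<O> R"
    and C: "finite C" "C \<subseteq> convergent_mps" "mps.independent C"
    and ker: "\<And>c. c \<in> mps.span C \<Longrightarrow> h (cf c) = \<zero>\<^bsub>R\<^esub> \<Longrightarrow> c = 0"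
  shows "ring.dim R (h ` constants) ((\<lambda>c. h (cf c)) ` mps.span C) = card C"
proof -
  interpret ring R by fact
  interpret H: ring_hom_ring \<O> R h by (rule ring_hom_ringI2[OF O.ring_axioms R h])
  let ?E = "(\<lambda>c. h (cf c)) ` mps.span C"
  have dimn: "dimension (card C) (h ` constants) ?E"
    by (rule ring_dimension_image_span[OF assms])
  show ?thesis
  proof (cases "\<one>\<^bsub>R\<^esub> = \<zero>\<^bsub>R\<^esub>")
    case False
    have "subfield (h ` constants) R" by (rule H.img_is_subfield(2)[OF subfield_constants False])
    from dimI[OF this dimn] show ?thesis by (simp add: over_def)
  next
    \<comment> \<open>The quotient is the zero ring when the ideal divided out is everything. The
      image of the constants is then no field, and the value 0 is obtained from the inductive
      definition of \<open>dimension\<close>.\<close>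
    case True
    then have carr: "carrier R = {\<zero>\<^bsub>R\<^esub>}" by (rule one_zeroD)
    have z: "n = 0" if "dimension n (h ` constants) F" for n F
      using that
    proof (cases rule: dimension.cases)
      case (Suc_dim v E m)
      have "E = {\<zero>\<^bsub>R\<^esub>}" using Suc_dim(5)
      proof (induction)
        case (Suc_dim v E n K)
        then show ?case using carr by auto
      qed simp
      with Suc_dim carr show ?thesis by auto
    qed simp
    have c0: "card C = 0" by (rule z[OF dimn])
    then have "(THE n. dimension n (h ` constants) ?E) = 0"
      by (intro the_equality) (use dimn z c0 in simp_all)
    then show ?thesis by (simp add: dim_def c0)
  qed
qed

section \<open>The graded pieces of the filtrations\<close>

lemma deg_ge_component: "q $ i \<le> tdeg q"
  unfolding tdeg_def by (rule member_le_sum) auto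

lemma finite_deg_le: "finite {q :: nat ^ 'n::finite. tdeg q \<le> N}"
proof (rule finite_subset[OF _ finite_le_vec])
  show "{q :: nat ^ 'n. tdeg q \<le> N} \<subseteq> {q. q \<le> (\<chi> i. N)}"
    using deg_ge_component order_trans by (fastforce simp: less_eq_vec_def)
qed

lemma exists_small_divisor:
  fixes q :: "nat ^ 'n::finite"
  assumes "N \<le> tdeg q" shows "\<exists>a. a \<le> q \<and> tdeg a = N"
  using assms
proof (induction "tdeg q" arbitrary: q)
  case 0
  then show ?case by (metis le_zero_eq order_refl)
next
  case (Suc m)
  show ?case
  proof (cases "N = tdeg q")
    case False
    have "q \<noteq> 0" using Suc.hyps(2) by (metis nat.distinct(1) tdeg_eq_0_iff)
    then obtain i where i: "0 < q $ i" by (auto simp: vec_eq_iff)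
    define q' where "q' = q - axis i 1"
    have q: "q = q' + axis i 1"
      using i by (auto simp: q'_def vec_eq_iff axis_def)
    have "tdeg (axis i 1 :: nat ^ 'n) = 1" by (simp add: tdeg_def axis_def)
    then have "tdeg q = Suc (tdeg q')" unfolding q tdeg_add by simp
    then obtain a where "a \<le> q'" "tdeg a = N" using Suc False by fastforce
    moreover have "q' \<le> q" unfolding q by (simp add: less_eq_vec_def)
    ultimately show ?thesis using order_trans[of a q' q] by blast
  qed (intro exI[of _ q], simp)
qed

lemma inj_zmon: "inj (zmon :: nat ^ 'n::finite \<Rightarrow> 'n mps)"
proof (rule injI)
  fix a b :: "nat ^ 'n" assume "zmon a = zmon b"
  then have "cf (zmon a) a = cf (zmon b) a" by simp
  then show "a = b" by (simp add: cf_zmon split: if_splits)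
qed

lemma independent_zmon:
  assumes "finite (Q :: (nat ^ 'n::finite) set)" shows "mps.independent (zmon ` Q :: 'n mps set)"
proof (rule mps.independent_if_scalars_zero)
  show "finite (zmon ` Q)" using assms by simp
  fix f :: "'n mps \<Rightarrow> complex" and x :: "'n mps"
  assume s: "(\<Sum>x\<in>zmon ` Q. cst (f x) * x) = 0" and "x \<in> zmon ` Q"
  then obtain q where q: "x = zmon q" "q \<in> Q" by blast
  have "0 = cf (\<Sum>x\<in>zmon ` Q. cst (f x) * x) q" by (simp only: s cf_zero)
  also have "\<dots> = cf (\<Sum>q'\<in>Q. cst (f (zmon q')) * zmon q') q"
    by (subst sum.reindex) (auto intro: inj_on_subset[OF inj_zmon])
  also have "\<dots> = (\<Sum>q'\<in>Q. if q = q' then f (zmon q') else 0)"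
    by (auto simp: cf_zmon intro!: sum.cong)
  also have "\<dots> = f x" using q assms by simp
  finally show "f x = 0" by simp
qed

lemma span_zmon:
  assumes "finite Q" shows "mps.span (zmon ` Q) = {f :: 'n::finite mps. \<forall>q. cf f q \<noteq> 0 \<longrightarrow> q \<in> Q}"
proof (intro subset_antisym mps.span_minimal subsetI)
  show "mps.subspace {f :: 'n mps. \<forall>q. cf f q \<noteq> 0 \<longrightarrow> q \<in> Q}"
    by (rule mps.subspaceI) (auto, metis add_0)
  fix f :: "'n mps" assume f: "f \<in> {f. \<forall>q. cf f q \<noteq> 0 \<longrightarrow> q \<in> Q}"
  have "f = (\<Sum>q\<in>Q. cst (cf f q) * zmon q)"
  proof (rule mps_eqI)
    fix q
    have "cf (\<Sum>q'\<in>Q. cst (cf f q') * zmon q') q = (\<Sum>q'\<in>Q. if q = q' then cf f q' else 0)"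
      by (auto simp: cf_zmon intro!: sum.cong)
    also have "\<dots> = (if q \<in> Q then cf f q else 0)" using assms by simp
    also have "\<dots> = cf f q" using f by auto
    finally show "cf f q = cf (\<Sum>q'\<in>Q. cst (cf f q') * zmon q') q" by simp
  qed
  moreover have "(\<Sum>q\<in>Q. cst (cf f q) * zmon q) \<in> mps.span (zmon ` Q)"
    by (intro mps.span_sum mps.span_scale mps.span_base imageI)
  ultimately show "f \<in> mps.span (zmon ` Q)" by simp
qed (auto simp: cf_zmon split: if_splits)

lemma cst_mult_left_commute: "f * (cst a * g) = cst a * (f * g)"
  by (rule mult.left_commute)

lemma (in ideal) rcos_eq_zero_iff:
  assumes "x \<in> carrier R" shows "I +> x = \<zero>\<^bsub>R Quot I\<^esub> \<longleftrightarrow> x \<in> I"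
proof -
  have "\<zero>\<^bsub>R Quot I\<^esub> = I" by (simp add: FactRing_def)
  then show ?thesis using rcos_const_imp_mem[OF assms] a_rcos_zero[OF is_ideal] by metis
qed

lemma cf_carrier_O: "f \<in> convergent_mps \<Longrightarrow> cf f \<in> carrier \<O>"
  by (simp add: carrier_O_iff)

text \<open>\<open>koszul_acyclic_inp\<close> is the codimension hypothesis in homological form.
  Positive weights make the graded pieces finite-dimensional.\<close>

locale newton_regular = newton_system p g \<nu> "{1..k}"
  for p :: "'r::finite \<Rightarrow> nat ^ 'n::finite" and g \<nu> k +
  assumes p_pos: "0 < p l $ i"
    and g_convergent: "a \<in> {1..k} \<Longrightarrow> g a \<in> convergent_mps"
    and g_0: "a \<in> {1..k} \<Longrightarrow> ord_ge 1 (g a)"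
    and koszul_acyclic_inp: "J \<noteq> {} \<Longrightarrow> card J \<le> d \<Longrightarrow> koszul_acyclic {1..k} (inp J) {0} d"
begin

lemma newton_system_initial_segment: "j \<le> k \<Longrightarrow> newton_system p g \<nu> {1..j}"
  by unfold_locales (use nu_le nu_nonneg in auto)

lemma koszul_acyclic_inp_initial_segment:
  assumes "j \<le> k" "J \<noteq> {}" "card J \<le> i" shows "koszul_acyclic {1..j} (inp J) {0} i"
proof (rule koszul_acyclic_initial_segment[OF assms(1) _ koszul_acyclic_inp[OF assms(2,3)]])
  fix a assume "a \<in> {1..k}"
  then have "ord_ge 1 (g a)" by (rule g_0)
  then show "ord_ge 1 (inp J a)" unfolding ord_ge_1_iff by (simp add: inp_def)
qed

abbreviation lv :: "int ^ 'r \<Rightarrow> 'n mps \<Rightarrow> bool" where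
  "lv \<equiv> lev {}"

lemma lv_iff: "lv \<mu> f \<longleftrightarrow> (\<forall>q. cf f q \<noteq> 0 \<longrightarrow> (\<forall>l. \<mu> $ l \<le> wv q $ l))"
  by (simp add: lev_def)

text \<open>The exponents of level \<open>\<mu>\<close> but not of level \<open>\<mu> + 1\<close>:
  their monomials represent a basis of the graded piece of \<open>\<O>\<close>.\<close>

definition QE :: "int ^ 'r \<Rightarrow> nat ^ 'n \<Rightarrow> bool" where
  "QE \<mu> q \<longleftrightarrow> (\<forall>l. \<mu> $ l \<le> wv q $ l) \<and> (\<exists>l. wv q $ l = \<mu> $ l)"

lemma deg_le_wv: "int (tdeg q) \<le> wv q $ l"
proof -
  have "int (q $ i) \<le> int (p l $ i) * int (q $ i)" for i
    using p_pos[of l i] mult_right_mono[of 1 "int (p l $ i)" "int (q $ i)"] by simp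
  then show ?thesis
    unfolding tdeg_def wv_def weight_def by (simp add: sum_mono)
qed

lemma finite_QE: "finite {q. QE \<mu> q}"
proof (rule finite_subset)
  show "{q. QE \<mu> q} \<subseteq> (\<Union>l. {q. tdeg q \<le> nat (\<mu> $ l)})"
  proof
    fix q assume "q \<in> {q. QE \<mu> q}"
    then obtain l where "wv q $ l = \<mu> $ l" by (auto simp: QE_def)
    with deg_le_wv[of q l] have "tdeg q \<le> nat (\<mu> $ l)" by linarith
    then show "q \<in> (\<Union>l. {q. tdeg q \<le> nat (\<mu> $ l)})" by blast
  qed
qed (simp add: finite_deg_le)

abbreviation rE :: "int ^ 'r \<Rightarrow> 'n mps \<Rightarrow> 'n mps" where
  "rE \<mu> \<equiv> restr (QE \<mu>)"

definition E :: "int ^ 'r \<Rightarrow> 'n mps set" where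
  "E \<mu> = {f. \<forall>q. cf f q \<noteq> 0 \<longrightarrow> QE \<mu> q}"

lemma E_eq_span: "E \<mu> = mps.span (zmon ` {q. QE \<mu> q})"
  unfolding E_def span_zmon[OF finite_QE] by simp

lemma subspace_E: "mps.subspace (E \<mu>)"
  unfolding E_eq_span by (rule mps.subspace_span)

lemma E_subset_span: "E \<mu> \<subseteq> mps.span (zmon ` {q. QE \<mu> q})" "finite (zmon ` {q. QE \<mu> q})"
  using finite_QE by (auto simp: E_eq_span)

lemma dim_E: "mps.dim (E \<mu>) = card {q. QE \<mu> q}"
  unfolding E_eq_span mps.dim_span_eq_card_independent[OF independent_zmon[OF finite_QE]]
  by (rule card_image) (rule inj_on_subset[OF inj_zmon], simp)

lemma rE_in_E: "rE \<mu> f \<in> E \<mu>"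
  by (simp add: E_def)

lemma rE_id: "f \<in> E \<mu> \<Longrightarrow> rE \<mu> f = f"
  by (intro restr_id) (simp add: E_def)

lemma lv_E: "f \<in> E \<mu> \<Longrightarrow> lv \<mu> f"
  by (simp add: E_def lv_iff QE_def)

lemma E_convergent: "f \<in> E \<mu> \<Longrightarrow> f \<in> convergent_mps"
  by (rule convergent_mps_finite, rule finite_subset[OF _ finite_QE[of \<mu>]]) (auto simp: E_def)

lemma restr_add: "restr P (f + f') = restr P f + restr P f'"
  by (rule mps_eqI) simp

lemma restr_cst: "restr P (cst a * f) = cst a * restr P f"
  by (rule mps_eqI) simp

lemma rE_lv_next: "lv (\<mu> + 1) f \<Longrightarrow> rE \<mu> f = 0"
proof (rule restr_eq_0)
  fix q assume "lv (\<mu> + 1) f" "cf f q \<noteq> 0"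
  then have "\<mu> $ l + 1 \<le> wv q $ l" for l by (simp add: lv_iff)
  then have "wv q $ l \<noteq> \<mu> $ l" for l by (metis zle_add1_eq_le less_irrefl)
  then show "\<not> QE \<mu> q" by (simp add: QE_def)
qed

lemma lv_diff_rE: "lv \<mu> f \<Longrightarrow> lv (\<mu> + 1) (f - rE \<mu> f)"
  unfolding lv_iff
proof (intro allI impI)
  fix q l assume f: "\<forall>q. cf f q \<noteq> 0 \<longrightarrow> (\<forall>l. \<mu> $ l \<le> wv q $ l)" and "cf (f - rE \<mu> f) q \<noteq> 0"
  then have "cf f q \<noteq> 0" "\<not> QE \<mu> q" by (auto split: if_splits)
  with f have "\<mu> $ l \<le> wv q $ l" "wv q $ l \<noteq> \<mu> $ l" by (auto simp: QE_def)
  then show "(\<mu> + 1) $ l \<le> wv q $ l" by simp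
qed

lemma lv_nextI: "lv \<mu> f \<Longrightarrow> rE \<mu> f = 0 \<Longrightarrow> lv (\<mu> + 1) f"
  using lv_diff_rE[of \<mu> f] by simp

lemma lv_next: "lv (\<mu> + 1) f \<Longrightarrow> lv \<mu> f"
  by (rule lev_mono) auto

lemma lv_g: "a \<in> {1..k} \<Longrightarrow> lv (\<nu> a) (g a)"
  using lev_inp[of a "{}"] by (simp add: inp_empty)

lemma lv_g_mult: "a \<in> {1..k} \<Longrightarrow> lv (\<mu> - \<nu> a) f \<Longrightarrow> lv \<mu> (g a * f)"
  using lev_mult[OF lv_g[of a], of "\<mu> - \<nu> a" f] by simp

text \<open>Multiplication by \<open>g a\<close> descends to graded pieces: what \<open>rE\<close>
  cuts off from \<open>f\<close> is carried to level \<open>\<mu> + 1\<close> and cut off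
  again.\<close>

lemma rE_g_mult:
  assumes "a \<in> {1..k}" "lv (\<mu> - \<nu> a) f"
  shows "rE \<mu> (g a * rE (\<mu> - \<nu> a) f) = rE \<mu> (g a * f)"
proof -
  have "lv (\<mu> - \<nu> a + 1) (f - rE (\<mu> - \<nu> a) f)" by (rule lv_diff_rE[OF assms(2)])
  then have "lv (\<mu> + 1 - \<nu> a) (f - rE (\<mu> - \<nu> a) f)" by (simp add: algebra_simps)
  from lv_g_mult[OF assms(1) this]
  have "rE \<mu> (g a * (f - rE (\<mu> - \<nu> a) f)) = 0" by (rule rE_lv_next)
  then show ?thesis by (simp add: right_diff_distrib restr_diff)
qed

text \<open>\<open>E \<mu>\<close> represents the quotient of the levels \<open>\<mu>\<close> and \<open>\<mu> + 1\<close> by polynomials. In it, \<open>W j \<mu>\<close> is the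
  contribution of the ideal generated by \<open>g 1, \<dots>, g j\<close>.\<close>

definition W :: "nat \<Rightarrow> int ^ 'r \<Rightarrow> 'n mps set" where
  "W j \<mu> = {rE \<mu> (\<Sum>a\<in>{1..j}. g a * e a) | e. \<forall>a\<in>{1..j}. e a \<in> E (\<mu> - \<nu> a)}"

text \<open>By \<open>rE_g_mult\<close> only the truncations of the coefficients matter. Formal
  coefficients may therefore be replaced by polynomials, which converge.\<close>

lemma W_I:
  assumes "j \<le> k" "\<And>a. a \<in> {1..j} \<Longrightarrow> lv (\<mu> - \<nu> a) (e a)"
  shows "rE \<mu> (\<Sum>a\<in>{1..j}. g a * e a) \<in> W j \<mu>"
proof -
  have "rE \<mu> (\<Sum>a\<in>{1..j}. g a * e a) = rE \<mu> (\<Sum>a\<in>{1..j}. g a * rE (\<mu> - \<nu> a) (e a))"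
    unfolding restr_sum using assms by (intro sum.cong refl rE_g_mult[symmetric]) auto
  then show ?thesis unfolding W_def
    by (intro CollectI exI[of _ "\<lambda>a. rE (\<mu> - \<nu> a) (e a)"]) (simp add: rE_in_E)
qed

lemma W_0: "W 0 \<mu> = {0}"
  by (auto simp: W_def)

lemma W_subset_E: "W j \<mu> \<subseteq> E \<mu>"
  unfolding W_def using rE_in_E by blast

lemma W_Suc:
  "W (Suc j) \<mu> = {w + rE \<mu> (g (Suc j) * e) | w e. w \<in> W j \<mu> \<and> e \<in> E (\<mu> - \<nu> (Suc j))}"
proof (intro subset_antisym subsetI)
  fix f assume "f \<in> W (Suc j) \<mu>"
  then obtain e where e: "f = rE \<mu> (\<Sum>a\<in>{1..Suc j}. g a * e a)" "\<forall>a\<in>{1..Suc j}. e a \<in> E (\<mu> - \<nu> a)"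
    by (auto simp: W_def)
  then have "f = rE \<mu> (\<Sum>a\<in>{1..j}. g a * e a) + rE \<mu> (g (Suc j) * e (Suc j))"
    by (simp add: restr_add)
  moreover have "rE \<mu> (\<Sum>a\<in>{1..j}. g a * e a) \<in> W j \<mu>" using e(2) by (auto simp: W_def)
  moreover have "e (Suc j) \<in> E (\<mu> - \<nu> (Suc j))" using e(2) by auto
  ultimately show "f \<in> {w + rE \<mu> (g (Suc j) * e) | w e. w \<in> W j \<mu> \<and> e \<in> E (\<mu> - \<nu> (Suc j))}"
    by blast
next
  fix f assume "f \<in> {w + rE \<mu> (g (Suc j) * e) | w e. w \<in> W j \<mu> \<and> e \<in> E (\<mu> - \<nu> (Suc j))}"
  then obtain w e where we: "f = w + rE \<mu> (g (Suc j) * e)" "w \<in> W j \<mu>" "e \<in> E (\<mu> - \<nu> (Suc j))"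
    by blast
  obtain e' where e': "w = rE \<mu> (\<Sum>a\<in>{1..j}. g a * e' a)" "\<forall>a\<in>{1..j}. e' a \<in> E (\<mu> - \<nu> a)"
    using we(2) by (auto simp: W_def)
  let ?e = "\<lambda>a. if a = Suc j then e else e' a"
  have "(\<Sum>a\<in>{1..j}. g a * ?e a) = (\<Sum>a\<in>{1..j}. g a * e' a)" by (intro sum.cong) auto
  then have "f = rE \<mu> (\<Sum>a\<in>{1..Suc j}. g a * ?e a)" by (simp add: we(1) e'(1) restr_add)
  moreover have "\<forall>a\<in>{1..Suc j}. ?e a \<in> E (\<mu> - \<nu> a)" using we(3) e'(2) by auto
  ultimately show "f \<in> W (Suc j) \<mu>" unfolding W_def by (intro CollectI exI[of _ ?e] conjI)
qed

lemma subspace_W: "mps.subspace (W j \<mu>)"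
proof (induction j)
  case 0
  then show ?case by (simp add: W_0)
next
  case (Suc j)
  show ?case
    unfolding W_Suc
    by (rule mps.subspace_sum_image[OF Suc _ _ subspace_E])
      (simp_all add: distrib_left restr_add cst_mult_left_commute restr_cst)
qed

text \<open>Multiplication by \<open>g (Suc j)\<close> is injective on the quotients \<open>E \<mu> / W j \<mu>\<close>.\<close>

lemma mult_in_W_iff:
  assumes j: "Suc j \<le> k" and e: "e \<in> E (\<mu> - \<nu> (Suc j))"
  shows "rE \<mu> (g (Suc j) * e) \<in> W j \<mu> \<longleftrightarrow> e \<in> W j (\<mu> - \<nu> (Suc j))"
proof
  let ?x = "Suc j"
  have x: "?x \<in> {1..k}" using j by simp
  assume "e \<in> W j (\<mu> - \<nu> ?x)"
  then obtain d where d: "e = rE (\<mu> - \<nu> ?x) (\<Sum>a\<in>{1..j}. g a * d a)"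
    "\<And>a. a \<in> {1..j} \<Longrightarrow> d a \<in> E (\<mu> - \<nu> ?x - \<nu> a)" by (auto simp: W_def)
  have lvd: "lv (\<mu> - \<nu> a) (g ?x * d a)" if "a \<in> {1..j}" for a
    using lv_E[OF d(2)[OF that]] by (intro lv_g_mult[OF x]) (simp add: algebra_simps)
  have "lv (\<mu> - \<nu> ?x) (\<Sum>a\<in>{1..j}. g a * d a)"
    using j by (intro lev_sum lv_g_mult lv_E d(2)) auto
  then have "rE \<mu> (g ?x * e) = rE \<mu> (g ?x * (\<Sum>a\<in>{1..j}. g a * d a))"
    unfolding d(1) by (rule rE_g_mult[OF x])
  also have "g ?x * (\<Sum>a\<in>{1..j}. g a * d a) = (\<Sum>a\<in>{1..j}. g a * (g ?x * d a))"
    by (simp add: sum_distrib_left mult.left_commute)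
  also have "rE \<mu> \<dots> \<in> W j \<mu>" using j lvd by (intro W_I) auto
  finally show "rE \<mu> (g ?x * e) \<in> W j \<mu>" .
next
  let ?x = "Suc j"
  have x: "?x \<in> {1..k}" using j by simp
  assume "rE \<mu> (g ?x * e) \<in> W j \<mu>"
  then obtain d where d: "rE \<mu> (g ?x * e) = rE \<mu> (\<Sum>a\<in>{1..j}. g a * d a)"
    "\<And>a. a \<in> {1..j} \<Longrightarrow> d a \<in> E (\<mu> - \<nu> a)" by (auto simp: W_def)
  \<comment> \<open>By assumption \<open>g ?x * e - \<Sum> g a * d a\<close> has level
    \<open>\<mu> + 1\<close>, one more than its coefficients promise; \<open>\<alpha>\<close> are
    these coefficients.\<close>
  define \<alpha> where "\<alpha> a = (if a = ?x then e else - d a)" for a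
  have lva: "lv (\<mu> - \<nu> a) (\<alpha> a)" if "a \<in> {1..?x}" for a
  proof (cases "a = ?x")
    case True
    then show ?thesis using lv_E[OF e] by (simp add: \<alpha>_def)
  next
    case False
    then have "lv (\<mu> - \<nu> a) (0 - d a)" using lv_E[OF d(2)] that by (intro lev_diff) auto
    then show ?thesis using False by (simp add: \<alpha>_def)
  qed
  have s: "(\<Sum>a\<in>{1..?x}. g a * \<alpha> a) = g ?x * e - (\<Sum>a\<in>{1..j}. g a * d a)"
    by (simp add: \<alpha>_def sum_negf[symmetric] cong: sum.cong_simp)
  have "lv \<mu> (\<Sum>a\<in>{1..?x}. g a * \<alpha> a)" using j lva by (intro lev_sum lv_g_mult) auto
  moreover have "rE \<mu> (\<Sum>a\<in>{1..?x}. g a * \<alpha> a) = 0" unfolding s restr_diff d(1) by simp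
  ultimately have lvs: "lv (\<mu> + 1) (\<Sum>a\<in>{1..?x}. g a * \<alpha> a)" by (rule lv_nextI)
  have le: "\<mu> $ l \<le> (\<mu> + 1) $ l" for l by simp
  have "\<exists>\<beta>. (\<forall>a\<in>{1..?x}. lv (\<mu> + 1 - \<nu> a) (\<alpha> a - (\<Sum>b\<in>{1..?x} - {a}. g b * \<beta> a b))) \<and>
      (\<forall>a\<in>{1..?x}. \<forall>b\<in>{1..?x} - {a}. lv (\<mu> - \<nu> a - \<nu> b) (\<beta> a b)) \<and>
      (\<Sum>a\<in>{1..?x}. g a * (\<alpha> a - (\<Sum>b\<in>{1..?x} - {a}. g b * \<beta> a b))) = (\<Sum>a\<in>{1..?x}. g a * \<alpha> a)"
    by (rule newton_system.raise_combination[OF newton_system_initial_segment[OF j] _ _ lvs le])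
      (rule koszul_acyclic_inp_initial_segment[OF j] lva; assumption)+
  then obtain \<beta> where
    \<beta>1: "\<forall>a\<in>{1..?x}. lv (\<mu> + 1 - \<nu> a) (\<alpha> a - (\<Sum>b\<in>{1..?x} - {a}. g b * \<beta> a b))"
    and \<beta>2: "\<forall>a\<in>{1..?x}. \<forall>b\<in>{1..?x} - {a}. lv (\<mu> - \<nu> a - \<nu> b) (\<beta> a b)"
    by (elim exE conjE)
  \<comment> \<open>The coefficient of \<open>?x\<close> is corrected only by multiples of the other
    \<open>g b\<close>, so up to the next level \<open>e\<close> is a combination of
    \<open>g 1, \<dots>, g j\<close>; the bound on \<open>\<beta>\<close> places it in
    \<open>W j\<close>.\<close>
  have D: "{1..?x} - {?x} = {1..j}" by auto
  have "lv (\<mu> - \<nu> ?x + 1) (e - (\<Sum>b\<in>{1..j}. g b * \<beta> ?x b))"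
    using bspec[OF \<beta>1, of ?x] unfolding D by (simp add: \<alpha>_def algebra_simps)
  then have "rE (\<mu> - \<nu> ?x) (e - (\<Sum>b\<in>{1..j}. g b * \<beta> ?x b)) = 0" by (rule rE_lv_next)
  then have "e = rE (\<mu> - \<nu> ?x) (\<Sum>b\<in>{1..j}. g b * \<beta> ?x b)"
    unfolding restr_diff rE_id[OF e] by simp
  moreover have "\<dots> \<in> W j (\<mu> - \<nu> ?x)"
  proof (rule W_I)
    show "j \<le> k" using j by simp
    have "?x \<in> {1..?x}" by simp
    from bspec[OF \<beta>2 this] show "lv (\<mu> - \<nu> ?x - \<nu> a) (\<beta> ?x a)" if "a \<in> {1..j}" for a
      unfolding D using that by (rule bspec)
  qed
  ultimately show "e \<in> W j (\<mu> - \<nu> ?x)" by simp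
qed

text \<open>The Hilbert function of the graded module modulo
  \<open>g 1, \<dots>, g j\<close>.\<close>

definition hdim :: "nat \<Rightarrow> int ^ 'r \<Rightarrow> int" where
  "hdim j \<mu> = int (mps.dim (E \<mu>)) - int (mps.dim (W j \<mu>))"

lemma hdim_0: "hdim 0 \<mu> = int (card {q. QE \<mu> q})"
  using mps.dim_span_eq_card_independent[OF mps.independent_empty]
  by (simp add: hdim_def W_0 dim_E)

text \<open>Dimension count in \<open>0 \<rightarrow> M (\<mu> - \<nu>) \<rightarrow> M \<mu>
  \<rightarrow> M' \<mu> \<rightarrow> 0\<close>, where \<open>M = E / W j\<close>,
  \<open>M' = E / W (Suc j)\<close>, and injectivity is \<open>mult_in_W_iff\<close>.\<close>

lemma hdim_Suc:
  assumes "Suc j \<le> k" shows "hdim (Suc j) \<mu> = hdim j \<mu> - hdim j (\<mu> - \<nu> (Suc j))"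
proof -
  let ?\<mu> = "\<mu> - \<nu> (Suc j)"
  have "mps.dim (W (Suc j) \<mu>) + mps.dim (W j ?\<mu>) = mps.dim (W j \<mu>) + mps.dim (E ?\<mu>)"
    unfolding W_Suc
  proof (rule mps.dim_sum_image_subspace)
    show "W j \<mu> \<subseteq> mps.span (zmon ` {q. QE \<mu> q})" using W_subset_E E_subset_span by blast
    show "rE \<mu> (g (Suc j) * (x + y)) = rE \<mu> (g (Suc j) * x) + rE \<mu> (g (Suc j) * y)" for x y
      by (simp add: distrib_left restr_add)
    show "rE \<mu> (g (Suc j) * (cst a * x)) = cst a * rE \<mu> (g (Suc j) * x)" for a x
      by (simp add: cst_mult_left_commute restr_cst)
  qed (use subspace_W subspace_E E_subset_span W_subset_E mult_in_W_iff[OF assms] in blast)+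
  then show ?thesis by (simp add: hdim_def)
qed

section \<open>Comparison with the filtrations of the two rings\<close>

lemma lv_mult: "lv \<mu> f \<Longrightarrow> lv \<mu> (r * f)"
proof -
  assume "lv \<mu> f"
  moreover have "lv 0 r" using wv_nonneg by (simp add: lv_iff)
  ultimately have "lv (0 + \<mu>) (r * f)" by (intro lev_mult)
  then show ?thesis by simp
qed

text \<open>A series of level \<open>\<mu>\<close> can have infinitely many monomials, but an
  element of the ideal is a finite combination. Finitely many monomials of level
  \<open>\<mu>\<close> divide all others of this level; grouping the terms by a chosen divisor gives
  the combination.\<close>

lemma filt_eq: "filt p \<mu> = cf ` {f \<in> convergent_mps. lv \<mu> f}"
proof (rule subset_antisym)
  have "ideal (cf ` {f \<in> convergent_mps. lv \<mu> f}) \<O>"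
    by (rule ideal_OI)
      (auto intro: convergent_mps_zero convergent_mps_add convergent_mps_mult lev_add lv_mult)
  moreover have "{monomial q | q. \<forall>l. \<mu> $ l \<le> weight (p l) q} \<subseteq> cf ` {f \<in> convergent_mps. lv \<mu> f}"
  proof clarify
    fix q assume "\<forall>l. \<mu> $ l \<le> weight (p l) q"
    then have "lv \<mu> (zmon q)" by (auto simp: lv_iff cf_zmon wv_def split: if_splits)
    moreover have "monomial q = cf (zmon q)" by (simp add: zmon_def)
    ultimately show "monomial q \<in> cf ` {f \<in> convergent_mps. lv \<mu> f}"
      using zmon_convergent by blast
  qed
  ultimately show "filt p \<mu> \<subseteq> cf ` {f \<in> convergent_mps. lv \<mu> f}"
    unfolding filt_def by (rule O.genideal_minimal)
next
  let ?S = "{monomial q | q. \<forall>l. \<mu> $ l \<le> weight (p l) q}"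
  have "?S \<subseteq> carrier \<O>"
  proof clarify
    fix q :: "nat ^ 'n"
    have "monomial q = cf (zmon q)" by (simp add: zmon_def)
    then show "monomial q \<in> carrier \<O>" using zmon_convergent by (auto simp: carrier_O)
  qed
  then have ide: "ideal (filt p \<mu>) \<O>" and base: "?S \<subseteq> filt p \<mu>"
    unfolding filt_def by (rule O.genideal_ideal, rule O.genideal_self)
  show "cf ` {f \<in> convergent_mps. lv \<mu> f} \<subseteq> filt p \<mu>"
  proof clarify
    fix f assume f: "f \<in> convergent_mps" "lv \<mu> f"
    \<comment> \<open>Weights are at least the degree, so every monomial of degree \<open>N\<close>
      has level \<open>\<mu>\<close>, and divisors of degree at most \<open>N\<close>
      suffice.\<close>
    define N where "N = nat (Max (range (($) \<mu>)))"
    have muN: "\<mu> $ l \<le> int N" for l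
    proof -
      have "\<mu> $ l \<le> Max (range (($) \<mu>))" by simp
      then show ?thesis unfolding N_def by linarith
    qed
    define M where "M = {a. tdeg a \<le> N \<and> (\<forall>l. \<mu> $ l \<le> wv a $ l)}"
    have finM: "finite M" by (rule finite_subset[OF _ finite_deg_le[of N]]) (auto simp: M_def)
    have "\<exists>a\<in>M. a \<le> q" if q: "\<forall>l. \<mu> $ l \<le> wv q $ l" for q
    proof (cases "tdeg q \<le> N")
      case True
      then show ?thesis using q by (intro bexI[of _ q]) (auto simp: M_def)
    next
      case False
      then obtain a where a: "a \<le> q" "tdeg a = N" using exists_small_divisor[of N q] by auto
      have "\<mu> $ l \<le> wv a $ l" for l using muN[of l] deg_le_wv[of a l] a(2) by simp
      then show ?thesis using a by (intro bexI[of _ a]) (auto simp: M_def)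
    qed
    then obtain m where m: "\<And>q. \<forall>l. \<mu> $ l \<le> wv q $ l \<Longrightarrow> m q \<in> M \<and> m q \<le> q" by metis
    \<comment> \<open>\<open>h a * zmon a\<close> will be the part of \<open>f\<close> whose
      monomials have \<open>a\<close> as chosen divisor.\<close>
    define h where "h a = Ms (\<lambda>q. if m (a + q) = a then cf f (a + q) else 0)" for a
    have f_eq: "f = (\<Sum>a\<in>M. h a * zmon a)"
    proof (rule mps_eqI)
      fix q
      have "cf (h a * zmon a) q = (if m q = a \<and> a \<le> q then cf f q else 0)" for a
      proof (cases "a \<le> q")
        case True
        then have "a + (q - a) = q" by (simp add: vec_eq_iff less_eq_vec_def)
        with True show ?thesis unfolding mult.commute[of "h a"] cf_zmon_mult by (simp add: h_def)
      qed (simp add: mult.commute[of "h a"] cf_zmon_mult)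
      then have "cf (\<Sum>a\<in>M. h a * zmon a) q = (\<Sum>a\<in>M. if m q = a then (if a \<le> q then cf f q else 0) else 0)"
        by (auto intro!: sum.cong)
      also have "\<dots> = (if m q \<in> M \<and> m q \<le> q then cf f q else 0)" using finM by simp
      also have "\<dots> = cf f q" using m[of q] f(2) by (auto simp: lv_iff)
      finally show "cf f q = cf (\<Sum>a\<in>M. h a * zmon a) q" by simp
    qed
    have mem: "cf (h a * zmon a) \<in> filt p \<mu>" if "a \<in> M" for a
    proof (rule ideal_O_mult[OF ide])
      show "h a \<in> convergent_mps"
        by (rule convergent_mps_shift[OF f(1), of _ a]) (simp add: h_def)
      have "\<forall>l. \<mu> $ l \<le> weight (p l) a" using that by (simp add: M_def wv_def)
      then show "cf (zmon a) \<in> filt p \<mu>" using base by (auto simp: zmon_def)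
    qed
    show "cf f \<in> filt p \<mu>" by (subst f_eq) (rule ideal_O_sum[OF ide mem])
  qed
qed

lemma ideal_filt: "ideal (filt p \<mu>) \<O>"
  unfolding filt_eq by (rule ideal_OI)
    (auto intro: convergent_mps_zero convergent_mps_add convergent_mps_mult lev_add lv_mult)

lemma cf_in_filt_iff: "cf f \<in> filt p \<mu> \<longleftrightarrow> f \<in> convergent_mps \<and> lv \<mu> f"
  unfolding filt_eq by (auto simp: cf_inject)

lemma L_series_ambient: "L_series \<O> constants (filt p) \<mu> = hdim 0 \<mu>"
proof -
  interpret I: ideal "filt p (\<mu> + 1)" \<O> by (rule ideal_filt)
  let ?R = "\<O> Quot filt p (\<mu> + 1)" and ?h = "(+>\<^bsub>\<O>\<^esub>) (filt p (\<mu> + 1))"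
  interpret R: ring ?R by (rule I.quotient_is_ring)
  interpret H: ring_hom_ring \<O> ?R ?h by (rule I.rcos_ring_hom_ring)
  let ?C = "zmon ` {q. QE \<mu> q}"
  have h0: "?h (cf f) = \<zero>\<^bsub>?R\<^esub> \<longleftrightarrow> lv (\<mu> + 1) f" if f: "f \<in> convergent_mps" for f
    using I.rcos_eq_zero_iff[OF cf_carrier_O[OF f]] f by (simp add: cf_in_filt_iff)
  have "ring.dim ?R (?h ` constants) ((\<lambda>c. ?h (cf c)) ` mps.span ?C) = card ?C"
  proof (rule quot_dim_image_span[OF R.ring_axioms I.rcos_ring_hom])
    show "finite ?C" using finite_QE by simp
    show "?C \<subseteq> convergent_mps" using zmon_convergent by blast
    show "mps.independent ?C" by (rule independent_zmon[OF finite_QE])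
    fix c assume "c \<in> mps.span ?C" "?h (cf c) = \<zero>\<^bsub>?R\<^esub>"
    then have c: "c \<in> E \<mu>" by (simp add: E_eq_span)
    then have "lv (\<mu> + 1) c" using h0[OF E_convergent] \<open>?h (cf c) = \<zero>\<^bsub>?R\<^esub>\<close> by simp
    then have "rE \<mu> c = 0" by (rule rE_lv_next)
    then show "c = 0" using rE_id[OF c] by simp
  qed
  moreover have "(\<lambda>c. ?h (cf c)) ` mps.span ?C = ?h ` filt p \<mu>"
  proof (intro subset_antisym subsetI)
    fix x assume "x \<in> (\<lambda>c. ?h (cf c)) ` mps.span ?C"
    then obtain c where c: "x = ?h (cf c)" "c \<in> E \<mu>" unfolding E_eq_span by (elim imageE)
    then have "cf c \<in> filt p \<mu>" by (simp add: cf_in_filt_iff lv_E E_convergent)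
    then show "x \<in> ?h ` filt p \<mu>" unfolding c(1) by (rule imageI)
  next
    fix x assume "x \<in> ?h ` filt p \<mu>"
    then obtain f where f: "x = ?h (cf f)" "f \<in> convergent_mps" "lv \<mu> f"
      unfolding filt_eq by (elim imageE CollectE conjE) simp
    have rc: "rE \<mu> f \<in> convergent_mps" by (rule E_convergent[OF rE_in_E])
    have dc: "f - rE \<mu> f \<in> convergent_mps" using f(2) rc by (rule convergent_mps_diff)
    have "cf f = cf (f - rE \<mu> f) \<oplus>\<^bsub>\<O>\<^esub> cf (rE \<mu> f)" by (simp add: O_simps)
    then have "x = ?h (cf (f - rE \<mu> f)) \<oplus>\<^bsub>?R\<^esub> ?h (cf (rE \<mu> f))"
      unfolding f(1) by (simp only: H.hom_add[OF cf_carrier_O[OF dc] cf_carrier_O[OF rc]])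
    also have "?h (cf (f - rE \<mu> f)) = \<zero>\<^bsub>?R\<^esub>" using h0[OF dc] lv_diff_rE[OF f(3)] by blast
    also have "\<zero>\<^bsub>?R\<^esub> \<oplus>\<^bsub>?R\<^esub> ?h (cf (rE \<mu> f)) = ?h (cf (rE \<mu> f))"
      by (intro R.l_zero H.hom_closed cf_carrier_O rc)
    finally have x: "x = ?h (cf (rE \<mu> f))" .
    show "x \<in> (\<lambda>c. ?h (cf c)) ` mps.span ?C"
      unfolding x using rE_in_E[of \<mu> f] unfolding E_eq_span by (rule imageI)
  qed
  moreover have "card ?C = card {q. QE \<mu> q}"
    by (rule card_image) (rule inj_on_subset[OF inj_zmon], simp)
  ultimately show ?thesis unfolding L_series_def quot_dim_def hdim_0 by simp
qed

text \<open>Let \<open>C\<close> be a basis of a complement of \<open>W k \<mu>\<close> in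
  \<open>E \<mu>\<close>. It spans the graded piece because \<open>W k \<mu>\<close> consists of
  elements of the ideal up to the next level. It stays independent because an element of the ideal
  of level \<open>\<mu>\<close> is a combination with coefficients of levels
  \<open>\<mu> - \<nu> a\<close>, whose truncation lies in \<open>W k \<mu>\<close>.\<close>

lemma L_series_quotient:
  assumes G: "G = (\<lambda>a. cf (g a)) ` {1..k}"
  shows "L_series (local_ring G) (residue_class G ` constants) (\<lambda>\<mu>. residue_class G ` filt p \<mu>) \<mu> = hdim k \<mu>"
proof -
  let ?I = "Idl\<^bsub>\<O>\<^esub> G" and ?\<pi> = "residue_class G" and ?A = "local_ring G"
  have Gc: "G \<subseteq> carrier \<O>" using g_convergent by (auto simp: G carrier_O)
  have I: "ideal ?I \<O>" by (rule O.genideal_ideal[OF Gc])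
  interpret I: ideal ?I \<O> by (rule I)
  have pi: "?\<pi> = (+>\<^bsub>\<O>\<^esub>) ?I" by (auto simp: residue_class_def)
  interpret P: ring_hom_ring \<O> ?A ?\<pi>
    unfolding pi local_ring_def by (rule I.rcos_ring_hom_ring)
  let ?F = "?\<pi> ` filt p (\<mu> + 1)"
  have F: "ideal ?F ?A"
    unfolding pi local_ring_def by (rule O.ring_ideal_imp_quot_ideal[OF I ideal_filt])
  interpret F: ideal ?F ?A by (rule F)
  let ?R = "?A Quot ?F" and ?q = "(+>\<^bsub>?A\<^esub>) ?F"
  interpret R: ring ?R by (rule F.quotient_is_ring)
  interpret Q: ring_hom_ring ?A ?R ?q by (rule F.rcos_ring_hom_ring)
  let ?h = "\<lambda>f. ?q (?\<pi> f)"
  have h: "?h \<in> ring_hom \<O> ?R"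
    by (rule ring_hom_memI) auto
  interpret H: ring_hom_ring \<O> ?R ?h by (rule ring_hom_ringI2[OF O.ring_axioms R.ring_axioms h])
  have pi0: "?\<pi> (cf f) = \<zero>\<^bsub>?A\<^esub> \<longleftrightarrow> cf f \<in> ?I" if "f \<in> convergent_mps" for f
    unfolding pi local_ring_def by (rule I.rcos_eq_zero_iff[OF cf_carrier_O[OF that]])
  have h0: "?h (cf f) = \<zero>\<^bsub>?R\<^esub> \<longleftrightarrow> ?\<pi> (cf f) \<in> ?F" if "f \<in> convergent_mps" for f
    by (rule F.rcos_eq_zero_iff[OF P.hom_closed[OF cf_carrier_O[OF that]]])
  have hF: "?h (cf f) = \<zero>\<^bsub>?R\<^esub>" if "f \<in> convergent_mps" "lv (\<mu> + 1) f" for f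
    using that by (subst h0) (auto intro!: imageI simp: cf_in_filt_iff)
  have hI: "?h (cf f) = \<zero>\<^bsub>?R\<^esub>" if "cf f \<in> ?I" for f
  proof -
    have "?\<pi> (cf f) = \<zero>\<^bsub>?A\<^esub>" using pi0[OF ideal_O_convergent[OF I that]] that by simp
    then show ?thesis by (simp only: Q.hom_zero)
  qed
  have padd: "?\<pi> (cf (f + f')) = ?\<pi> (cf f) \<oplus>\<^bsub>?A\<^esub> ?\<pi> (cf f')"
    and hadd: "?h (cf (f + f')) = ?h (cf f) \<oplus>\<^bsub>?R\<^esub> ?h (cf f')"
    if "f \<in> convergent_mps" "f' \<in> convergent_mps" for f f'
    using P.hom_add[OF cf_carrier_O[OF that(1)] cf_carrier_O[OF that(2)]]
      H.hom_add[OF cf_carrier_O[OF that(1)] cf_carrier_O[OF that(2)]]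
    unfolding O_simps by auto
  obtain C where C: "finite C" "C \<subseteq> E \<mu>" "mps.independent C" "mps.span C \<inter> W k \<mu> \<subseteq> {0}"
    "E \<mu> = {w + c | w c. w \<in> W k \<mu> \<and> c \<in> mps.span C}" "card C + mps.dim (W k \<mu>) = mps.dim (E \<mu>)"
    by (rule mps.complement_exists[OF subspace_W subspace_E W_subset_E E_subset_span])
  have spC: "mps.span C \<subseteq> E \<mu>" by (rule mps.span_minimal[OF C(2) subspace_E])
  have "ring.dim ?R (?h ` constants) ((\<lambda>c. ?h (cf c)) ` mps.span C) = card C"
  proof (rule quot_dim_image_span[OF R.ring_axioms h C(1) _ C(3)])
    show "C \<subseteq> convergent_mps" using C(2) E_convergent by blast
    fix c assume c: "c \<in> mps.span C" "?h (cf c) = \<zero>\<^bsub>?R\<^esub>"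
    have cE: "c \<in> E \<mu>" using c(1) spC by blast
    then have cc: "c \<in> convergent_mps" by (rule E_convergent)
    then have "?\<pi> (cf c) \<in> ?F" using c(2) h0 by simp
    then obtain f where f: "?\<pi> (cf c) = ?\<pi> (cf f)" "f \<in> convergent_mps" "lv (\<mu> + 1) f"
      unfolding filt_eq by (elim imageE CollectE conjE) simp
    have dc: "c - f \<in> convergent_mps" using cc f(2) by (rule convergent_mps_diff)
    have "?\<pi> (cf (c - f)) = \<zero>\<^bsub>?A\<^esub>"
    proof -
      have "?\<pi> (cf f) = ?\<pi> (cf (c - f)) \<oplus>\<^bsub>?A\<^esub> ?\<pi> (cf f)"
        using padd[OF dc f(2)] f(1) by simp
      moreover have "?\<pi> (cf (c - f)) \<in> carrier ?A" "?\<pi> (cf f) \<in> carrier ?A"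
        using dc f(2) by (auto intro!: P.hom_closed cf_carrier_O)
      ultimately show ?thesis using P.S.add.r_cancel_one'[of "?\<pi> (cf f)" "?\<pi> (cf (c - f))"] by simp
    qed
    then have "cf (c - f) \<in> ?I" using pi0[OF dc] by simp
    then have "c - f \<in> generated {1..k} g"
      unfolding G by (intro Idl_subset_generated g_convergent) auto
    then obtain \<alpha> where "c - f = (\<Sum>a\<in>{1..k}. \<alpha> a * g a)" by (auto simp: generated_def)
    then have cf: "c - f = (\<Sum>a\<in>{1..k}. g a * \<alpha> a)" by (simp add: mult.commute)
    \<comment> \<open>Ideal membership yields coefficients without any level; nonnegative weights
      and \<open>\<nu>\<close> give them at least the level \<open>\<mu>0 - \<nu> a\<close> to start
      from.\<close>
    define \<mu>0 where "\<mu>0 = (\<chi> l. min (\<mu> $ l) 0)"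
    have lva: "lv (\<mu>0 - \<nu> a) (\<alpha> a)" if "a \<in> {1..k}" for a
      unfolding lv_iff
    proof (intro allI impI)
      fix q l
      show "(\<mu>0 - \<nu> a) $ l \<le> wv q $ l"
        using wv_nonneg[of q l] nu_nonneg[OF that, of l] by (simp add: \<mu>0_def)
    qed
    have "lv \<mu> (c - f)" using lv_E[OF cE] lv_next[OF f(3)] by (rule lev_diff)
    then have lvs: "lv \<mu> (\<Sum>a\<in>{1..k}. g a * \<alpha> a)" by (simp add: cf)
    have le: "\<mu>0 $ l \<le> \<mu> $ l" for l by (simp add: \<mu>0_def)
    have "\<exists>\<beta>. (\<forall>a\<in>{1..k}. lv (\<mu> - \<nu> a) (\<alpha> a - (\<Sum>b\<in>{1..k} - {a}. g b * \<beta> a b))) \<and>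
        (\<forall>a\<in>{1..k}. \<forall>b\<in>{1..k} - {a}. lv (\<mu>0 - \<nu> a - \<nu> b) (\<beta> a b)) \<and>
        (\<Sum>a\<in>{1..k}. g a * (\<alpha> a - (\<Sum>b\<in>{1..k} - {a}. g b * \<beta> a b))) = (\<Sum>a\<in>{1..k}. g a * \<alpha> a)"
      by (rule raise_combination[OF _ _ lvs le]) (rule koszul_acyclic_inp lva; assumption)+
    then obtain \<beta> where \<beta>: "\<forall>a\<in>{1..k}. lv (\<mu> - \<nu> a) (\<alpha> a - (\<Sum>b\<in>{1..k} - {a}. g b * \<beta> a b))"
      "(\<Sum>a\<in>{1..k}. g a * (\<alpha> a - (\<Sum>b\<in>{1..k} - {a}. g b * \<beta> a b))) = (\<Sum>a\<in>{1..k}. g a * \<alpha> a)"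
      by (elim exE conjE)
    have "c = rE \<mu> (c - f) + rE \<mu> f" using rE_id[OF cE] by (simp add: restr_diff)
    also have "\<dots> = rE \<mu> (\<Sum>a\<in>{1..k}. g a * (\<alpha> a - (\<Sum>b\<in>{1..k} - {a}. g b * \<beta> a b)))"
      by (simp only: rE_lv_next[OF f(3)] cf \<beta>(2) add_0_right)
    also have "\<dots> \<in> W k \<mu>" by (rule W_I[OF order.refl bspec[OF \<beta>(1)]])
    finally show "c = 0" using c(1) C(4) by blast
  qed
  moreover have "(\<lambda>c. ?h (cf c)) ` mps.span C = ?h ` filt p \<mu>"
  proof (intro subset_antisym subsetI)
    fix x assume "x \<in> (\<lambda>c. ?h (cf c)) ` mps.span C"
    then obtain c where c: "x = ?h (cf c)" "c \<in> mps.span C" by (elim imageE)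
    then have "c \<in> E \<mu>" using spC by blast
    then have "cf c \<in> filt p \<mu>" by (simp add: cf_in_filt_iff lv_E E_convergent)
    then show "x \<in> ?h ` filt p \<mu>" unfolding c(1) by (rule imageI)
  next
    fix x assume "x \<in> ?h ` filt p \<mu>"
    then obtain f where f: "x = ?h (cf f)" "f \<in> convergent_mps" "lv \<mu> f"
      unfolding filt_eq by (elim imageE CollectE conjE) simp
    obtain w c where wc: "rE \<mu> f = w + c" "w \<in> W k \<mu>" "c \<in> mps.span C"
      using rE_in_E[of \<mu> f] C(5) by blast
    obtain e where e: "w = rE \<mu> (\<Sum>a\<in>{1..k}. g a * e a)" "\<And>a. a \<in> {1..k} \<Longrightarrow> e a \<in> E (\<mu> - \<nu> a)"
      using wc(2) by (auto simp: W_def)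
    let ?s = "\<Sum>a\<in>{1..k}. g a * e a"
    have cc: "c \<in> convergent_mps" using wc(3) spC E_convergent by blast
    have sI: "cf ?s \<in> ?I"
    proof (rule ideal_O_sum[OF I])
      fix a assume a: "a \<in> {1..k}"
      then have "cf (g a) \<in> ?I" using O.genideal_self[OF Gc] by (auto simp: G)
      from ideal_O_mult[OF I E_convergent[OF e(2)[OF a]] this]
      show "cf (g a * e a) \<in> ?I" by (simp only: mult.commute)
    qed
    have sc: "?s \<in> convergent_mps" by (rule ideal_O_convergent[OF I sI])
    \<comment> \<open>\<open>f\<close> is \<open>c\<close> plus an element of the ideal plus
      \<open>d\<close>; as \<open>d\<close> has no part in \<open>E \<mu>\<close>, it lies in the
      next level.\<close>
    define d where "d = f - c - ?s"
    have dc: "d \<in> convergent_mps" unfolding d_def by (intro convergent_mps_diff f(2) cc sc)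
    have "lv \<mu> ?s" by (intro lev_sum lv_g_mult lv_E e(2)) auto
    moreover have "lv \<mu> c" using wc(3) spC lv_E by blast
    ultimately have "lv \<mu> d" unfolding d_def using f(3) by (intro lev_diff)
    moreover have "rE \<mu> d = 0"
    proof -
      have "rE \<mu> c = c" using wc(3) spC rE_id by blast
      then show ?thesis unfolding d_def restr_diff e(1)[symmetric] wc(1) by simp
    qed
    ultimately have "lv (\<mu> + 1) d" by (rule lv_nextI)
    then have hdd: "?h (cf d) = \<zero>\<^bsub>?R\<^esub>" by (rule hF[OF dc])
    have "f = (d + ?s) + c" by (simp add: d_def)
    then have "x = ?h (cf ((d + ?s) + c))" using f(1) by simp
    also have "\<dots> = (?h (cf d) \<oplus>\<^bsub>?R\<^esub> ?h (cf ?s)) \<oplus>\<^bsub>?R\<^esub> ?h (cf c)"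
      by (simp only: hadd[OF convergent_mps_add[OF dc sc] cc] hadd[OF dc sc])
    also have "\<dots> = ?h (cf c)"
    proof -
      have "?h (cf c) \<in> carrier ?R" by (intro H.hom_closed cf_carrier_O cc)
      then show ?thesis unfolding hdd hI[OF sI] by simp
    qed
    finally have x: "x = ?h (cf c)" .
    show "x \<in> (\<lambda>c. ?h (cf c)) ` mps.span C" unfolding x using wc(3) by (rule imageI)
  qed
  moreover have "int (card C) = hdim k \<mu>" using C(6) by (simp add: hdim_def)
  ultimately show ?thesis unfolding L_series_def quot_dim_def by (simp add: image_image)
qed

end

section \<open>Poincare series\<close>

lemma lmult_superset:
  assumes "finite S" "Poly_Mapping.keys a \<subseteq> S"
  shows "(a \<star> B) \<mu> = (\<Sum>\<kappa>\<in>S. Poly_Mapping.lookup a \<kappa> * B (\<mu> - \<kappa>))"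
  unfolding lmult_def using assms by (intro sum.mono_neutral_left) (auto simp: in_keys_iff)

lemma lmult_single: "Poly_Mapping.single \<kappa> c \<star> B = (\<lambda>\<mu>. c * B (\<mu> - \<kappa>))"
  by (rule ext) (simp add: lmult_superset[of "{\<kappa>}"])

lemma lmult_diff: "(a - b) \<star> B = (\<lambda>\<mu>. (a \<star> B) \<mu> - (b \<star> B) \<mu>)"
proof
  fix \<mu>
  let ?S = "Poly_Mapping.keys a \<union> Poly_Mapping.keys b"
  have "Poly_Mapping.keys (a - b) \<subseteq> ?S" by (auto simp: in_keys_iff lookup_minus)
  then show "((a - b) \<star> B) \<mu> = (a \<star> B) \<mu> - (b \<star> B) \<mu>"
    by (simp add: lmult_superset[of ?S] lookup_minus left_diff_distrib sum_subtractf)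
qed

lemma lmult_diff_right: "a \<star> (\<lambda>\<mu>. B \<mu> - B' \<mu>) = (\<lambda>\<mu>. (a \<star> B) \<mu> - (a \<star> B') \<mu>)"
  by (auto simp: lmult_def right_diff_distrib sum_subtractf)

lemma lmult_zero: "0 \<star> B = (\<lambda>\<mu>. 0)"
  by (simp add: lmult_def)

lemma lmult_one: "1 \<star> B = B"
  using lmult_single[of 0 1 B] by (simp add: single_one)

text \<open>Laurent polynomials form the free abelian group on the exponents, so
  \<open>frag_induction\<close> reduces each factor to a single power of \<open>t\<close>, through
  differences.\<close>

lemma lmult_mult: "(a * b) \<star> B = a \<star> (b \<star> B)"
proof -
  have single: "(tpow \<kappa> * b) \<star> B = tpow \<kappa> \<star> (b \<star> B)" for \<kappa>
    by (rule frag_induction[of b UNIV])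
      (simp_all add: mult_single lmult_single lmult_zero lmult_diff right_diff_distrib
        lmult_diff_right diff_diff_eq add.commute)
  show ?thesis
    by (rule frag_induction[of a UNIV])
      (simp_all add: single lmult_zero lmult_diff left_diff_distrib)
qed

lemma lmult_commute: "a \<star> (b \<star> B) = b \<star> (a \<star> B)"
  by (metis lmult_mult mult.commute)

lemma power_series_lmult:
  assumes "\<And>l. 0 \<le> \<nu> $ l" "power_series B" shows "power_series ((1 - tpow \<nu>) \<star> B)"
  unfolding power_series_def
proof (intro allI impI)
  fix \<mu> l assume "((1 - tpow \<nu>) \<star> B) \<mu> \<noteq> 0"
  then have "B \<mu> \<noteq> 0 \<or> B (\<mu> - \<nu>) \<noteq> 0" by (auto simp: lmult_diff lmult_one lmult_single)
  then show "0 \<le> \<mu> $ l"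
  proof
    assume "B (\<mu> - \<nu>) \<noteq> 0"
    then have "\<forall>l. 0 \<le> (\<mu> - \<nu>) $ l" using assms(2) unfolding power_series_def by blast
    then have "0 \<le> \<mu> $ l - \<nu> $ l" by simp
    then show ?thesis using assms(1)[of l] by linarith
  next
    assume "B \<mu> \<noteq> 0"
    then show ?thesis using assms(2) unfolding power_series_def by blast
  qed
qed

lemma power_series_lmult_prod:
  assumes "finite A" "\<And>a l. a \<in> A \<Longrightarrow> 0 \<le> \<nu> a $ l" "power_series B"
  shows "power_series ((\<Prod>a\<in>A. 1 - tpow (\<nu> a)) \<star> B)"
  using assms(1,2)
proof (induction A)
  case empty
  then show ?case using assms(3) by (simp add: lmult_one)
next
  case (insert a A)
  then show ?case by (simp add: lmult_mult power_series_lmult)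
qed

text \<open>Two solutions differ by a function invariant under the shift by \<open>1\<close>.
  Shifting until one coordinate is negative, where power series vanish, shows that they
  agree.\<close>

lemma poincareI:
  fixes P :: "int ^ 'r::finite \<Rightarrow> int"
  assumes P: "power_series P"
    and eq: "(tpow 1 - 1) \<star> P = (\<Prod>l\<in>UNIV. tpow (axis l 1) - 1) \<star> L_series R K F"
  shows "poincare R K F = P"
  unfolding poincare_def
proof (rule the_equality)
  show "power_series P \<and> (tpow 1 - 1) \<star> P = (\<Prod>l\<in>UNIV. tpow (axis l 1) - 1) \<star> L_series R K F"
    using P eq by blast
  fix P' assume P': "power_series P' \<and> (tpow 1 - 1) \<star> P' =
      (\<Prod>l\<in>UNIV. tpow (axis l 1) - 1) \<star> L_series R K F"
  have "(tpow 1 - 1) \<star> P' = (tpow 1 - 1) \<star> P" using P' eq by simp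
  then have "((tpow 1 - 1) \<star> P') \<mu> = ((tpow 1 - 1) \<star> P) \<mu>" for \<mu> by simp
  then have step: "P' \<mu> - P \<mu> = P' (\<mu> - 1) - P (\<mu> - 1)" for \<mu>
    unfolding lmult_diff lmult_one lmult_single by (simp add: algebra_simps)
  have iter: "P' \<mu> - P \<mu> = P' (\<mu> - of_nat N) - P (\<mu> - of_nat N)" for \<mu> N
  proof (induction N)
    case (Suc N)
    then show ?case using step[of "\<mu> - of_nat N"] by (simp add: algebra_simps)
  qed simp
  show "P' = P"
  proof
    fix \<mu>
    fix l :: 'r
    define N where "N = nat (\<mu> $ l + 1)"
    have "(\<mu> - of_nat N) $ l = \<mu> $ l - int N" by (simp add: of_nat_index)
    then have "(\<mu> - of_nat N) $ l < 0" by (simp add: N_def)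
    then have "P' (\<mu> - of_nat N) = 0" "P (\<mu> - of_nat N) = 0"
      using P P' unfolding power_series_def by (meson not_le)+
    then show "P' \<mu> = P \<mu>" using iter[of \<mu> N] by simp
  qed
qed

text \<open>The factor \<open>t_l - 1\<close> telescopes the half-line
  \<open>\<mu> $ l \<le> w $ l\<close> to the point \<open>w $ l + 1\<close>.\<close>

lemma lmult_prod_axis_below:
  fixes w :: "int ^ 'r::finite"
  assumes "finite S"
  shows "(\<Prod>l\<in>S. tpow (axis l 1) - 1) \<star> (\<lambda>\<mu>. of_bool (\<forall>l. \<mu> $ l \<le> w $ l)) =
    (\<lambda>\<mu>. of_bool ((\<forall>l\<in>S. \<mu> $ l = w $ l + 1) \<and> (\<forall>l. l \<notin> S \<longrightarrow> \<mu> $ l \<le> w $ l)))"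
  using assms
proof (induction S)
  case empty
  then show ?case by (simp add: lmult_one)
next
  case (insert m S)
  define F where "F \<mu> \<longleftrightarrow> (\<forall>l\<in>S. \<mu> $ l = w $ l + 1) \<and> (\<forall>l. l \<notin> S \<longrightarrow> \<mu> $ l \<le> w $ l)"
    for \<mu> :: "int ^ 'r"
  define G where "G \<mu> \<longleftrightarrow> (\<forall>l\<in>S. \<mu> $ l = w $ l + 1) \<and> (\<forall>l. l \<notin> insert m S \<longrightarrow> \<mu> $ l \<le> w $ l)"
    for \<mu> :: "int ^ 'r"
  have F1: "F \<mu> \<longleftrightarrow> G \<mu> \<and> \<mu> $ m \<le> w $ m" for \<mu>
    using insert.hyps(2) unfolding F_def G_def by auto
  have ax: "(\<mu> - axis m 1) $ l = (if l = m then \<mu> $ m - 1 else \<mu> $ l)" for \<mu> :: "int ^ 'r" and l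
    by (simp add: axis_def)
  have G: "G (\<mu> - axis m 1) \<longleftrightarrow> G \<mu>" for \<mu>
    unfolding G_def ax using insert.hyps(2) by auto
  have F2: "F (\<mu> - axis m 1) \<longleftrightarrow> G \<mu> \<and> \<mu> $ m \<le> w $ m + 1" for \<mu>
    unfolding F1 G ax by auto
  have "(\<Prod>l\<in>insert m S. tpow (axis l 1) - 1) \<star> (\<lambda>\<mu>. of_bool (\<forall>l. \<mu> $ l \<le> w $ l)) =
      (tpow (axis m 1) - 1) \<star> (\<lambda>\<mu>. of_bool (F \<mu>) :: int)"
    unfolding prod.insert[OF insert.hyps] lmult_mult insert.IH F_def ..
  also have "\<dots> = (\<lambda>\<mu>. of_bool (F (\<mu> - axis m 1)) - of_bool (F \<mu>))"
    by (simp add: lmult_diff lmult_one lmult_single)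
  also have "\<dots> = (\<lambda>\<mu>. of_bool (G \<mu> \<and> \<mu> $ m = w $ m + 1))"
    unfolding F2 unfolding F1 by (rule ext) (auto simp: of_bool_def)
  also have "\<dots> = (\<lambda>\<mu>. of_bool ((\<forall>l\<in>insert m S. \<mu> $ l = w $ l + 1) \<and>
      (\<forall>l. l \<notin> insert m S \<longrightarrow> \<mu> $ l \<le> w $ l)))"
    by (rule ext) (auto simp: of_bool_def G_def)
  finally show ?case .
qed

section \<open>The Poincare series of both rings\<close>

context newton_regular
begin

lemma hdim_eq: "j \<le> k \<Longrightarrow> hdim j = (\<Prod>a\<in>{1..j}. 1 - tpow (\<nu> a)) \<star> hdim 0"
proof (induction j)
  case 0
  then show ?case by (simp add: lmult_one)
next
  case (Suc j)
  have "hdim (Suc j) = (1 - tpow (\<nu> (Suc j))) \<star> hdim j"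
    using hdim_Suc[OF Suc.prems] by (auto simp: lmult_diff lmult_one lmult_single)
  also have "\<dots> = ((1 - tpow (\<nu> (Suc j))) * (\<Prod>a\<in>{1..j}. 1 - tpow (\<nu> a))) \<star> hdim 0"
    using Suc by (simp add: lmult_mult)
  finally show ?case by (simp add: mult.commute)
qed

text \<open>The coefficients of the product of the series \<open>1 / (1 - t^{p^l})\<close> over the
  variables.\<close>

definition P0 :: "int ^ 'r \<Rightarrow> int" where
  "P0 \<mu> = int (card {q. wv q = \<mu>})"

lemma power_series_P0: "power_series P0"
  unfolding power_series_def
proof (intro allI impI)
  fix \<mu> l assume "P0 \<mu> \<noteq> 0"
  then have "{q. wv q = \<mu>} \<noteq> {}" unfolding P0_def by (metis card.empty of_nat_0)
  then show "0 \<le> \<mu> $ l" using wv_nonneg by auto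
qed

text \<open>With \<open>w = wv q\<close>, the monomial \<open>z^q\<close> contributes to
  \<open>hdim 0\<close> the orthant below \<open>w\<close> minus the orthant below
  \<open>w - 1\<close>. The product of the \<open>t_l - 1\<close> turns this into
  \<open>t^{w + 1} - t^w\<close>, which is \<open>t_1 \<cdots> t_r - 1\<close> times the
  contribution of \<open>z^q\<close> to \<open>P0\<close>.\<close>

lemma lmult_P0: "(tpow 1 - 1) \<star> P0 = (\<Prod>l\<in>UNIV. tpow (axis l 1) - 1) \<star> hdim 0"
proof
  fix \<mu> :: "int ^ 'r"
  let ?\<Pi> = "\<Prod>l\<in>(UNIV :: 'r set). tpow (axis l 1) - 1"
  let ?K = "Poly_Mapping.keys ?\<Pi>"
  \<comment> \<open>All exponents that count at \<open>\<mu>\<close> or at one of the finitely many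
    shifts involved; over this finite set the sums can be exchanged.\<close>
  define Q where "Q = (\<Union>\<kappa>\<in>?K. {q. QE (\<mu> - \<kappa>) q}) \<union> {q. QE (\<mu> - 1) q} \<union> {q. QE \<mu> q}"
  have fQ: "finite Q" using finite_QE by (simp add: Q_def)
  let ?b = "\<lambda>w \<mu>. of_bool (\<forall>l. \<mu> $ l \<le> w $ l) :: int"
  have QE_b: "of_bool (QE \<mu>' q) = ?b (wv q) \<mu>' - ?b (wv q - 1) \<mu>'" for \<mu>' q
  proof -
    have "QE \<mu>' q \<longleftrightarrow> (\<forall>l. \<mu>' $ l \<le> wv q $ l) \<and> \<not> (\<forall>l. \<mu>' $ l \<le> (wv q - 1) $ l)"
    proof -
      have "wv q $ l = \<mu>' $ l \<longleftrightarrow> \<not> \<mu>' $ l \<le> (wv q - 1) $ l" if "\<mu>' $ l \<le> wv q $ l" for l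
        using that by auto
      then show ?thesis unfolding QE_def by blast
    qed
    moreover have "(\<forall>l. \<mu>' $ l \<le> wv q $ l)" if "\<forall>l. \<mu>' $ l \<le> (wv q - 1) $ l"
    proof
      fix l
      have "\<mu>' $ l \<le> wv q $ l - 1" using that by simp
      then show "\<mu>' $ l \<le> wv q $ l" by simp
    qed
    ultimately show ?thesis by (auto simp: of_bool_def)
  qed
  have card_Q: "int (card {q. R q}) = (\<Sum>q\<in>Q. of_bool (R q))" if "{q. R q} \<subseteq> Q" for R
  proof -
    have "{q \<in> Q. R q} = {q. R q}" using that by blast
    then show ?thesis using fQ by (simp add: of_bool_def sum.If_cases Int_def)
  qed
  have "(?\<Pi> \<star> hdim 0) \<mu> = (\<Sum>\<kappa>\<in>?K. Poly_Mapping.lookup ?\<Pi> \<kappa> * (\<Sum>q\<in>Q. of_bool (QE (\<mu> - \<kappa>) q)))"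
    unfolding lmult_def hdim_0 by (intro sum.cong refl arg_cong2[where f = times] card_Q) (auto simp: Q_def)
  also have "\<dots> = (\<Sum>q\<in>Q. (?\<Pi> \<star> (\<lambda>\<mu>. of_bool (QE \<mu> q))) \<mu>)"
    unfolding lmult_def sum_distrib_left by (rule sum.swap)
  also have "\<dots> = (\<Sum>q\<in>Q. of_bool (wv q = \<mu> - 1) - of_bool (wv q = \<mu>))"
  proof (intro sum.cong refl)
    fix q
    have "(?\<Pi> \<star> (\<lambda>\<mu>. of_bool (QE \<mu> q))) \<mu> = (?\<Pi> \<star> ?b (wv q)) \<mu> - (?\<Pi> \<star> ?b (wv q - 1)) \<mu>"
      unfolding QE_b lmult_diff_right ..
    also have "\<dots> = of_bool (\<forall>l. \<mu> $ l = wv q $ l + 1) - of_bool (\<forall>l. \<mu> $ l = wv q $ l)"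
      unfolding lmult_prod_axis_below[OF finite] by simp
    also have "(\<forall>l. \<mu> $ l = wv q $ l + 1) \<longleftrightarrow> wv q = \<mu> - 1" by (auto simp: vec_eq_iff)
    also have "(\<forall>l. \<mu> $ l = wv q $ l) \<longleftrightarrow> wv q = \<mu>" by (auto simp: vec_eq_iff)
    finally show "(?\<Pi> \<star> (\<lambda>\<mu>. of_bool (QE \<mu> q))) \<mu> = of_bool (wv q = \<mu> - 1) - of_bool (wv q = \<mu>)" .
  qed
  also have "\<dots> = P0 (\<mu> - 1) - P0 \<mu>"
  proof -
    have "{q. wv q = \<mu> - 1} \<subseteq> Q" "{q. wv q = \<mu>} \<subseteq> Q" by (auto simp: Q_def QE_def)
    then show ?thesis unfolding P0_def by (simp only: card_Q sum_subtractf)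
  qed
  also have "\<dots> = ((tpow 1 - 1) \<star> P0) \<mu>" by (simp add: lmult_diff lmult_one lmult_single)
  finally show "((tpow 1 - 1) \<star> P0) \<mu> = (?\<Pi> \<star> hdim 0) \<mu>" by simp
qed

lemma poincare_ambient_eq: "poincare_ambient p = P0"
  unfolding poincare_ambient_def
proof (rule poincareI[OF power_series_P0])
  have "L_series \<O> constants (filt p) = hdim 0" using L_series_ambient by blast
  then show "(tpow 1 - 1) \<star> P0 = (\<Prod>l\<in>UNIV. tpow (axis l 1) - 1) \<star> L_series \<O> constants (filt p)"
    by (simp add: lmult_P0)
qed

lemma poincare_quot_eq:
  assumes "G = (\<lambda>a. cf (g a)) ` {1..k}"
  shows "poincare_quot p G = (\<Prod>a\<in>{1..k}. 1 - tpow (\<nu> a)) \<star> poincare_ambient p"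
  unfolding poincare_quot_def poincare_ambient_eq
proof (rule poincareI)
  let ?L = "L_series (local_ring G) (residue_class G ` constants) (\<lambda>\<mu>. residue_class G ` filt p \<mu>)"
  show "power_series ((\<Prod>a\<in>{1..k}. 1 - tpow (\<nu> a)) \<star> P0)"
    using nu_nonneg power_series_P0 by (intro power_series_lmult_prod) auto
  have L: "?L = (\<Prod>a\<in>{1..k}. 1 - tpow (\<nu> a)) \<star> hdim 0"
    using L_series_quotient[OF assms] hdim_eq[OF order.refl] by (simp add: fun_eq_iff)
  show "(tpow 1 - 1) \<star> (\<Prod>a\<in>{1..k}. 1 - tpow (\<nu> a)) \<star> P0 =
      (\<Prod>l\<in>UNIV. tpow (axis l 1) - 1) \<star> ?L"
    unfolding L lmult_commute[of "tpow 1 - 1"] lmult_P0 by (rule lmult_commute)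
qed

end

text \<open>Weights are nonnegative integers, so on a nonempty support the minimum is attained, and
  \<open>GREATEST\<close> denotes it.\<close>

lemma order_vec_le:
  assumes "q \<in> supp f" shows "order_vec p f $ l \<le> weight (p l) q"
    and order_vec_nonneg: "0 \<le> order_vec p f $ l"
proof -
  have nonneg: "0 \<le> weight (p l) q" for q by (simp add: weight_def sum_nonneg)
  obtain q0 where q0: "q0 \<in> supp f" "\<And>q. q \<in> supp f \<Longrightarrow> nat (weight (p l) q0) \<le> nat (weight (p l) q)"
    using ex_has_least_nat[of "\<lambda>q. q \<in> supp f" q "\<lambda>q. nat (weight (p l) q)"] assms by blast
  have min: "weight (p l) q0 \<le> weight (p l) q" if "q \<in> supp f" for q
    using q0(2)[OF that] nonneg[of q] nonneg[of q0] by simp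
  have "order_vec p f $ l = weight (p l) q0"
    unfolding order_vec_def vec_lambda_beta
    by (rule Greatest_equality) (use min q0(1) in auto)
  then show "order_vec p f $ l \<le> weight (p l) q" "0 \<le> order_vec p f $ l"
    using min[OF assms] nonneg[of q0] by auto
qed

section \<open>Normals of compact facets\<close>

lemma newton_polyhedron_add_axis:
  assumes "x \<in> newton_polyhedron f" "0 \<le> t"
  shows "x + axis i t \<in> newton_polyhedron f"
proof -
  let ?S = "{real_vec q + x | q x. q \<in> supp f \<and> (\<forall>i. 0 \<le> x $ i)}"
  have "(+) (axis i t) ` ?S \<subseteq> ?S"
  proof clarify
    fix q and y :: "real ^ 'a" assume "q \<in> supp f" "\<forall>i. 0 \<le> y $ i"
    then show "\<exists>q' y'. axis i t + (real_vec q + y) = real_vec q' + y' \<and> q' \<in> supp f \<and> (\<forall>i. 0 \<le> y' $ i)"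
      using assms(2) by (intro exI[of _ q] exI[of _ "y + axis i t"]) (auto simp: axis_def)
  qed
  then have "convex hull ((+) (axis i t) ` ?S) \<subseteq> convex hull ?S" by (rule hull_mono)
  then have "(+) (axis i t) ` newton_polyhedron f \<subseteq> newton_polyhedron f"
    unfolding newton_polyhedron_def convex_hull_translation .
  then show ?thesis using assms(1) by (auto simp: add.commute)
qed

text \<open>Above every point of the support the polyhedron contains a unit cube, so it has interior
  points.\<close>

lemma aff_dim_newton_polyhedron:
  assumes "newton_polyhedron f \<noteq> {}"
  shows "aff_dim (newton_polyhedron (f :: 'n::finite series)) = int CARD('n)"
proof -
  let ?S = "{real_vec q + x | q x. q \<in> supp f \<and> (\<forall>i. 0 \<le> x $ i)}"
  have "?S \<noteq> {}" using assms unfolding newton_polyhedron_def by simp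
  then obtain q where q: "q \<in> supp f" by blast
  have "cbox (real_vec q) (real_vec q + 1) \<subseteq> ?S"
  proof
    fix y assume "y \<in> cbox (real_vec q) (real_vec q + 1)"
    then have "\<forall>i. 0 \<le> (y - real_vec q) $ i" by (auto simp: mem_box_cart)
    moreover have "y = real_vec q + (y - real_vec q)" by simp
    ultimately show "y \<in> ?S" using q by blast
  qed
  then have "cbox (real_vec q) (real_vec q + 1) \<subseteq> newton_polyhedron f"
    unfolding newton_polyhedron_def using hull_subset[of ?S convex] by blast
  moreover have "real_vec q + (\<chi> i. 1 / 2) \<in> box (real_vec q) (real_vec q + 1)"
    by (auto simp: mem_box_cart)
  ultimately have "interior (newton_polyhedron f) \<noteq> {}"
    using interior_mono interior_cbox by blast
  then show ?thesis by (simp add: aff_dim_nonempty_interior)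
qed

text \<open>If the component \<open>i\<close> of the normal vanishes, then the facet contains a segment in the direction of
  the \<open>i\<close>th axis around each relative interior point. Such a segment lies inside a ray in the
  polyhedron, so the face contains a ray.\<close>

lemma facet_normal_pos:
  fixes f :: "'n::finite series"
  assumes "v \<in> facet_normals (newton_polyhedron f)" shows "0 < v $ i"
proof (rule ccontr)
  let ?D = "newton_polyhedron f" and ?e = "axis i 1 :: real ^ 'n"
  assume "\<not> 0 < v $ i"
  then have vi: "v $ i = 0" by simp
  obtain T where gcd: "Gcd (range (($) v)) = 1" and T: "T facet_of ?D" "compact T"
    and orth: "\<And>x y. x \<in> T \<Longrightarrow> y \<in> T \<Longrightarrow> real_vec v \<bullet> (x - y) = 0"
    using assms unfolding facet_normals_def by blast
  have v0: "real_vec v \<noteq> 0"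
  proof
    assume "real_vec v = 0"
    then have "v $ j = 0" for j by (simp add: real_vec_def vec_eq_iff)
    then have "range (($) v) = {0}" by auto
    then show False using gcd by simp
  qed
  have face: "T face_of ?D" and ne: "T \<noteq> {}" and dim: "aff_dim T = aff_dim ?D - 1"
    using T(1) by (auto simp: facet_of_def)
  have sub: "T \<subseteq> ?D" using face by (rule face_of_imp_subset)
  then have dimT: "aff_dim T = int CARD('n) - 1" using dim aff_dim_newton_polyhedron ne by auto
  obtain x where x: "x \<in> rel_interior T"
    using ne rel_interior_eq_empty[OF face_of_imp_convex[OF face]] by blast
  then have xT: "x \<in> T" using rel_interior_subset by blast
  let ?H = "{y. real_vec v \<bullet> y = real_vec v \<bullet> x}"
  \<comment> \<open>Both have dimension \<open>CARD('n) - 1\<close>, so the affine hull of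
    \<open>T\<close> is the whole hyperplane and contains the direction \<open>?e\<close>, because
    \<open>v $ i = 0\<close>.\<close>
  have "T \<subseteq> ?H" using orth[OF _ xT] by (auto simp: inner_diff_right)
  then have "affine hull T \<subseteq> ?H" by (intro hull_minimal affine_hyperplane)
  moreover have "aff_dim ?H = int CARD('n) - 1" using aff_dim_hyperplane[OF v0] by simp
  then have "\<not> affine hull T \<subset> affine hull ?H" using aff_dim_psubset[of T ?H] dimT by auto
  ultimately have H: "affine hull T = ?H" by (simp add: affine_hyperplane hull_same psubset_eq)
  obtain \<epsilon> where \<epsilon>: "\<epsilon> > 0" "cball x \<epsilon> \<inter> affine hull T \<subseteq> T"
    using x by (auto simp: mem_rel_interior_cball)
  have ve: "real_vec v \<bullet> ?e = 0" using vi by (simp add: inner_axis real_vec_def)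
  have "x - \<epsilon> *\<^sub>R ?e \<in> cball x \<epsilon> \<inter> affine hull T"
    using \<epsilon>(1) ve by (auto simp: H dist_norm inner_diff_right norm_axis_1)
  then have a: "x - \<epsilon> *\<^sub>R ?e \<in> T" using \<epsilon>(2) by blast
  have ray: "x + t *\<^sub>R ?e \<in> T" if t: "t > 0" for t
  proof -
    have "axis i t = t *\<^sub>R ?e" by (simp add: vec_eq_iff axis_def)
    then have xD: "x + t *\<^sub>R ?e \<in> ?D"
      using newton_polyhedron_add_axis[of x f t i] subsetD[OF sub xT] t by simp
    have "x \<in> open_segment (x - \<epsilon> *\<^sub>R ?e) (x + t *\<^sub>R ?e)"
    proof -
      have "?e \<noteq> 0" by (simp add: axis_eq_0_iff)
      then have "x - \<epsilon> *\<^sub>R ?e \<noteq> x + t *\<^sub>R ?e"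
        using \<epsilon>(1) t by (auto simp: diff_eq_eq add.assoc[symmetric] simp flip: scaleR_add_left)
      moreover have "x = (1 - \<epsilon> / (\<epsilon> + t)) *\<^sub>R (x - \<epsilon> *\<^sub>R ?e) + (\<epsilon> / (\<epsilon> + t)) *\<^sub>R (x + t *\<^sub>R ?e)"
      proof -
        have "(1 - \<epsilon> / (\<epsilon> + t)) * \<epsilon> = (\<epsilon> / (\<epsilon> + t)) * t" using \<epsilon>(1) t by (simp add: field_simps)
        then show ?thesis by (simp add: algebra_simps flip: scaleR_add_left)
      qed
      ultimately show ?thesis unfolding in_segment using \<epsilon>(1) t
        by (intro conjI exI[of _ "\<epsilon> / (\<epsilon> + t)"]) auto
    qed
    from face_ofD[OF face this subsetD[OF sub a] xD xT] show ?thesis by (rule conjunct2)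
  qed
  obtain B where B: "\<And>y. y \<in> T \<Longrightarrow> norm y \<le> B"
    using compact_imp_bounded[OF T(2)] by (auto simp: bounded_iff)
  define t where "t = B + norm x + 1"
  have "0 \<le> B" using B[OF xT] norm_ge_zero order_trans by blast
  then have t: "t > 0" by (simp add: t_def add_nonneg_pos)
  have "t = norm (t *\<^sub>R ?e)" using t by (simp add: norm_axis_1)
  also have "\<dots> \<le> norm (x + t *\<^sub>R ?e) + norm x" using norm_triangle_ineq4[of "x + t *\<^sub>R ?e" x] by simp
  also have "\<dots> \<le> B + norm x" using B[OF ray[OF t]] by simp
  finally show False by (simp add: t_def)
qed

theorem theorem1p1:
  fixes g :: "nat \<Rightarrow> 'n::finite series"
    and k :: nat
    and p :: "'r::finite \<Rightarrow> nat ^ 'n"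
  assumes "\<And>j. j \<in> {1..k} \<Longrightarrow> g j \<in> carrier \<O>"
    and "\<And>j. j \<in> {1..k} \<Longrightarrow> convenient (g j)"
    and "\<And>j. j \<in> {1..k} \<Longrightarrow> g j 0 = 0"
    and "complete_intersection k g"
    and "bij_betw p UNIV (facet_normals (newton_polyhedron (finprod \<O> g {1..k})))"
    and "\<And>J. J \<noteq> {} \<Longrightarrow>
           codim ((\<lambda>i. initial_part p J (g i)) ` {1..k}) \<ge> ereal (real k - real (card J) + 1)"
  shows "poincare_quot p (g ` {1..k}) =
           (\<Prod>j\<in>{1..k}. 1 - tpow (order_vec p (g j))) \<star> poincare_ambient p"
proof -
  \<comment> \<open>A convenient series is nonzero, so the components of \<open>order_vec\<close>
    are attained minima.\<close>
  have supp: "\<exists>q. q \<in> supp (g a)" if "a \<in> {1..k}" for a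
    using assms(2)[OF that] by (auto simp: convenient_def)
  interpret NS: newton_system p "\<lambda>a. Ms (g a)" "\<lambda>a. order_vec p (g a)" "{1..k}"
  proof
    show "order_vec p (g a) $ l \<le> weight (p l) q" if "cf (Ms (g a)) q \<noteq> 0" for a q l
      using that by (intro order_vec_le) (simp add: supp_def)
    show "0 \<le> order_vec p (g a) $ l" if "a \<in> {1..k}" for a l
      using supp[OF that] order_vec_nonneg by blast
  qed simp
  have inp: "cf (NS.inp J a) = initial_part p J (g a)" for J a
    by (rule ext) (simp add: NS.inp_def NS.wv_def initial_part_def)
  have conv: "Ms (g a) \<in> convergent_mps" if "a \<in> {1..k}" for a
    using assms(1)[OF that] by (simp add: carrier_O_iff)
  have g0: "ord_ge 1 (Ms (g a))" if "a \<in> {1..k}" for a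
    using assms(3)[OF that] unfolding ord_ge_1_iff by simp
  interpret NR: newton_regular p "\<lambda>a. Ms (g a)" "\<lambda>a. order_vec p (g a)" k
  proof
    show "0 < p l $ i" for l i
      using assms(5) by (intro facet_normal_pos) (auto simp: bij_betw_def)
    show "koszul_acyclic {1..k} (NS.inp J) {0} d" if J: "J \<noteq> {}" "card J \<le> d" for J d
    proof (rule koszul_acyclic_of_krull_dim[OF _ _ _ J(2)])
      fix a assume a: "a \<in> {1..k}"
      show "NS.inp J a \<in> convergent_mps"
        by (rule convergent_mps_restrict[OF conv[OF a]]) (simp add: NS.inp_def)
      show "ord_ge 1 (NS.inp J a)"
        using g0[OF a] unfolding ord_ge_1_iff by (simp add: NS.inp_def)
    next
      let ?K = "krull_dim (local_ring ((\<lambda>a. cf (NS.inp J a)) ` {1..k}))"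
      have "ereal (real k - real (card J) + 1) \<le> ereal (real CARD('n)) - ?K"
        using assms(6)[OF J(1)] by (simp add: codim_def inp)
      \<comment> \<open>\<open>?K\<close> is an extended real; the subtraction is undone separately
        for finite and infinite values.\<close>
      then show "?K \<le> ereal (real CARD('n) - (real k - real (card J) + 1))"
        by (cases ?K) auto
    qed
    show "Ms (g a) \<in> convergent_mps" if "a \<in> {1..k}" for a by (rule conv[OF that])
    show "ord_ge 1 (Ms (g a))" if "a \<in> {1..k}" for a by (rule g0[OF that])
  qed
  show ?thesis by (rule NR.poincare_quot_eq) simp
qed

end
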